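(* Let $x,y,z$ be non-negative integers and let $\mathbf a=(a_1,\dots,a_m)$, $\mathbf b=(b_1,\dots,b_n)$ be two sequences of non-negative integers. Put $\mu=2\lfloor\frac{m+1}{2}\rfloor$, $\mu'=2\lceil\frac{m-1}{2}\rceil$, $\nu=2\lfloor\frac{n+1}{2}\rfloor$, $\nu'=2\lceil\frac{n-1}{2}\rceil$, and $$\mathbf t^{+}=(0,a_1,\dots,a_{\mu-1},\,a_{\mu}+x+y+b_{\nu},\,b_{\nu-1},\dots,b_1),\qquad \mathbf t^{-}=(a_1,\dots,a_{\mu'},\,a_{\mu'+1}+x+y+b_{\nu'+1},\,b_{\nu'},\dots,b_1,z).$$ Then $$M(N^{(2)}_{x,y,z}(\mathbf a;\mathbf b))=\frac{M(N^{(2)}_{x+y,0,z}(\mathbf a;\mathbf b))\,M(N^{(2)}_{0,y,z}(\mathbf a;\mathbf b))}{M(N^{(2)}_{y,0,z}(\mathbf a;\mathbf b))}\cdot\frac{T(x+1,2a+b+2y+z-1,y)\,T(x+a+1,b+2y+z-1,y)}{T(1,2a+b+2y+z-1,y)\,T(a+1,b+2y+z-1,y)}$$ $$=2^{a_1-y}\,Q'(\mathbf t^{+})\,K(\mathbf t^{-})\cdot\frac{H_2(2o_a+2o_b+1)\,H_2(2e_a+2e_b+2z)}{H_2(2o_a+2o_b+2y+1)\,H_2(2e_a+2e_b+2y+2z)}\cdot\frac{H(2a+b+2y+z)\,H(b+y+z)}{H(2a+b+y+z)\,H(b+z)}$$ $$\cdot\frac{T(x+1,2a+b+2y+z-1,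y)\,T(x+a+1,b+2y+z-1,y)}{T(1,2a+b+2y+z-1,y)\,T(a+1,b+2y+z-1,y)}.$$
   Context: Lattice and tilings. For real $u,k$ let $[u;k]$ be the point of the plane with Cartesian coordinates $(u,\frac{\sqrt3}{2}k)$. The triangular lattice has as vertices all $[u;k]$ with $k\in\mathbb Z$, $u-k/2\in\mathbb Z$; its faces are unit equilateral triangles, up-pointing or down-pointing. A region is a finite union of unit triangles. A lozenge is the union of two unit triangles sharing an edge; it is vertical if that edge is horizontal. A tiling of a region is a covering of it by lozenges contained in it, without gaps or overlaps. $M(R)$ is the sum of the weights of all tilings of $R$, the weight of a tiling being the product of the weights of its lozenges; lozenges have weight $1$ unless stated otherwise; $M(\emptyset)=1$. Sequences. $a=\sum a_i$, $b=\sum b_j$; $o_a,e_a$ are the sums of the $a_i$ with $i$ odd, resp. even; $o_b,e_b$ likewise. $a_i=0$ for $i>m$, $b_j=0$ for $j>n$; an empty sequence is treated as the one-term sequence $(0)$. Functions. $H(n)=\prod_{i=0}^{n-1}i!$; $H_2(n)=\prod_{i=1}^{\lfloor n/2\rfloor}(n-2i)!$; for $n\ge0$, $(x)_n=x(x+1)\cdots(x+n-1)$ ($1$ for $n=0$); $T(x,n,m)=\prod_{i=0}^{m-1}(x+i)_{n-2i}$. Empty products are $1$. Quartered hexagons. For a sequence $\mathbf t=(t_1,\dots,t_{2l})$ of non-negative integers let $s_k=t_1+\dots+t_k$, $o_t=\sum_{i\text{ odd}}t_i$, $e_t=\sum_{i\text{ even}}t_i$. $Q'(\mathbf t)$: take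 the region bounded by the base from $[0;0]$ to $[o_t+e_t;0]$, the segment from $[o_t+e_t;0]$ to $[o_t;2e_t]$, the north side from $[o_t;2e_t]$ to $[0;2e_t]$, and the west zigzag through $[0;0],[-\frac12;1],[0;2],[-\frac12;3],\dots,[0;2e_t]$; remove from it, for each $1\le i\le l$, the up-pointing triangle with base from $[s_{2i-1};0]$ to $[s_{2i};0]$; give weight $\frac12$ to each vertical lozenge whose two western (left) sides both lie on the west zigzag. $Q'(\mathbf t)$ is $M$ of this weighted region. $K(\mathbf t)$: if $e_t\ge1$, take the region bounded by the base from $[0;0]$ to $[o_t+e_t;0]$, the segment from $[o_t+e_t;0]$ to $[o_t+\frac12;2e_t-1]$, the north side from there to $[\frac12;2e_t-1]$, and the west zigzag through $[0;0],[\frac12;1],[0;2],[\frac12;3],\dots,[\frac12;2e_t-1]$; remove the same up-pointing triangles. $K(\mathbf t)$ is the number of tilings of the resulting region; if $e_t=0$, $K(\mathbf t)=1$. The region $N^{(2)}_{x,y,z}(\mathbf a;\mathbf b)$. Let $L=x+y+a+b$, $A=2(y+o_a+o_b)$, $B=2(y+z+e_a+e_b)-1$, and let $\ell$ be the line $k=0$. Upper part: bounded by $\ell$ between $[0;0]$ and $[L;0]$, the segment from $[L;0]$ to $[L-\frac A2;A]$, the horizontal north side at height $k=A$, and the west zigzag through the points $[\alpha(k);k]$, $0\le k\le A$, with $\alpha(k)=0$ for $k$ even and $-\frac12$ for $k$ odd. Lower part (empty if $B=-1$): bounded by $\ell$ between $[0;0]$ and $[L;0]$, the segments from $[L;0]$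 to $[L+\frac z2;-z]$ and from there to $[L+z-\frac B2;-B]$, the horizontal south side at $k=-B$, and the west zigzag through $[\beta(k);-k]$, $0\le k\le B$, with $\beta(k)=0$ for $k$ even and $\frac12$ for $k$ odd. The region is the union of the two parts (lozenges may cross $\ell$) after removing: (i) from the upper part, everything at points $[u;k]$ with $u<a_1-k/2$ (an up-pointing half triangle of side $2a_1$); (ii) for $2\le i\le m$, the triangle of side $a_i$ having a side on $\ell$ from $[a_1+\dots+a_{i-1};0]$ to $[a_1+\dots+a_i;0]$, down-pointing (below $\ell$) if $i$ is even, up-pointing (above $\ell$) if $i$ is odd; (iii) for $1\le j\le n$, the triangle of side $b_j$ having a side on $\ell$ from $[L-b_1-\dots-b_j;0]$ to $[L-b_1-\dots-b_{j-1};0]$, up-pointing (above $\ell$) if $j$ is odd, down-pointing (below $\ell$) if $j$ is even. Each vertical lozenge whose two western (left) sides both lie on the upper west zigzag has weight $\frac12$; all others have weight $1$. *)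

theory Defs
  imports Complex_Main "HOL-Library.Disjoint_Sets"
begin

section \<open>Lozenge tilings of the triangular lattice\<close>

text \<open>
  The lattice vertex \<open>[u;k]\<close> (\<open>k\<close> and \<open>u - k/2\<close> integers), whose Cartesian coordinates are
  \<open>(u, k sqrt 3 / 2)\<close>, is encoded by the pair \<open>(u - k/2, k)\<close>; every pair of integers is a vertex.
  \<open>Up j k\<close> and \<open>Down j k\<close> are the two unit triangles having the horizontal edge from \<open>(j, k)\<close> to
  \<open>(j + 1, k)\<close> as a side.
\<close>

type_synonym vertex = "int \<times> int"

definition ucoord :: "vertex \<Rightarrow> real" where
  "ucoord v = of_int (fst v) + of_int (snd v) / 2"

datatype triangle = Up int int | Down int int

fun corners :: "triangle \<Rightarrow> vertex set" where
  "corners (Up j k) = {(j, k), (j + 1, k), (j, k + 1)}"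
| "corners (Down j k) = {(j, k), (j + 1, k), (j + 1, k - 1)}"

text \<open>A region is represented by the set of its unit triangles, a lozenge by the set of its two
  unit triangles.\<close>

type_synonym region = "triangle set"
type_synonym lozenge = "triangle set"

definition is_lozenge :: "lozenge \<Rightarrow> bool" where
  "is_lozenge l \<longleftrightarrow> (\<exists>s t. l = {s, t} \<and> card (corners s \<inter> corners t) = 2)"

definition tiling :: "region \<Rightarrow> lozenge set \<Rightarrow> bool" where
  "tiling R \<T> \<longleftrightarrow> partition_on R \<T> \<and> (\<forall>l\<in>\<T>. is_lozenge l)"

definition M :: "(lozenge \<Rightarrow> real) \<Rightarrow> region \<Rightarrow> real" where
  "M w R = (\<Sum>\<T> | tiling R \<T>. \<Prod>l\<in>\<T>. w l)"

text \<open>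
  \<open>triangles_in P\<close> is the set of unit triangles contained in the closed set of all points \<open>[u;k]\<close>
  satisfying \<open>P u k\<close>. Testing the corners suffices: each set used below is bounded by lattice
  paths and is convex in every strip between two consecutive lattice rows (a zigzag boundary
  is a straight segment there), so it is enough to give \<open>P\<close> at integral heights \<open>k\<close>.
\<close>

definition triangles_in :: "(real \<Rightarrow> int \<Rightarrow> bool) \<Rightarrow> region" where
  "triangles_in P = {t. \<forall>v\<in>corners t. P (ucoord v) (snd v)}"

text \<open>Triangles with a side on the line \<open>k = 0\<close>, namely from \<open>[p;0]\<close> to \<open>[q;0]\<close>.\<close>

definition up_dent :: "nat \<Rightarrow> nat \<Rightarrow> region" where
  "up_dent p q = triangles_in (\<lambda>u k. 0 \<le> k \<and> p + k / 2 \<le> u \<and> u \<le> q - k / 2)"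

definition down_dent :: "nat \<Rightarrow> nat \<Rightarrow> region" where
  "down_dent p q = triangles_in (\<lambda>u k. k \<le> 0 \<and> p - k / 2 \<le> u \<and> u \<le> q + k / 2)"

definition zigzag_left :: "int \<Rightarrow> real" where
  "zigzag_left k = (if even k then 0 else - 1 / 2)"

definition zigzag_right :: "int \<Rightarrow> real" where
  "zigzag_right k = (if even k then 0 else 1 / 2)"

text \<open>
  Weight 1/2 for the vertical lozenges whose two western sides lie on the zigzag path through the
  points \<open>[zigzag_left k; k]\<close>, \<open>0 \<le> k \<le> h\<close>. The western sides of \<open>{Up j k, Down j k}\<close> join \<open>(j, k)\<close>
  to its top corner \<open>(j, k + 1)\<close> and to its bottom corner \<open>(j + 1, k - 1)\<close>; as these vertices have
  consecutive heights, the sides lie on the path iff the vertices do.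
\<close>

definition zigzag_weight :: "int \<Rightarrow> lozenge \<Rightarrow> real" where
  "zigzag_weight h l =
     (let Z = {v. 0 \<le> snd v \<and> snd v \<le> h \<and> ucoord v = zigzag_left (snd v)}
      in if \<exists>j k. l = {Up j k, Down j k} \<and> {(j, k), (j, k + 1), (j + 1, k - 1)} \<subseteq> Z
         then 1 / 2 else 1)"


section \<open>Sequences\<close>

text \<open>Sequences are indexed from 1 and continued by 0.\<close>

definition entry :: "nat list \<Rightarrow> nat \<Rightarrow> nat" where
  "entry s i = (if 1 \<le> i \<and> i \<le> length s then s ! (i - 1) else 0)"

definition psum :: "nat list \<Rightarrow> nat \<Rightarrow> nat" where
  "psum s k = (\<Sum>i=1..k. entry s i)"

definition osum :: "nat list \<Rightarrow> nat" where
  "osum s = (\<Sum>i | i \<in> {1..length s} \<and> odd i. entry s i)"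

definition esum :: "nat list \<Rightarrow> nat" where
  "esum s = (\<Sum>i | i \<in> {1..length s} \<and> even i. entry s i)"

text \<open>The empty sequence counts as the one-term sequence \<open>(0)\<close>.\<close>

definition len :: "nat list \<Rightarrow> nat" where
  "len s = (if s = [] then 1 else length s)"


section \<open>Product functions\<close>

definition H :: "nat \<Rightarrow> real" where
  "H n = (\<Prod>i<n. fact i)"

definition H2 :: "nat \<Rightarrow> real" where
  "H2 n = (\<Prod>i=1..n div 2. fact (n - 2 * i))"

text \<open>The index \<open>n - 2 * i\<close> must not truncate: \<open>T x n m\<close> is meant for \<open>n \<ge> 2 * (m - 1)\<close>, or \<open>m = 0\<close>.\<close>

definition T :: "nat \<Rightarrow> nat \<Rightarrow> nat \<Rightarrow> real" where
  "T x n m = (\<Prod>i<m. pochhammer (real (x + i)) (n - 2 * i))"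


section \<open>Quartered hexagons\<close>

definition t_dents :: "nat list \<Rightarrow> region" where
  "t_dents t = (\<Union>i\<in>{1..length t div 2}. up_dent (psum t (2 * i - 1)) (psum t (2 * i)))"

definition Q'_region :: "nat list \<Rightarrow> region" where
  "Q'_region t =
     triangles_in (\<lambda>u k. 0 \<le> k \<and> k \<le> 2 * int (esum t) \<and>
       zigzag_left k \<le> u \<and> u \<le> osum t + esum t - k / 2) - t_dents t"

definition Q' :: "nat list \<Rightarrow> real" where
  "Q' t = M (zigzag_weight (2 * int (esum t))) (Q'_region t)"

definition K_region :: "nat list \<Rightarrow> region" where
  "K_region t =
     triangles_in (\<lambda>u k. 0 \<le> k \<and> k \<le> 2 * int (esum t) - 1 \<and>
       zigzag_right k \<le> u \<and> u \<le> osum t + esum t - k / 2) - t_dents t"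

definition K :: "nat list \<Rightarrow> real" where
  "K t = (if esum t \<ge> 1 then M (\<lambda>_. 1) (K_region t) else 1)"


section \<open>The region \<open>N\<^sup>(\<^sup>2\<^sup>)\<close>\<close>

definition N2_length :: "nat \<Rightarrow> nat \<Rightarrow> nat list \<Rightarrow> nat list \<Rightarrow> nat" where
  "N2_length x y as bs = x + y + sum_list as + sum_list bs"

definition N2_above :: "nat \<Rightarrow> nat list \<Rightarrow> nat list \<Rightarrow> int" where
  "N2_above y as bs = 2 * int (y + osum as + osum bs)"

definition N2_below :: "nat \<Rightarrow> nat \<Rightarrow> nat list \<Rightarrow> nat list \<Rightarrow> int" where
  "N2_below y z as bs = 2 * int (y + z + esum as + esum bs) - 1"

text \<open>The subtracted set is the half triangle of side \<open>2 a\<^sub>1\<close> along the west zigzag.\<close>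

definition N2_upper :: "nat \<Rightarrow> nat \<Rightarrow> nat list \<Rightarrow> nat list \<Rightarrow> region" where
  "N2_upper x y as bs =
     triangles_in (\<lambda>u k. 0 \<le> k \<and> k \<le> N2_above y as bs \<and>
       zigzag_left k \<le> u \<and> u \<le> N2_length x y as bs - k / 2)
     - triangles_in (\<lambda>u k. u \<le> entry as 1 - k / 2)"

text \<open>The eastern boundary goes from \<open>[L;0]\<close> through \<open>[L + z/2; -z]\<close> to \<open>[L + z - B/2; -B]\<close>.\<close>

definition N2_lower :: "nat \<Rightarrow> nat \<Rightarrow> nat \<Rightarrow> nat list \<Rightarrow> nat list \<Rightarrow> region" where
  "N2_lower x y z as bs =
     triangles_in (\<lambda>u k. - N2_below y z as bs \<le> k \<and> k \<le> 0 \<and> zigzag_right k \<le> u \<and>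
       u \<le> N2_length x y as bs - k / 2 \<and> u \<le> N2_length x y as bs + z + k / 2)"

definition a_dents :: "nat list \<Rightarrow> region" where
  "a_dents as = (\<Union>i\<in>{2..length as}.
     (if even i then down_dent else up_dent) (psum as (i - 1)) (psum as i))"

definition b_dents :: "nat \<Rightarrow> nat list \<Rightarrow> region" where
  "b_dents L bs = (\<Union>j\<in>{1..length bs}.
     (if even j then down_dent else up_dent) (L - psum bs j) (L - psum bs (j - 1)))"

definition N2_region :: "nat \<Rightarrow> nat \<Rightarrow> nat \<Rightarrow> nat list \<Rightarrow> nat list \<Rightarrow> region" where
  "N2_region x y z as bs =
     N2_upper x y as bs \<union> N2_lower x y z as bs
     - a_dents as - b_dents (N2_length x y as bs) bs"

definition M_N2 :: "nat \<Rightarrow> nat \<Rightarrow> nat \<Rightarrow> nat list \<Rightarrow> nat list \<Rightarrow> real" where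
  "M_N2 x y z as bs = M (zigzag_weight (N2_above y as bs)) (N2_region x y z as bs)"

definition t_plus :: "nat \<Rightarrow> nat \<Rightarrow> nat list \<Rightarrow> nat list \<Rightarrow> nat list" where
  "t_plus x y as bs =
     (let \<mu> = 2 * ((len as + 1) div 2); \<nu> = 2 * ((len bs + 1) div 2)
      in 0 # map (entry as) [1..<\<mu>] @ [entry as \<mu> + x + y + entry bs \<nu>]
         @ rev (map (entry bs) [1..<\<nu>]))"

text \<open>Here \<open>len s div 2\<close> is the ceiling of \<open>(len s - 1)/2\<close>.\<close>

definition t_minus :: "nat \<Rightarrow> nat \<Rightarrow> nat \<Rightarrow> nat list \<Rightarrow> nat list \<Rightarrow> nat list" where
  "t_minus x y z as bs =
     (let \<mu>' = 2 * (len as div 2); \<nu>' = 2 * (len bs div 2)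
      in map (entry as) [1..<\<mu>' + 1] @ [entry as (\<mu>' + 1) + x + y + entry bs (\<nu>' + 1)]
         @ rev (map (entry bs) [1..<\<nu>' + 1]) @ [z])"

end

theory Submission
  imports Defs "Jordan_Normal_Form.Determinant"
begin

text \<open>
  Cut the region along \<open>\<ell>\<close>. A tiling is determined by the set \<open>S\<close> of the \<open>y\<close> positions at which a
  vertical lozenge crosses \<open>\<ell>\<close> and by tilings of the two halves, and these are quartered hexagons
  with dents at \<open>S\<close> and at the bases of the removed triangles. Reading a quartered hexagon strip by
  strip, the vertical lozenges form interlacing sequences; summing determinants of central
  factorials over such sequences is a telescoping of determinant rows, so a quartered hexagon with
  dents at \<open>p\<^sub>1 < \<dots> < p\<^sub>n\<close> is enumerated by a Vandermonde product in \<open>(p\<^sub>i - 1/2)\<^sup>2\<close>. In the sum over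
  \<open>S\<close> the positions of the fixed dents only enter through their union, which leaves a discrete Selberg
  sum of squared Vandermonde products against a Racah type weight. By Cauchy-Binet it is a
  determinant whose entries are total masses of shifted weights, and these have a product form that
  reduces the determinant to a Hankel determinant of binomial coefficients.
\<close>


section \<open>Determinants\<close>

text \<open>The telescoping needs polynomials whose sums over every second integer leave no boundary
  term at the zigzag. Divided central factorials of step two achieve this for both zigzags at once:
  an odd function vanishes at 0, and its value at 1 is half of its central difference at 0, which is
  exactly the weight 1/2 of a vertical lozenge in the column over abscissa 0. Hence the two halves
  of the region are one family, told apart by the parity of the height.

  In the determinant for the Selberg sum, monomials would lead out of the family of weights. Newton
  products based at the left end in the rows and at the right end in the columns only move the ends
  of the interval inwards, so every entry is again a total mass in the same three-parameter family.

  The power of 2 has two sources: \<open>a_1\<close> forced lozenges of weight 1/2 that are present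
  in \<open>Q'\<close> but cut away in the region, and a factor 1/2 in each of the \<open>y\<close>
  rows of total masses.\<close>

lemma det_mat_expand:
  "det (mat n n f) = (\<Sum>p | p permutes {0..<n}. of_int (sign p) * (\<Prod>i<n. f (i, p i)))"
  for f :: "nat \<times> nat \<Rightarrow> 'a::comm_ring_1"
proof -
  have "(\<Prod>i=0..<n. mat n n f $$ (i, p i)) = (\<Prod>i<n. f (i, p i))" if "p permutes {0..<n}" for p
    unfolding lessThan_atLeast0 by (intro prod.cong) (use that permutes_in_image[OF that] in auto)
  then show ?thesis by (subst det_def'[of _ n]) (auto intro!: sum.cong)
qed

lemma det_mat_cong:
  "(\<And>i j. i < n \<Longrightarrow> j < n \<Longrightarrow> f (i, j) = g (i, j)) \<Longrightarrow> det (mat n n f) = det (mat n n g)"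
  by (rule arg_cong[of _ _ det], rule cong_mat) auto

lemma det_scale:
  fixes A :: "nat \<Rightarrow> nat \<Rightarrow> 'a::comm_ring_1"
  shows "det (mat n n (\<lambda>(i, j). r i * c j * A i j))
    = (\<Prod>i<n. r i) * (\<Prod>j<n. c j) * det (mat n n (\<lambda>(i, j). A i j))"
proof -
  have "(\<Prod>i<n. r i * c (p i) * A i (p i)) = (\<Prod>i<n. r i) * (\<Prod>j<n. c j) * (\<Prod>i<n. A i (p i))"
    if "p permutes {0..<n}" for p
  proof -
    have "(\<Prod>i<n. c (p i)) = (\<Prod>j<n. c j)"
      using prod.permute[OF that, of c] by (simp add: lessThan_atLeast0 o_def)
    then show ?thesis by (simp add: prod.distrib)
  qed
  then show ?thesis
    by (auto simp: det_mat_expand sum_distrib_left mult_ac intro!: sum.cong)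
qed

text \<open>Multilinearity in the rows. In a strip every crossing ranges over its own gap
  independently of the others, so this moves the sum over all configurations of the strip inside one
  determinant.\<close>

lemma det_row_sums:
  fixes a :: "nat \<Rightarrow> nat \<Rightarrow> 'b \<Rightarrow> 'a::comm_ring_1"
  assumes "\<And>i. i < n \<Longrightarrow> finite (I i)"
  shows "det (mat n n (\<lambda>(i, j). \<Sum>x\<in>I i. a i j x))
    = (\<Sum>d\<in>PiE {..<n} I. det (mat n n (\<lambda>(i, j). a i j (d i))))"
proof -
  have "det (mat n n (\<lambda>(i, j). \<Sum>x\<in>I i. a i j x))
    = (\<Sum>p | p permutes {0..<n}. \<Sum>d\<in>PiE {..<n} I. of_int (sign p) * (\<Prod>i<n. a i (p i) (d i)))"
    unfolding det_mat_expand
    by (intro sum.cong refl, simp, subst prod_sum_PiE) (use assms in \<open>auto simp: sum_distrib_left\<close>)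
  also have "\<dots> = (\<Sum>d\<in>PiE {..<n} I. det (mat n n (\<lambda>(i, j). a i j (d i))))"
    by (subst sum.swap) (simp add: det_mat_expand)
  finally show ?thesis .
qed

text \<open>Telescoped sums over the gaps appear as differences of consecutive rows. They are undone
  by the lower triangular matrix of ones, whose determinant is 1.\<close>

lemma det_row_differences:
  fixes A :: "nat \<Rightarrow> nat \<Rightarrow> 'a::comm_ring_1"
  shows "det (mat n n (\<lambda>(i, j). if i = 0 then A i j else A i j - A (i - 1) j))
    = det (mat n n (\<lambda>(i, j). A i j))"
proof -
  let ?B = "\<lambda>i j. if i = 0 then A i j else A i j - A (i - 1) j"
  let ?L = "mat n n (\<lambda>(i, j). if j \<le> i then 1 else 0 :: 'a)"
  have tel: "(\<Sum>k\<le>i. ?B k j) = A i j" for i j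
    by (induction i) auto
  have "mat n n (\<lambda>(i, j). A i j) = ?L * mat n n (\<lambda>(i, j). ?B i j)"
  proof (rule eq_matI, goal_cases)
    case (1 i j)
    then have "(?L * mat n n (\<lambda>(i, j). ?B i j)) $$ (i, j) = (\<Sum>k = 0..<n. if k \<le> i then ?B k j else 0)"
      by (auto simp: scalar_prod_def intro!: sum.cong)
    also have "\<dots> = (\<Sum>k\<le>i. ?B k j)"
      by (rule sum.mono_neutral_cong_right) (use 1 in auto)
    also have "\<dots> = A i j" by (rule tel)
    finally show ?case using 1 by simp
  qed auto
  moreover have "det ?L = 1"
    by (subst det_lower_triangular[of n]) (auto simp: diag_mat_def prod.list_conv_set_nth)
  ultimately show ?thesis by (simp add: det_mult[of _ n])
qed

text \<open>Laplace expansion. It accounts for the strips across which the number of positions drops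
  by one.\<close>

lemma det_unit_first_column:
  fixes A :: "nat \<Rightarrow> nat \<Rightarrow> 'a::comm_ring_1"
  assumes "A 0 0 = 1" and "\<And>i. 0 < i \<Longrightarrow> i \<le> n \<Longrightarrow> A i 0 = 0"
  shows "det (mat (Suc n) (Suc n) (\<lambda>(i, j). A i j)) = det (mat n n (\<lambda>(i, j). A (Suc i) (Suc j)))"
proof -
  let ?A = "mat (Suc n) (Suc n) (\<lambda>(i, j). A i j)"
  have "det ?A = (\<Sum>i<Suc n. ?A $$ (i, 0) * cofactor ?A i 0)"
    by (rule laplace_expansion_column) auto
  also have "\<dots> = (\<Sum>i\<in>{0}. ?A $$ (i, 0) * cofactor ?A i 0)"
    by (rule sum.mono_neutral_right) (use assms in auto)
  also have "\<dots> = det (mat_delete ?A 0 0)"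
    using assms by (simp add: cofactor_def)
  also have "mat_delete ?A 0 0 = mat n n (\<lambda>(i, j). A (Suc i) (Suc j))"
    by (rule eq_matI) (auto simp: mat_delete_def)
  finally show ?thesis .
qed

text \<open>Passing from monomials to monic polynomials of the same degrees is a unit upper
  triangular change of basis. Hence the nodes \<open>c\<close> do not influence the determinant and
  can be chosen at will.\<close>

lemma det_newton_eq_power:
  fixes x c :: "nat \<Rightarrow> 'a::idom"
  shows "det (mat n n (\<lambda>(i, j). \<Prod>k<j. x i - c k)) = det (mat n n (\<lambda>(i, j). x i ^ j))"
proof -
  define q where "q j = (\<Prod>k<j. [:- c k, 1:])" for j
  have q0: "q j \<noteq> 0" for j by (auto simp: q_def)
  have deg: "degree (q j) = j" for j
    unfolding q_def by (subst degree_prod_eq_sum_degree) auto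
  have lead: "coeff (q j) j = 1" for j
    using lead_coeff_prod[of "\<lambda>k. [:- c k, 1:]" "{..<j}"] deg[of j] by (simp add: q_def)
  have ev: "poly (q j) y = (\<Prod>k<j. y - c k)" for j y
    by (simp add: q_def poly_prod)
  let ?V = "mat n n (\<lambda>(i, j). x i ^ j)" and ?C = "mat n n (\<lambda>(i, j). coeff (q j) i)"
  have "mat n n (\<lambda>(i, j). \<Prod>k<j. x i - c k) = ?V * ?C"
  proof (rule eq_matI, goal_cases)
    case (1 i j)
    then have "(?V * ?C) $$ (i, j) = (\<Sum>k = 0..<n. x i ^ k * coeff (q j) k)"
      by (auto simp: scalar_prod_def intro!: sum.cong)
    also have "\<dots> = (\<Sum>k\<le>degree (q j). x i ^ k * coeff (q j) k)"
      by (rule sum.mono_neutral_right) (use 1 deg in \<open>auto simp: coeff_eq_0\<close>)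
    also have "\<dots> = (\<Prod>k<j. x i - c k)"
      unfolding ev[symmetric] poly_altdef by (simp add: mult.commute)
    finally show ?case using 1 by simp
  qed auto
  moreover have "det ?C = 1"
    by (subst det_upper_triangular[of _ n])
       (auto simp: diag_mat_def prod.list_conv_set_nth lead coeff_eq_0 deg intro!: upper_triangularI)
  ultimately show ?thesis by (simp add: det_mult[of _ n])
qed

text \<open>Choosing the points \<open>x\<close> themselves as nodes gives each entry above the
  diagonal a zero factor, so the matrix becomes triangular.\<close>

lemma det_newton:
  fixes x c :: "nat \<Rightarrow> 'a::idom"
  shows "det (mat n n (\<lambda>(i, j). \<Prod>k<j. x i - c k)) = (\<Prod>j<n. \<Prod>i<j. x j - x i)"
proof -
  have "det (mat n n (\<lambda>(i, j). \<Prod>k<j. x i - c k)) = det (mat n n (\<lambda>(i, j). \<Prod>k<j. x i - x k))"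
    by (simp only: det_newton_eq_power)
  also have "\<dots> = (\<Prod>j<n. \<Prod>i<j. x j - x i)"
    by (subst det_lower_triangular[of n])
       (auto simp: diag_mat_def prod.list_conv_set_nth lessThan_atLeast0 intro!: prod.cong)
  finally show ?thesis .
qed

text \<open>Expanding the rows independently gives a sum over maps from the row indices to
  \<open>X\<close>. Maps that are not injective produce equal rows and vanish. The others are
  grouped by their image; within a group they differ by permutations, whose signs assemble the
  determinant of \<open>f\<close>.\<close>

lemma cauchy_binet:
  fixes f g :: "nat \<Rightarrow> 'b::linorder \<Rightarrow> 'a::idom"
  assumes fin: "finite X"
  shows "det (mat n n (\<lambda>(i, j). \<Sum>s\<in>X. f i s * g j s))
    = (\<Sum>S | S \<subseteq> X \<and> card S = n.
        det (mat n n (\<lambda>(i, j). f j (sorted_list_of_set S ! i)))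
        * det (mat n n (\<lambda>(i, j). g j (sorted_list_of_set S ! i))))"
proof -
  let ?D = "\<lambda>t. (\<Prod>i<n. f i (t i)) * det (mat n n (\<lambda>(i, j). g j (t i)))"
  let ?Inj = "{t \<in> PiE {..<n} (\<lambda>_. X). inj_on t {..<n}}"
  let ?SS = "{S. S \<subseteq> X \<and> card S = n}"
  have finI: "finite ?Inj" using fin by (simp add: finite_PiE)
  have finS: "finite ?SS" using fin by auto
  have "det (mat n n (\<lambda>(i, j). \<Sum>s\<in>X. f i s * g j s))
    = (\<Sum>t\<in>PiE {..<n} (\<lambda>_. X). det (mat n n (\<lambda>(i, j). f i (t i) * g j (t i))))"
    using det_row_sums[of n "\<lambda>_. X" "\<lambda>i j s. f i s * g j s"] fin by simp
  also have "\<dots> = (\<Sum>t\<in>PiE {..<n} (\<lambda>_. X). ?D t)"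
  proof (rule sum.cong[OF refl])
    fix t
    show "det (mat n n (\<lambda>(i, j). f i (t i) * g j (t i))) = ?D t"
      using det_scale[of n "\<lambda>i. f i (t i)" "\<lambda>_. 1" "\<lambda>i j. g j (t i)"] by simp
  qed
  also have "\<dots> = (\<Sum>t\<in>?Inj. ?D t)"
  proof (rule sum.mono_neutral_right)
    show "\<forall>t\<in>PiE {..<n} (\<lambda>_. X) - ?Inj. ?D t = 0"
    proof
      fix t assume "t \<in> PiE {..<n} (\<lambda>_. X) - ?Inj"
      then obtain i j where ij: "i < n" "j < n" "i \<noteq> j" "t i = t j" by (auto simp: inj_on_def)
      have "det (mat n n (\<lambda>(i, j). g j (t i))) = 0"
        by (rule det_identical_rows[OF _ ij(3,1,2)]) (use ij in \<open>auto intro!: eq_vecI\<close>)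
      then show "?D t = 0" by simp
    qed
  qed (use fin in \<open>auto simp: finite_PiE\<close>)
  also have "\<dots> = (\<Sum>S\<in>?SS. \<Sum>t | t \<in> ?Inj \<and> t ` {..<n} = S. ?D t)"
  proof -
    have "(\<lambda>t. t ` {..<n}) ` ?Inj \<subseteq> ?SS"
    proof (rule image_subsetI, intro CollectI conjI)
      fix t assume t: "t \<in> ?Inj"
      then show "t ` {..<n} \<subseteq> X" by (auto simp: PiE_iff)
      show "card (t ` {..<n}) = n" using t by (simp add: card_image)
    qed
    from sum.group[OF finI finS this, of ?D] show ?thesis by (rule sym)
  qed
  also have "\<dots> = (\<Sum>S\<in>?SS.
        det (mat n n (\<lambda>(i, j). f j (sorted_list_of_set S ! i)))
        * det (mat n n (\<lambda>(i, j). g j (sorted_list_of_set S ! i))))"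
  proof (rule sum.cong[OF refl])
    fix S assume "S \<in> ?SS"
    then have S: "S \<subseteq> X" "card S = n" by auto
    with fin have finS: "finite S" by (meson finite_subset)
    define e where "e = (\<lambda>i. sorted_list_of_set S ! i)"
    have be: "bij_betw e {..<n} S"
      unfolding e_def using bij_betw_nth[of "sorted_list_of_set S" "{..<n}" S] finS S by simp
    let ?e' = "the_inv_into {..<n} e"
    have e': "?e' s < n" "e (?e' s) = s" if "s \<in> S" for s
      using be that f_the_inv_into_f_bij_betw[OF be] bij_betw_the_inv_into[OF be]
      by (auto simp: bij_betw_def)
    have e'e: "?e' (e i) = i" if "i < n" for i
      using be that by (simp add: bij_betw_def the_inv_into_f_f)
    have inS: "e i \<in> S" if "i < n" for i using be that by (auto simp: bij_betw_def)
    have "(\<Sum>t | t \<in> ?Inj \<and> t ` {..<n} = S. ?D t)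
      = (\<Sum>p | p permutes {0..<n}. ?D (\<lambda>i. e (p i)))"
    \<comment> \<open>A map with image \<open>S\<close> is a permutation followed by the increasing
      enumeration \<open>e\<close>: the permutation sends \<open>i\<close> to the rank of
      \<open>t i\<close> in \<open>S\<close> and is continued by the identity.\<close>
    proof (rule sum.reindex_bij_witness[of _ "\<lambda>p. restrict (\<lambda>i. e (p i)) {..<n}"
          "\<lambda>t k. if k < n then ?e' (t k) else k"], goal_cases)
      case (1 t)
      then have t: "t \<in> extensional {..<n}" "\<And>i. i < n \<Longrightarrow> t i \<in> S"
        by (auto simp: PiE_def)
      then show ?case using e'
        by (auto simp: fun_eq_iff extensional_def restrict_def)
    next
      case (2 t)
      then have t: "inj_on t {..<n}" "t ` {..<n} = S" by auto
      have bt: "bij_betw t {..<n} S" using t by (simp add: bij_betw_def)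
      have "bij_betw (\<lambda>k. ?e' (t k)) {..<n} {..<n}"
        using bij_betw_trans[OF bt bij_betw_the_inv_into[OF be]] by (simp add: o_def)
      then have "bij_betw (\<lambda>k. if k < n then ?e' (t k) else k) {0..<n} {0..<n}"
        unfolding lessThan_atLeast0 by (rule bij_betw_cong[THEN iffD1, rotated]) auto
      then show ?case by (auto intro!: bij_imp_permutes)
    next
      case (3 p)
      then have p: "p permutes {0..<n}" by simp
      then have pi: "p i < n" if "i < n" for i using permutes_in_image[OF p, of i] that by auto
      have p': "p i = i" if "\<not> i < n" for i using p that by (simp add: permutes_def)
      show ?case using pi p' e'e by (auto simp: fun_eq_iff)
    next
      case (4 p)
      then have p: "p permutes {0..<n}" by simp
      have "bij_betw p {..<n} {..<n}" using permutes_imp_bij[OF p] by (simp add: lessThan_atLeast0)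
      from bij_betw_trans[OF this be] have "bij_betw (\<lambda>i. e (p i)) {..<n} S" by (simp add: o_def)
      then have "bij_betw (restrict (\<lambda>i. e (p i)) {..<n}) {..<n} S"
        by (rule bij_betw_cong[THEN iffD1, rotated]) auto
      then show ?case using S by (auto simp: bij_betw_def)
    next
      case (5 t)
      then have t: "\<And>i. i < n \<Longrightarrow> t i \<in> S" by auto
      show ?case using e' t
        by (intro arg_cong2[of _ _ _ _ times] prod.cong det_mat_cong) auto
    qed
    also have "\<dots> = (\<Sum>p | p permutes {0..<n}. of_int (sign p) * (\<Prod>i<n. f i (e (p i)))
        * det (mat n n (\<lambda>(i, j). g j (e i))))"
    proof (rule sum.cong[OF refl])
      fix p assume "p \<in> {p. p permutes {0..<n}}"
      then have p: "p permutes {0..<n}" by simp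
      have "det (mat n n (\<lambda>(i, j). g j (e (p i))))
        = det (mat n n (\<lambda>(i, j). mat n n (\<lambda>(i, j). g j (e i)) $$ (p i, j)))"
        by (rule det_mat_cong) (use permutes_in_image[OF p] in auto)
      also have "\<dots> = of_int (sign p) * det (mat n n (\<lambda>(i, j). g j (e i)))"
        by (rule det_permute_rows) (use p in auto)
      finally show "?D (\<lambda>i. e (p i)) = of_int (sign p) * (\<Prod>i<n. f i (e (p i)))
        * det (mat n n (\<lambda>(i, j). g j (e i)))" by simp
    qed
    also have "\<dots> = det (mat n n (\<lambda>(i, j). f i (e j))) * det (mat n n (\<lambda>(i, j). g j (e i)))"
      by (simp add: det_mat_expand sum_distrib_right)
    also have "det (mat n n (\<lambda>(i, j). f i (e j))) = det (mat n n (\<lambda>(i, j). f j (e i)))"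
      by (subst det_transpose[symmetric, of _ n]) (auto intro!: arg_cong[of _ _ det] eq_matI)
    finally show "(\<Sum>t | t \<in> ?Inj \<and> t ` {..<n} = S. ?D t) =
        det (mat n n (\<lambda>(i, j). f j (sorted_list_of_set S ! i)))
        * det (mat n n (\<lambda>(i, j). g j (sorted_list_of_set S ! i)))"
      unfolding e_def .
  qed
  finally show ?thesis .
qed

section \<open>Weighted perfect matchings\<close>

definition edge_partitions :: "('a set \<Rightarrow> bool) \<Rightarrow> 'a set \<Rightarrow> 'a set set set" where
  "edge_partitions E R = {P. partition_on R P \<and> (\<forall>l\<in>P. E l)}"

definition match_sum :: "('a set \<Rightarrow> bool) \<Rightarrow> ('a set \<Rightarrow> real) \<Rightarrow> 'a set \<Rightarrow> real" where
  "match_sum E w R = (\<Sum>P\<in>edge_partitions E R. \<Prod>l\<in>P. w l)"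

lemma M_eq_match_sum: "M w R = match_sum is_lozenge w R"
  by (simp add: M_def match_sum_def edge_partitions_def tiling_def)

lemma finite_edge_partitions: "finite R \<Longrightarrow> finite (edge_partitions E R)"
  by (rule finite_subset[of _ "Pow (Pow R)"]) (auto simp: edge_partitions_def partition_on_def)

lemma edge_partitionsD:
  assumes "P \<in> edge_partitions E R"
  shows "\<Union>P = R" "disjoint P" "{} \<notin> P" "\<And>l. l \<in> P \<Longrightarrow> E l" "\<And>l. l \<in> P \<Longrightarrow> l \<subseteq> R"
  using assms by (auto simp: edge_partitions_def partition_on_def)

lemma edge_partitions_finite: "P \<in> edge_partitions E R \<Longrightarrow> finite R \<Longrightarrow> finite P"
  using edge_partitionsD(1) finite_UnionD by metis

lemma edge_partitionsI:
  "\<Union>P = R \<Longrightarrow> disjoint P \<Longrightarrow> {} \<notin> P \<Longrightarrow> (\<And>l. l \<in> P \<Longrightarrow> E l) \<Longrightarrow> P \<in> edge_partitions E R"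
  by (auto simp: edge_partitions_def partition_on_def)

lemma match_sum_empty [simp]: "match_sum E w {} = 1"
proof -
  have "edge_partitions E ({} :: 'a set) = {{}}"
    by (auto simp: edge_partitions_def partition_on_def)
  then show ?thesis by (simp add: match_sum_def)
qed

text \<open>Transport along an injection. Edges and weights are compared inside \<open>R\<close>
  only, because the zigzag weight and the cell weight agree only within the regions
  considered.\<close>

lemma match_sum_image:
  assumes inj: "inj_on f R"
    and E: "\<And>l. l \<subseteq> R \<Longrightarrow> E' (f ` l) = E l"
    and w: "\<And>l. l \<subseteq> R \<Longrightarrow> E l \<Longrightarrow> w' (f ` l) = w l"
  shows "match_sum E' w' (f ` R) = match_sum E w R"
proof -
  let ?g = "the_inv_into R f"
  have gf: "?g ` f ` l = l" if "l \<subseteq> R" for l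
    using that by (force simp: image_image the_inv_into_f_f[OF inj])
  have fg: "f ` ?g ` l = l" if "l \<subseteq> f ` R" for l
    using that inj by (force simp: image_image f_the_inv_into_f)
  have injg: "inj_on ?g (f ` R)" by (simp add: inj inj_on_the_inv_into)
  have gR: "?g ` l \<subseteq> R" if "l \<subseteq> f ` R" for l
    using that inj by (fastforce simp: the_inv_into_f_f)
  show ?thesis unfolding match_sum_def
  proof (rule sum.reindex_bij_witness[of _ "\<lambda>P. (`) f ` P" "\<lambda>P. (`) ?g ` P"], goal_cases)
    case (1 P)
    have "(\<lambda>l. f ` ?g ` l) ` P = (\<lambda>l. l) ` P"
      by (rule image_cong[OF refl]) (rule fg, rule edge_partitionsD(5)[OF 1])
    then show ?case by (simp only: image_image[of "(`) f" "(`) ?g" P] image_ident)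
  next
    case (2 P)
    note P = edge_partitionsD[OF 2]
    have "(`) ?g ` P - {{}} = (`) ?g ` P" using P(3) by auto
    then have "partition_on R ((`) ?g ` P)"
      using partition_on_inj_image[OF _ injg, of P] 2 gf[OF subset_refl]
      by (simp add: edge_partitions_def)
    moreover have "E (?g ` l)" if "l \<in> P" for l
      using E[OF gR[OF P(5)[OF that]]] fg[OF P(5)[OF that]] P(4)[OF that] by simp
    ultimately show ?case unfolding edge_partitions_def by blast
  next
    case (3 P)
    have "(\<lambda>l. ?g ` f ` l) ` P = (\<lambda>l. l) ` P"
      by (rule image_cong[OF refl]) (rule gf, rule edge_partitionsD(5)[OF 3])
    then show ?case by (simp only: image_image[of "(`) ?g" "(`) f" P] image_ident)
  next
    case (4 P)
    have "(`) f ` P - {{}} = (`) f ` P" using edge_partitionsD(3)[OF 4] by auto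
    then have "partition_on (f ` R) ((`) f ` P)"
      using partition_on_inj_image[OF _ inj, of P] 4 by (simp add: edge_partitions_def)
    moreover have "E' (f ` l)" if "l \<in> P" for l
      using edge_partitionsD(4,5)[OF 4 that] E by simp
    ultimately show ?case unfolding edge_partitions_def by blast
  next
    case (5 P)
    note P = edge_partitionsD[OF 5]
    have "inj_on ((`) ?g) P"
      by (rule inj_onI) (metis P(5) fg)
    then have "(\<Prod>l\<in>(`) ?g ` P. w l) = (\<Prod>l\<in>P. w (?g ` l))"
      by (simp add: prod.reindex)
    also have "\<dots> = (\<Prod>l\<in>P. w' l)"
    proof (rule prod.cong[OF refl])
      fix l assume l: "l \<in> P"
      have "E (?g ` l)" using E[OF gR[OF P(5)[OF l]]] fg[OF P(5)[OF l]] P(4)[OF l] by simp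
      then show "w (?g ` l) = w' l" using w[OF gR[OF P(5)[OF l]]] fg[OF P(5)[OF l]] by simp
    qed
    finally show ?case .
  qed
qed

text \<open>The edges meeting both parts are chosen first. As they are pairwise disjoint, every
  subset of them is admissible, and once it is fixed the two parts no longer interact.\<close>

lemma match_sum_split:
  assumes fin: "finite A" "finite B" and AB: "A \<inter> B = {}"
    and C: "C = {l. E l \<and> l \<subseteq> A \<union> B \<and> \<not> l \<subseteq> A \<and> \<not> l \<subseteq> B}" and dis: "disjoint C"
  shows "match_sum E w (A \<union> B)
    = (\<Sum>V\<in>Pow C. (\<Prod>l\<in>V. w l) * match_sum E w (A - \<Union>V) * match_sum E w (B - \<Union>V))"
proof -
  have finC: "finite C" by (rule finite_subset[of _ "Pow (A \<union> B)"]) (use fin in \<open>auto simp: C\<close>)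
  let ?S = "SIGMA V:Pow C. edge_partitions E (A - \<Union>V) \<times> edge_partitions E (B - \<Union>V)"
  have "match_sum E w (A \<union> B) = (\<Sum>(V, P, Q)\<in>?S. (\<Prod>l\<in>V. w l) * (\<Prod>l\<in>P. w l) * (\<Prod>l\<in>Q. w l))"
    unfolding match_sum_def
  proof (rule sum.reindex_bij_witness[of _ "\<lambda>(V, P, Q). V \<union> P \<union> Q"
        "\<lambda>P. (P \<inter> C, {l \<in> P. l \<subseteq> A}, {l \<in> P. l \<subseteq> B})"], goal_cases)
    case (1 P)
    note P = edge_partitionsD[OF 1]
    show ?case using P(4,5) by (auto simp: C)
  next
    case (2 P)
    note P = edge_partitionsD[OF 2]
    have dj: "l \<inter> l' = {}" if "l \<in> P" "l' \<in> P" "l \<noteq> l'" for l l'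
      using P(2) that by (auto simp: disjoint_def)
    have cov: "\<exists>l\<in>P. x \<in> l" if "x \<in> A \<union> B" for x using P(1) that by blast
    have cl: "l \<in> C \<or> l \<subseteq> A \<or> l \<subseteq> B" if "l \<in> P" for l using P(4,5)[OF that] by (auto simp: C)
    have ne: "l \<noteq> {}" if "l \<in> P" for l using P(3) that by auto
    have nC: "l \<notin> C" if "l \<subseteq> A \<or> l \<subseteq> B" for l using that by (auto simp: C)
    have "{l \<in> P. l \<subseteq> A} \<in> edge_partitions E (A - \<Union>(P \<inter> C))"
    proof (rule edge_partitionsI)
      show "\<Union>{l \<in> P. l \<subseteq> A} = A - \<Union>(P \<inter> C)"
      proof (intro equalityI subsetI)
        fix x assume "x \<in> \<Union>{l \<in> P. l \<subseteq> A}"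
        then obtain l where l: "l \<in> P" "l \<subseteq> A" "x \<in> l" by auto
        then show "x \<in> A - \<Union>(P \<inter> C)" using dj[OF l(1)] nC[of l] by blast
      next
        fix x assume x: "x \<in> A - \<Union>(P \<inter> C)"
        then obtain l where l: "l \<in> P" "x \<in> l" using cov by auto
        moreover from l x have "l \<notin> C" by auto
        moreover from x l AB have "\<not> l \<subseteq> B" by auto
        ultimately show "x \<in> \<Union>{l \<in> P. l \<subseteq> A}" using cl[of l] by blast
      qed
    qed (use P in \<open>auto simp: disjoint_def\<close>)
    moreover have "{l \<in> P. l \<subseteq> B} \<in> edge_partitions E (B - \<Union>(P \<inter> C))"
    proof (rule edge_partitionsI)
      show "\<Union>{l \<in> P. l \<subseteq> B} = B - \<Union>(P \<inter> C)"
      proof (intro equalityI subsetI)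
        fix x assume "x \<in> \<Union>{l \<in> P. l \<subseteq> B}"
        then obtain l where l: "l \<in> P" "l \<subseteq> B" "x \<in> l" by auto
        then show "x \<in> B - \<Union>(P \<inter> C)" using dj[OF l(1)] nC[of l] by blast
      next
        fix x assume x: "x \<in> B - \<Union>(P \<inter> C)"
        then obtain l where l: "l \<in> P" "x \<in> l" using cov by auto
        moreover from l x have "l \<notin> C" by auto
        moreover from x l AB have "\<not> l \<subseteq> A" by auto
        ultimately show "x \<in> \<Union>{l \<in> P. l \<subseteq> B}" using cl[of l] by blast
      qed
    qed (use P in \<open>auto simp: disjoint_def\<close>)
    ultimately show ?case by auto
  next
    case (3 x)
    then obtain V P Q where x: "x = (V, P, Q)" "V \<subseteq> C" "P \<in> edge_partitions E (A - \<Union>V)"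
      "Q \<in> edge_partitions E (B - \<Union>V)" by auto
    note P = edge_partitionsD[OF x(3)] and Q = edge_partitionsD[OF x(4)]
    have "l \<notin> C" if "l \<subseteq> A \<or> l \<subseteq> B" for l using that by (auto simp: C)
    moreover have "\<not> l \<subseteq> A" "\<not> l \<subseteq> B" if "l \<in> V" for l using x(2) that by (auto simp: C)
    moreover have "l \<subseteq> A" "\<not> l \<subseteq> B" if "l \<in> P" for l
    proof -
      have "l \<noteq> {}" using P(3) that by auto
      then show "l \<subseteq> A" "\<not> l \<subseteq> B" using P(5)[OF that] AB by blast+
    qed
    moreover have "\<not> l \<subseteq> A" "l \<subseteq> B" if "l \<in> Q" for l
    proof -
      have "l \<noteq> {}" using Q(3) that by auto
      then show "\<not> l \<subseteq> A" "l \<subseteq> B" using Q(5)[OF that] AB by blast+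
    qed
    ultimately show ?case using x(1,2) by fastforce
  next
    case (4 x)
    then obtain V P Q where x: "x = (V, P, Q)" "V \<subseteq> C" "P \<in> edge_partitions E (A - \<Union>V)"
      "Q \<in> edge_partitions E (B - \<Union>V)" by auto
    note P = edge_partitionsD[OF x(3)] and Q = edge_partitionsD[OF x(4)]
    have "V \<union> P \<union> Q \<in> edge_partitions E (A \<union> B)"
    proof (rule edge_partitionsI)
      show "\<Union>(V \<union> P \<union> Q) = A \<union> B" using P(1) Q(1) x(2) by (auto simp: C)
      have dV: "disjoint V" using dis x(2) by (auto simp: disjoint_def)
      have 1: "disjoint (P \<union> Q)"
        by (rule disjoint_union[OF P(2) Q(2)]) (use P(1) Q(1) AB in blast)
      have "disjoint (V \<union> (P \<union> Q))"
        by (rule disjoint_union[OF dV 1]) (use P(1) Q(1) in auto)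
      then show "disjoint (V \<union> P \<union> Q)" by (simp add: Un_assoc)
      show "{} \<notin> V \<union> P \<union> Q" using P(3) Q(3) x(2) by (auto simp: C)
      show "E l" if "l \<in> V \<union> P \<union> Q" for l using that P(4) Q(4) x(2) by (auto simp: C)
    qed
    then show ?case using x by simp
  next
    case (5 P)
    note P = edge_partitionsD[OF 5]
    have finP: "finite P" using edge_partitions_finite[OF 5] fin by simp
    have eq: "P = (P \<inter> C) \<union> {l \<in> P. l \<subseteq> A} \<union> {l \<in> P. l \<subseteq> B}" using P(4,5) by (auto simp: C)
    have d: "(P \<inter> C) \<inter> {l \<in> P. l \<subseteq> A} = {}" "((P \<inter> C) \<union> {l \<in> P. l \<subseteq> A}) \<inter> {l \<in> P. l \<subseteq> B} = {}"
    proof -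
      have "\<not> (l \<subseteq> A \<and> l \<subseteq> B)" if "l \<in> P" for l
      proof -
        have "l \<noteq> {}" using P(3) that by auto
        then show ?thesis using AB by blast
      qed
      then show "(P \<inter> C) \<inter> {l \<in> P. l \<subseteq> A} = {}" "((P \<inter> C) \<union> {l \<in> P. l \<subseteq> A}) \<inter> {l \<in> P. l \<subseteq> B} = {}"
        by (auto simp: C)
    qed
    have "(\<Prod>l\<in>P. w l) = (\<Prod>l\<in>(P \<inter> C) \<union> {l \<in> P. l \<subseteq> A} \<union> {l \<in> P. l \<subseteq> B}. w l)"
      by (rule arg_cong[OF eq])
    also have "\<dots> = (\<Prod>l\<in>(P \<inter> C) \<union> {l \<in> P. l \<subseteq> A}. w l) * (\<Prod>l\<in>{l \<in> P. l \<subseteq> B}. w l)"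
      by (rule prod.union_disjoint[OF _ _ d(2)]) (use finP in auto)
    also have "(\<Prod>l\<in>(P \<inter> C) \<union> {l \<in> P. l \<subseteq> A}. w l) = (\<Prod>l\<in>P \<inter> C. w l) * (\<Prod>l\<in>{l \<in> P. l \<subseteq> A}. w l)"
      by (rule prod.union_disjoint[OF _ _ d(1)]) (use finP in auto)
    finally show ?case by simp
  qed
  also have "\<dots> = (\<Sum>V\<in>Pow C. \<Sum>P\<in>edge_partitions E (A - \<Union>V). \<Sum>Q\<in>edge_partitions E (B - \<Union>V).
      (\<Prod>l\<in>V. w l) * (\<Prod>l\<in>P. w l) * (\<Prod>l\<in>Q. w l))"
    using fin finC by (simp add: sum.Sigma finite_edge_partitions)
  also have "\<dots> = (\<Sum>V\<in>Pow C. (\<Prod>l\<in>V. w l) * match_sum E w (A - \<Union>V) * match_sum E w (B - \<Union>V))"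
    unfolding match_sum_def mult.assoc sum_product by (simp only: sum_distrib_left)
  finally show ?thesis .
qed

lemma match_sum_Un:
  assumes "finite A" "finite B" "A \<inter> B = {}"
    and "\<And>l. E l \<Longrightarrow> l \<subseteq> A \<union> B \<Longrightarrow> l \<subseteq> A \<or> l \<subseteq> B"
  shows "match_sum E w (A \<union> B) = match_sum E w A * match_sum E w B"
proof -
  have "{l. E l \<and> l \<subseteq> A \<union> B \<and> \<not> l \<subseteq> A \<and> \<not> l \<subseteq> B} = {}" using assms(4) by blast
  from match_sum_split[OF assms(1-3) this[symmetric], of w] show ?thesis by simp
qed

lemma match_sum_UN:
  assumes "finite I" "\<And>i. i \<in> I \<Longrightarrow> finite (B i)" "disjoint_family_on B I"
    and "\<And>l. E l \<Longrightarrow> l \<subseteq> (\<Union>i\<in>I. B i) \<Longrightarrow> \<exists>i\<in>I. l \<subseteq> B i"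
    and "\<not> E {}"
  shows "match_sum E w (\<Union>i\<in>I. B i) = (\<Prod>i\<in>I. match_sum E w (B i))"
  using assms
proof (induction I rule: finite_induct)
  case (insert i I)
  have dj: "B i \<inter> (\<Union>j\<in>I. B j) = {}"
    using insert.prems(2) insert.hyps(2) by (fastforce simp: disjoint_family_on_def)
  have "match_sum E w (B i \<union> (\<Union>j\<in>I. B j)) = match_sum E w (B i) * match_sum E w (\<Union>j\<in>I. B j)"
  proof (rule match_sum_Un[OF _ _ dj])
    fix l assume "E l" "l \<subseteq> B i \<union> (\<Union>j\<in>I. B j)"
    then show "l \<subseteq> B i \<or> l \<subseteq> (\<Union>j\<in>I. B j)" using insert.prems(3)[of l] by auto
  qed (use insert in auto)
  also have "match_sum E w (\<Union>j\<in>I. B j) = (\<Prod>j\<in>I. match_sum E w (B j))"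
  proof (rule insert.IH)
    show "disjoint_family_on B I" using insert.prems(2) by (auto simp: disjoint_family_on_def)
    fix l assume l: "E l" "l \<subseteq> (\<Union>j\<in>I. B j)"
    then obtain j where j: "j \<in> insert i I" "l \<subseteq> B j" using insert.prems(3)[of l] by auto
    have "l \<noteq> {}" using l(1) insert.prems(4) by auto
    have "j \<noteq> i" using l j dj \<open>l \<noteq> {}\<close> by blast
    then show "\<exists>j\<in>I. l \<subseteq> B j" using j by auto
  qed (use insert.prems in auto)
  finally show ?case using insert.hyps by simp
qed simp

lemma match_sum_forced:
  assumes fin: "finite R" and V: "disjoint V" "{} \<notin> V" "\<And>l. l \<in> V \<Longrightarrow> E l" "\<Union>V \<subseteq> R"
    and forced: "\<And>P. P \<in> edge_partitions E R \<Longrightarrow> V \<subseteq> P"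
  shows "match_sum E w R = (\<Prod>l\<in>V. w l) * match_sum E w (R - \<Union>V)"
proof -
  have finV: "finite V" using V(4) fin by (meson finite_UnionD finite_subset)
  have "match_sum E w R = (\<Sum>P\<in>edge_partitions E (R - \<Union>V). (\<Prod>l\<in>V. w l) * (\<Prod>l\<in>P. w l))"
    unfolding match_sum_def
  proof (rule sum.reindex_bij_witness[of _ "\<lambda>P. V \<union> P" "\<lambda>P. P - V"], goal_cases)
    case (1 P) then show ?case using forced by auto
  next
    case (2 P)
    note P = edge_partitionsD[OF 2]
    show ?case
    proof (rule edge_partitionsI)
      have "l \<inter> l' = {}" if "l \<in> P - V" "l' \<in> V" for l l'
        using P(2) that forced[OF 2] unfolding disjoint_def by (metis DiffE subsetD)
      then show "\<Union>(P - V) = R - \<Union>V" using P(1) by blast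
    qed (use P in \<open>auto simp: disjoint_def\<close>)
  next
    case (3 P)
    note P = edge_partitionsD[OF 3]
    have "l \<notin> P" if "l \<in> V" for l
    proof
      assume "l \<in> P"
      moreover have "l \<noteq> {}" using V(2) that by auto
      ultimately show False using P(5) that by blast
    qed
    then show ?case by auto
  next
    case (4 P)
    note P = edge_partitionsD[OF 4]
    show ?case
    proof (rule edge_partitionsI)
      show "\<Union>(V \<union> P) = R" using P(1) V(4) by auto
      show "disjoint (V \<union> P)" by (rule disjoint_union[OF V(1) P(2)]) (use P(1) in auto)
    qed (use P V in auto)
  next
    case (5 P)
    have "P = V \<union> (P - V)" using forced[OF 5] by auto
    then have "(\<Prod>l\<in>P. w l) = (\<Prod>l\<in>V \<union> (P - V). w l)" by simp
    also have "\<dots> = (\<Prod>l\<in>V. w l) * (\<Prod>l\<in>P - V. w l)"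
      by (rule prod.union_disjoint) (use finV edge_partitions_finite[OF 5 fin] in auto)
    finally show ?case by simp
  qed
  then show ?thesis by (simp add: match_sum_def sum_distrib_left)
qed

lemma edge_partition_balanced:
  assumes P: "P \<in> edge_partitions E R" and fin: "finite R"
    and E: "\<And>l. E l \<Longrightarrow> \<exists>s t. l = {s, t} \<and> c s \<and> \<not> c t"
  shows "card {x \<in> R. c x} = card {x \<in> R. \<not> c x}"
proof -
  note D = edge_partitionsD[OF P]
  have cnt: "card {x \<in> R. q x} = (\<Sum>l\<in>P. card {x \<in> l. q x})" for q
  proof -
    have eq: "{x \<in> R. q x} = (\<Union>l\<in>P. {x \<in> l. q x})" using D(1) by auto
    have "finite {x \<in> l. q x}" if "l \<in> P" for l
      using D(5)[OF that] fin by (auto intro: finite_subset)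
    moreover have "{x \<in> l. q x} \<inter> {x \<in> l'. q x} = {}" if "l \<in> P" "l' \<in> P" "l \<noteq> l'" for l l'
      using disjointD[OF D(2) that] by auto
    ultimately show ?thesis
      unfolding eq using edge_partitions_finite[OF P fin] by (subst card_UN_disjoint) auto
  qed
  have "card {x \<in> l. c x} = card {x \<in> l. \<not> c x}" if "l \<in> P" for l
  proof -
    have "E l" using D(4) that by blast
    then obtain s t where l: "l = {s, t}" "c s" "\<not> c t" using E by blast
    have "{x \<in> l. c x} = {s}" using l by blast
    moreover have "{x \<in> l. \<not> c x} = {t}" using l by blast
    ultimately show ?thesis by simp
  qed
  then show ?thesis unfolding cnt[of c] cnt[of "\<lambda>x. \<not> c x"] by (rule sum.cong[OF refl])
qed

lemma match_sum_unbalanced: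
  assumes "finite R" "\<And>l. E l \<Longrightarrow> \<exists>s t. l = {s, t} \<and> c s \<and> \<not> c t"
    and "card {x \<in> R. c x} \<noteq> card {x \<in> R. \<not> c x}"
  shows "match_sum E w R = 0"
proof -
  have "edge_partitions E R = {}" using edge_partition_balanced assms by blast
  then show ?thesis by (simp add: match_sum_def)
qed

section \<open>The brick wall graph\<close>

text \<open>The cell \<open>(k, v)\<close> stands for the unit triangle between the heights \<open>k\<close> and \<open>k + 1\<close> whose
  horizontal side has its midpoint at abscissa \<open>v / 2\<close>; it points down iff \<open>v - k\<close> is even.\<close>

definition cell_edge :: "(int \<times> int) set \<Rightarrow> bool" where
  "cell_edge l \<longleftrightarrow> (\<exists>k v. l = {(k, v), (k, v + 1)}) \<or> (\<exists>k v. even (v - k) \<and> l = {(k, v), (k + 1, v)})"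

text \<open>The height bound of \<open>zigzag_weight\<close> is omitted, which makes the weight
  invariant under reflection. In the regions to which it is applied, column 0 occurs only as the
  west end of an upper half, where the bound holds by itself.\<close>

definition cell_weight :: "(int \<times> int) set \<Rightarrow> real" where
  "cell_weight l = (if \<exists>k. l = {(k, 0), (k + 1, 0)} then 1 / 2 else 1)"

abbreviation cell_sum :: "(int \<times> int) set \<Rightarrow> real" where
  "cell_sum \<equiv> match_sum cell_edge cell_weight"

lemma cell_edge_bipartite:
  "cell_edge l \<Longrightarrow> \<exists>s t. l = {s, t} \<and> even (snd s - fst s) \<and> \<not> even (snd t - fst t)"
  unfolding cell_edge_def
proof (elim disjE exE conjE)
  fix k v assume l: "l = {(k, v), (k, v + 1)}"
  show ?thesis
  proof (cases "even (v - k)")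
    case True
    then show ?thesis using l by (intro exI[of _ "(k, v)"] exI[of _ "(k, v + 1)"]) auto
  next
    case False
    then show ?thesis using l by (intro exI[of _ "(k, v + 1)"] exI[of _ "(k, v)"]) auto
  qed
next
  fix k v assume "even (v - k)" "l = {(k, v), (k + 1, v)}"
  then show ?thesis by (intro exI[of _ "(k, v)"] exI[of _ "(k + 1, v)"]) auto
qed

lemma not_cell_edge_empty: "\<not> cell_edge {}"
  by (simp add: cell_edge_def)

section \<open>Perfect matchings of a single strip with cells removed\<close>

lemma cell_edge_row:
  assumes "cell_edge l" "l \<subseteq> Pair k ` X"
  obtains v where "l = {(k, v), (k, v + 1)}" "v \<in> X" "v + 1 \<in> X"
  using assms unfolding cell_edge_def by (auto simp: doubleton_eq_iff)

lemma cell_weight_row: "cell_weight {(k, v), (k, v + 1)} = 1"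
  by (auto simp: cell_weight_def doubleton_eq_iff)

text \<open>The left end of the path has a single neighbour, so the first edge is forced, and the
  rest is again a path with an even number of cells.\<close>

lemma cell_sum_path: "cell_sum (Pair k ` {s..<s + 2 * int m}) = 1"
proof (induction m arbitrary: s)
  case (Suc m)
  let ?R = "Pair k ` {s..<s + 2 * int (Suc m)}" and ?e = "{(k, s), (k, s + 1)}"
  have "cell_sum ?R = (\<Prod>l\<in>{?e}. cell_weight l) * cell_sum (?R - \<Union>{?e})"
  proof (rule match_sum_forced)
    show "cell_edge l" if "l \<in> {?e}" for l using that by (auto simp: cell_edge_def)
    fix P assume P: "P \<in> edge_partitions cell_edge ?R"
    note D = edge_partitionsD[OF P]
    have "(k, s) \<in> \<Union>P" unfolding D(1) by auto
    then obtain l where l: "l \<in> P" "(k, s) \<in> l" by blast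
    obtain v where v: "l = {(k, v), (k, v + 1)}" "v \<in> {s..<s + 2 * int (Suc m)}"
      using cell_edge_row[OF D(4)[OF l(1)] D(5)[OF l(1)]] by metis
    with l(2) have "v = s" by auto
    then show "{?e} \<subseteq> P" using l v by simp
  qed (auto simp: disjoint_def)
  also have "?R - \<Union>{?e} = Pair k ` {s + 2..<s + 2 + 2 * int m}" by auto
  finally show ?case by (simp add: Suc cell_weight_row)
qed simp

lemma finite_interval_filter: "finite {v \<in> {s..<e}. q v}" for s e :: int
  by (rule finite_subset[of _ "{s..<e}"]) auto

lemma card_even_path: "card {v \<in> {s..<s + 2 * int m}. even (v - k)} = m"
  and card_odd_path: "card {v \<in> {s..<s + 2 * int m}. odd (v - k)} = m"
proof (induction m)
  case (Suc m)
  have "{v \<in> {s..<s + 2 * int (Suc m)}. even (v - k)} = insert (if even (s - k) then s + 2 * m else s + 2 * m + 1)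
      {v \<in> {s..<s + 2 * int m}. even (v - k)}"
   "{v \<in> {s..<s + 2 * int (Suc m)}. odd (v - k)} = insert (if even (s - k) then s + 2 * m + 1 else s + 2 * m)
      {v \<in> {s..<s + 2 * int m}. odd (v - k)}"
    by (auto split: if_splits) presburger+
  moreover note finite_interval_filter[of s "s + 2 * int m" "\<lambda>v. even (v - k)"]
    finite_interval_filter[of s "s + 2 * int m" "\<lambda>v. odd (v - k)"]
  ultimately show "card {v \<in> {s..<s + 2 * int (Suc m)}. even (v - k)} = Suc m"
    "card {v \<in> {s..<s + 2 * int (Suc m)}. odd (v - k)} = Suc m"
    using Suc by (auto simp: card_insert_if)
qed auto

lemma cell_sum_row_unbalanced:
  assumes "finite X" "card {v \<in> X. even (v - k)} \<noteq> card {v \<in> X. odd (v - k)}"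
  shows "cell_sum (Pair k ` X) = 0"
proof -
  have "card {x \<in> Pair k ` X. q (snd x - fst x)} = card {v \<in> X. q (v - k)}" for q
  proof -
    have "{x \<in> Pair k ` X. q (snd x - fst x)} = Pair k ` {v \<in> X. q (v - k)}" by auto
    then show ?thesis by (simp add: card_image inj_on_def)
  qed
  note cd = this
  show ?thesis
    by (rule match_sum_unbalanced[where c = "\<lambda>x. even (snd x - fst x)", OF _ cell_edge_bipartite])
       (use assms cd[of even] cd[of odd] in auto)
qed

text \<open>A path of even length has equally many up and down cells. All cells of \<open>D\<close>
  point down, so removing any of them destroys the balance.\<close>

lemma cell_sum_even_block:
  assumes D: "\<And>v. v \<in> D \<Longrightarrow> even (v - k)"
  shows "cell_sum (Pair k ` ({s..<s + 2 * int m} - D)) = of_bool ({s..<s + 2 * int m} \<inter> D = {})"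
proof (cases "{s..<s + 2 * int m} \<inter> D = {}")
  case True
  then have "{s..<s + 2 * int m} - D = {s..<s + 2 * int m}" by auto
  then show ?thesis using True by (simp add: cell_sum_path)
next
  case False
  let ?X = "{s..<s + 2 * int m}"
  have "{v \<in> ?X - D. even (v - k)} \<subset> {v \<in> ?X. even (v - k)}" using False D by auto
  then have "card {v \<in> ?X - D. even (v - k)} < card {v \<in> ?X. even (v - k)}"
    by (intro psubset_card_mono finite_interval_filter)
  moreover have "{v \<in> ?X - D. odd (v - k)} = {v \<in> ?X. odd (v - k)}" using D by auto
  ultimately have "card {v \<in> ?X - D. even (v - k)} \<noteq> card {v \<in> ?X - D. odd (v - k)}"
    by (simp only: card_even_path card_odd_path less_imp_neq not_False_eq_True)
  then have "cell_sum (Pair k ` (?X - D)) = 0"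
    by (rule cell_sum_row_unbalanced[rotated]) simp
  then show ?thesis using False by simp
qed

lemma cell_sum_row_Un:
  assumes "finite A" "finite B" "A \<inter> B = {}" "\<And>v. v \<in> A \<Longrightarrow> v + 1 \<notin> B \<and> v - 1 \<notin> B"
  shows "cell_sum (Pair k ` (A \<union> B)) = cell_sum (Pair k ` A) * cell_sum (Pair k ` B)"
  unfolding image_Un
proof (rule match_sum_Un)
  fix l assume l: "cell_edge l" "l \<subseteq> Pair k ` A \<union> Pair k ` B"
  then have "l \<subseteq> Pair k ` (A \<union> B)" by auto
  then obtain v where "l = {(k, v), (k, v + 1)}" "v \<in> A \<union> B" "v + 1 \<in> A \<union> B"
    using cell_edge_row l(1) by metis
  then show "l \<subseteq> Pair k ` A \<or> l \<subseteq> Pair k ` B" using assms(4)[of v] assms(4)[of "v + 1"] by auto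
qed (use assms in auto)

text \<open>A path of odd length has one cell too many of the kind found at its ends. Losing down
  cells can repair this only if the ends point down and exactly one cell is lost; two paths of even
  length then remain.\<close>

lemma cell_sum_odd_block:
  assumes D: "\<And>v. v \<in> D \<Longrightarrow> even (v - k)"
  shows "cell_sum (Pair k ` ({s..s + 2 * int m} - D))
    = of_bool (even (s - k) \<and> card ({s..s + 2 * int m} \<inter> D) = 1)"
proof -
  let ?X = "{s..s + 2 * int m}"
  have X: "?X = insert (s + 2 * int m) {s..<s + 2 * int m}" by auto
  note fin = finite_interval_filter[of s "s + 2 * int m"]
  have ev: "card {v \<in> ?X. even (v - k)} = m + of_bool (even (s - k))"
  proof -
    have eq: "{v \<in> ?X. even (v - k)} = (if even (s - k) then insert (s + 2 * int m) else id) {v \<in> {s..<s + 2 * int m}. even (v - k)}"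
      unfolding X by (auto split: if_splits)
    have "card (insert (s + 2 * int m) {v \<in> {s..<s + 2 * int m}. even (v - k)}) = Suc m"
      by (subst card_insert_disjoint[OF fin]) (auto simp only: card_even_path, auto)
    then show ?thesis unfolding eq using card_even_path[of s m k] by (simp only: id_apply split: if_splits) simp
  qed
  have od: "card {v \<in> ?X. odd (v - k)} = m + of_bool (odd (s - k))"
  proof -
    have eq: "{v \<in> ?X. odd (v - k)} = (if odd (s - k) then insert (s + 2 * int m) else id) {v \<in> {s..<s + 2 * int m}. odd (v - k)}"
      unfolding X by (auto split: if_splits)
    have "card (insert (s + 2 * int m) {v \<in> {s..<s + 2 * int m}. odd (v - k)}) = Suc m"
      by (subst card_insert_disjoint[OF fin]) (auto simp only: card_odd_path, auto)
    then show ?thesis unfolding eq using card_odd_path[of s m k] by (simp only: id_apply split: if_splits) simp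
  qed
  have "{v \<in> ?X - D. even (v - k)} = {v \<in> ?X. even (v - k)} - (?X \<inter> D)" by auto
  then have ev': "card {v \<in> ?X - D. even (v - k)} = card {v \<in> ?X. even (v - k)} - card (?X \<inter> D)"
    using D by (simp only:) (subst card_Diff_subset, auto)
  have le: "card (?X \<inter> D) \<le> card {v \<in> ?X. even (v - k)}"
    using D by (intro card_mono finite_subset[of "{v \<in> ?X. even (v - k)}" ?X]) auto
  have od': "{v \<in> ?X - D. odd (v - k)} = {v \<in> ?X. odd (v - k)}" using D by auto
  show ?thesis
  proof (cases "even (s - k) \<and> card (?X \<inter> D) = 1")
    case False
    have "card {v \<in> ?X - D. even (v - k)} \<noteq> card {v \<in> ?X - D. odd (v - k)}"
      using False le unfolding ev' od' ev od by (cases "even (s - k)") auto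
    then have "cell_sum (Pair k ` (?X - D)) = 0"
      by (rule cell_sum_row_unbalanced[rotated]) simp
    then show ?thesis using False by simp
  next
    case True
    then obtain d where d: "?X \<inter> D = {d}" by (auto simp: card_1_singleton_iff)
    then have dX: "d \<in> ?X" "even (d - k)" using D by auto
    then have "even (d - s)" using True by presburger
    then obtain j0 where "d - s = 2 * j0" by (elim dvdE)
    moreover from this have "0 \<le> j0" using dX(1) by auto
    ultimately have j: "d = s + 2 * int (nat j0)" by simp
    define j where "j = nat j0"
    have dj: "d = s + 2 * int j" using j unfolding j_def .
    have jm: "j \<le> m" using dX(1) dj by simp
    have eq: "?X - D = {s..<s + 2 * int j} \<union> {d + 1..<d + 1 + 2 * int (m - j)}"
    proof -
      have "?X - D = ?X - {d}" using d by blast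
      also have "\<dots> = {s..<d} \<union> {d + 1..<d + 1 + (s + 2 * int m - d)}" using dX(1) by auto
      also have "s + 2 * int m - d = 2 * int (m - j)" using jm dj by simp
      finally show ?thesis using dj by simp
    qed
    have "cell_sum (Pair k ` (?X - D)) = 1"
      unfolding eq by (subst cell_sum_row_Un) (auto simp: cell_sum_path dj)
    then show ?thesis using True by simp
  qed
qed

text \<open>Removing the increasing positions \<open>p 0, \<dots>, p (n - 1)\<close> from \<open>{lo..hi}\<close> leaves the blocks
  \<open>{block_start lo p i..<block_end hi n p i}\<close>, \<open>i \<le> n\<close>.\<close>

definition block_start :: "int \<Rightarrow> (nat \<Rightarrow> int) \<Rightarrow> nat \<Rightarrow> int" where
  "block_start lo p i = (if i = 0 then lo else p (i - 1) + 1)"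

definition block_end :: "int \<Rightarrow> nat \<Rightarrow> (nat \<Rightarrow> int) \<Rightarrow> nat \<Rightarrow> int" where
  "block_end hi n p i = (if i = n then hi + 1 else p i)"

lemma blocks_cover:
  assumes inc: "\<And>i j. i < j \<Longrightarrow> j < n \<Longrightarrow> p i < p j" and rng: "\<And>i. i < n \<Longrightarrow> p i \<in> {lo..hi}"
  shows "{lo..hi} - p ` {..<n} = (\<Union>i\<le>n. {block_start lo p i..<block_end hi n p i})" (is "?L = ?R")
proof (intro equalityI subsetI)
  fix v assume v: "v \<in> ?L"
  define i where "i = (LEAST i. i = n \<or> v < p i)"
  have i: "i = n \<or> v < p i" unfolding i_def by (rule LeastI[of _ n]) simp
  have ile: "i \<le> n" unfolding i_def by (rule Least_le) simp
  have pr: "p (i - 1) < v" if "i > 0"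
  proof -
    have "\<not> (i - 1 = n \<or> v < p (i - 1))"
      using not_less_Least[of "i - 1" "\<lambda>i. i = n \<or> v < p i"] that unfolding i_def by auto
    moreover have "v \<noteq> p (i - 1)" using v ile that by auto
    ultimately show ?thesis by auto
  qed
  have "v \<in> {block_start lo p i..<block_end hi n p i}"
    using i pr v by (auto simp: block_start_def block_end_def)
  then show "v \<in> ?R" using ile by auto
next
  fix v assume "v \<in> ?R"
  then obtain i where i: "i \<le> n" "block_start lo p i \<le> v" "v < block_end hi n p i" by auto
  have "v \<in> {lo..hi}"
  proof -
    have "lo \<le> v" if "i > 0"
    proof -
      have "i - 1 < n" using i(1) that by simp
      then show ?thesis using i(2) rng[of "i - 1"] that by (auto simp: block_start_def)
    qed
    then have "lo \<le> v" using i(2) by (cases "i = 0") (auto simp: block_start_def)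
    moreover have "v \<le> hi" using i rng[of i] by (auto simp: block_end_def split: if_splits)
    ultimately show ?thesis by simp
  qed
  moreover have "v \<noteq> p j" if j: "j < n" for j
  proof (cases "j < i")
    case True
    then have "j = i - 1 \<or> j < i - 1 \<and> i - 1 < n" using i(1) by auto
    then have "p j \<le> p (i - 1)" using inc[of j "i - 1"] by auto
    then show ?thesis using i True by (auto simp: block_start_def)
  next
    case False
    then have "p i \<le> p j" using inc[of i j] j by (cases "j = i") auto
    then show ?thesis using i False j by (auto simp: block_end_def)
  qed
  ultimately show "v \<in> ?L" by auto
qed

lemma cell_sum_blocks:
  assumes inc: "\<And>i j. i < j \<Longrightarrow> j < n \<Longrightarrow> p i < p j" and rng: "\<And>i. i < n \<Longrightarrow> p i \<in> {lo..hi}"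
  shows "cell_sum (Pair k ` ({lo..hi} - p ` {..<n} - D))
    = (\<Prod>i\<le>n. cell_sum (Pair k ` ({block_start lo p i..<block_end hi n p i} - D)))"
proof -
  let ?B = "\<lambda>i. {block_start lo p i..<block_end hi n p i} - D"
  have cov: "{lo..hi} - p ` {..<n} - D = (\<Union>i\<le>n. ?B i)"
    using blocks_cover[of n p lo hi, OF inc rng] by auto
  have "cell_sum (\<Union>i\<le>n. Pair k ` ?B i) = (\<Prod>i\<le>n. cell_sum (Pair k ` ?B i))"
  proof (rule match_sum_UN)
    show "disjoint_family_on (\<lambda>i. Pair k ` ?B i) {..n}"
    proof -
      have "?B i \<inter> ?B j = {}" if "i < j" "j \<le> n" for i j
      proof -
        have "i = j - 1 \<or> i < j - 1 \<and> j - 1 < n" using that by auto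
        then have "p i \<le> p (j - 1)" using inc[of i "j - 1"] by auto
        then show ?thesis using that by (auto simp: block_start_def block_end_def)
      qed
      then have "?B i \<inter> ?B j = {}" if "i \<noteq> j" "i \<le> n" "j \<le> n" for i j
        using that by (metis inf_commute linorder_neqE_nat)
      then have "Pair k ` ?B i \<inter> Pair k ` ?B j = {}" if "i \<noteq> j" "i \<le> n" "j \<le> n" for i j
        using that by (metis image_Int image_empty inj_on_def prod.inject)
      then show ?thesis unfolding disjoint_family_on_def by simp
    qed
    fix l assume l: "cell_edge l" "l \<subseteq> (\<Union>i\<in>{..n}. Pair k ` ?B i)"
    then have "l \<subseteq> Pair k ` (\<Union>i\<le>n. ?B i)" unfolding image_UN by blast
    then obtain v where v: "l = {(k, v), (k, v + 1)}" "v \<in> (\<Union>i\<le>n. ?B i)" "v + 1 \<in> (\<Union>i\<le>n. ?B i)"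
      by (rule cell_edge_row[OF l(1)])
    then obtain i where i: "i \<le> n" "v \<in> ?B i" by auto
    have "v + 1 \<in> {lo..hi} - p ` {..<n} - D" using v(3) unfolding cov[symmetric] .
    then have "v + 1 \<noteq> block_end hi n p i" using i(1) by (auto simp: block_end_def)
    then have "v + 1 \<in> ?B i" using i v(3) by auto
    then have "l \<subseteq> Pair k ` ?B i" using i(2) unfolding v(1) by blast
    then show "\<exists>i\<in>{..n}. l \<subseteq> Pair k ` ?B i" using i(1) by blast
  qed (auto simp: not_cell_edge_empty)
  then show ?thesis unfolding cov image_UN .
qed

text \<open>Sets of crossings become choice functions with one independent choice per block. This is
  the shape of sum that multilinearity in the rows can absorb.\<close>

lemma sum_transversals:
  fixes g :: "'a set \<Rightarrow> real"
  assumes fin: "finite X" and J: "\<And>i. i < n \<Longrightarrow> J i \<subseteq> X" and dis: "disjoint_family_on J {..<n}"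
  shows "(\<Sum>D\<in>Pow X. of_bool ((\<forall>i<n. card (D \<inter> J i) = 1) \<and> D \<subseteq> (\<Union>i<n. J i)) * g D)
    = (\<Sum>f\<in>PiE {..<n} J. g (f ` {..<n}))"
proof -
  let ?G = "{D \<in> Pow X. (\<forall>i<n. card (D \<inter> J i) = 1) \<and> D \<subseteq> (\<Union>i<n. J i)}"
  let ?t = "\<lambda>D. restrict (\<lambda>i. the_elem (D \<inter> J i)) {..<n}"
  have te: "D \<inter> J i = {the_elem (D \<inter> J i)}" if "D \<in> ?G" "i < n" for D i
  proof -
    have "card (D \<inter> J i) = 1" using that by auto
    then show ?thesis by (metis card_1_singletonE the_elem_eq)
  qed
  have tG: "?t D ` {..<n} = D" if D: "D \<in> ?G" for D
  proof -
    have "?t D ` {..<n} = (\<Union>i<n. {the_elem (D \<inter> J i)})" by auto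
    also have "\<dots> = (\<Union>i<n. D \<inter> J i)" by (rule SUP_cong) (simp_all add: te[OF D, symmetric])
    also have "\<dots> = D" using D by auto
    finally show ?thesis .
  qed
  have fi: "f ` {..<n} \<inter> J i = {f i}" if f: "f \<in> PiE {..<n} J" and i: "i < n" for f i
  proof -
    have "j = i" if "f j \<in> J i" "j < n" for j
      using dis that i f by (fastforce simp: disjoint_family_on_def PiE_iff)
    then show ?thesis using f i by (auto simp: PiE_iff)
  qed
  have "(\<Sum>D\<in>Pow X. of_bool ((\<forall>i<n. card (D \<inter> J i) = 1) \<and> D \<subseteq> (\<Union>i<n. J i)) * g D) = (\<Sum>D\<in>?G. g D)"
    by (rule sum.mono_neutral_cong_right) (use fin in auto)
  also have "\<dots> = (\<Sum>f\<in>PiE {..<n} J. g (f ` {..<n}))"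
  proof (rule sum.reindex_bij_witness[of _ "\<lambda>f. f ` {..<n}" ?t], goal_cases)
    case (2 D)
    then show ?case using te[OF 2] by (auto simp: PiE_iff)
  next
    case (3 f)
    show ?case
    proof
      fix i show "?t (f ` {..<n}) i = f i"
        using 3 fi[OF 3] by (cases "i < n") (auto simp: PiE_iff extensional_def)
    qed
  next
    case (4 f)
    show ?case using 4 J by (auto simp: fi[OF 4] PiE_iff)
  qed (simp_all only: tG)
  finally show ?thesis .
qed

text \<open>The strip starts with a down cell and the removed \<open>p i\<close> point up. A block
  ending just before some \<open>p i\<close> therefore starts and ends with down cells and has odd
  length, while the block after the last \<open>p i\<close> has even length. Each block decides
  separately how many down cells it has to lose.\<close>

lemma cell_sum_strip_D:
  assumes inc: "\<And>i j. i < j \<Longrightarrow> j < n \<Longrightarrow> p i < p j" and rng: "\<And>i. i < n \<Longrightarrow> p i \<in> {lo..hi}"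
    and par: "\<And>i. i < n \<Longrightarrow> odd (p i - k)" "odd (hi - k)" "even (lo - k)" and lohi: "lo \<le> hi + 1"
    and D: "\<And>v. v \<in> D \<Longrightarrow> even (v - k)"
  shows "cell_sum (Pair k ` ({lo..hi} - p ` {..<n} - D))
    = of_bool ((\<forall>i<n. card ({block_start lo p i..<p i} \<inter> D) = 1) \<and> {block_start lo p n..hi} \<inter> D = {})"
proof -
  have bs: "even (block_start lo p i - k)" if "i \<le> n" for i
    using par(3) par(1)[of "i - 1"] that by (auto simp: block_start_def)
  have 1: "cell_sum (Pair k ` ({block_start lo p i..<block_end hi n p i} - D))
      = of_bool (card ({block_start lo p i..<p i} \<inter> D) = 1)" if i: "i < n" for i
  proof -
    have le: "block_start lo p i \<le> p i"
      using rng[OF i] inc[of "i - 1" i] i by (auto simp: block_start_def)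
    have "even (p i - 1 - block_start lo p i)" using bs[of i] par(1)[OF i] i by presburger
    then obtain m where m: "p i - 1 - block_start lo p i = 2 * m" by (elim dvdE)
    have "block_start lo p i \<noteq> p i" using bs[of i] par(1)[OF i] i by auto
    then have "m \<ge> 0" using m le by auto
    then obtain m' where m': "m = int m'" by (metis nonneg_int_cases)
    then have "p i = block_start lo p i + 2 * int m' + 1" using m by simp
    then have eq: "{block_start lo p i..<p i} = {block_start lo p i..block_start lo p i + 2 * int m'}"
      by auto
    have "cell_sum (Pair k ` ({block_start lo p i..<p i} - D)) = of_bool (card ({block_start lo p i..<p i} \<inter> D) = 1)"
      unfolding eq by (subst cell_sum_odd_block[OF D]) (use bs[of i] i in auto)
    then show ?thesis using i by (simp add: block_end_def)
  qed
  have 2: "cell_sum (Pair k ` ({block_start lo p n..<block_end hi n p n} - D))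
      = of_bool ({block_start lo p n..hi} \<inter> D = {})"
  proof -
    have le: "block_start lo p n \<le> hi + 1"
      using rng[of "n - 1"] lohi by (auto simp: block_start_def)
    have "even (hi + 1 - block_start lo p n)" using bs[of n] par(2) by presburger
    then obtain m where m: "hi + 1 - block_start lo p n = 2 * m" by (elim dvdE)
    have "m \<ge> 0" using m le by auto
    then have "hi = block_start lo p n + 2 * int (nat m) - 1" using m by simp
    then have eq: "{block_start lo p n..hi} = {block_start lo p n..<block_start lo p n + 2 * int (nat m)}"
      by auto
    have "cell_sum (Pair k ` ({block_start lo p n..hi} - D)) = of_bool ({block_start lo p n..hi} \<inter> D = {})"
      unfolding eq by (rule cell_sum_even_block[OF D])
    then show ?thesis by (simp add: block_end_def atLeastLessThanPlusOne_atLeastAtMost_int)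
  qed
  have "{..n} = insert n {..<n}" by auto
  moreover have "cell_sum (Pair k ` ({lo..hi} - p ` {..<n} - D))
    = (\<Prod>i\<le>n. cell_sum (Pair k ` ({block_start lo p i..<block_end hi n p i} - D)))"
    by (rule cell_sum_blocks) (use inc rng in auto)
  ultimately show ?thesis by (auto simp: 1 2 prod_zero_iff)
qed

lemma strip_sum_D:
  fixes g :: "int set \<Rightarrow> real"
  assumes inc: "\<And>i j. i < j \<Longrightarrow> j < n \<Longrightarrow> p i < p j" and rng: "\<And>i. i < n \<Longrightarrow> p i \<in> {lo..hi}"
    and par: "\<And>i. i < n \<Longrightarrow> odd (p i - k)" "odd (hi - k)" "even (lo - k)" and lohi: "lo \<le> hi + 1"
  shows "(\<Sum>D\<in>Pow {v \<in> {lo..hi}. even (v - k)}. cell_sum (Pair k ` ({lo..hi} - p ` {..<n} - D)) * g D)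
    = (\<Sum>f\<in>PiE {..<n} (\<lambda>i. {v \<in> {block_start lo p i..<p i}. even (v - k)}). g (f ` {..<n}))"
proof -
  let ?X = "{v \<in> {lo..hi}. even (v - k)}"
  let ?J = "\<lambda>i. {v \<in> {block_start lo p i..<p i}. even (v - k)}"
  have lob: "lo \<le> block_start lo p i" if "i < n" for i
  proof -
    have "i - 1 < n" using that by simp
    then show ?thesis using rng[of "i - 1"] by (auto simp: block_start_def)
  qed
  have JX: "?J i \<subseteq> ?X" if "i < n" for i
    using lob[of i] rng[of i] that by auto
  have dj: "{block_start lo p i..<p i} \<inter> {block_start lo p j..<p j} = {}" if "i < j" "j < n" for i j
  proof -
    have "i = j - 1 \<or> i < j - 1 \<and> j - 1 < n" using that by auto
    then have "p i \<le> p (j - 1)" using inc[of i "j - 1"] by auto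
    then show ?thesis using that by (auto simp: block_start_def)
  qed
  have dis: "disjoint_family_on ?J {..<n}"
    unfolding disjoint_family_on_def
  proof (intro ballI impI)
    fix i j assume "i \<in> {..<n}" "j \<in> {..<n}" "i \<noteq> j"
    then show "?J i \<inter> ?J j = {}" using dj[of i j] dj[of j i] by (cases "i < j") auto
  qed
  have cov: "{lo..hi} - p ` {..<n} = (\<Union>i<n. {block_start lo p i..<p i}) \<union> {block_start lo p n..hi}"
  proof -
    have "{..n} = insert n {..<n}" by auto
    moreover have "{lo..hi} - p ` {..<n} = (\<Union>i\<le>n. {block_start lo p i..<block_end hi n p i})"
      by (rule blocks_cover) (use inc rng in auto)
    moreover have "(\<Union>i<n. {block_start lo p i..<block_end hi n p i}) = (\<Union>i<n. {block_start lo p i..<p i})"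
      by (rule SUP_cong) (auto simp: block_end_def)
    moreover have "{block_start lo p n..<block_end hi n p n} = {block_start lo p n..hi}"
      by (auto simp: block_end_def)
    ultimately show ?thesis by (simp only: UN_insert Un_commute)
  qed
  have dn: "{block_start lo p i..<p i} \<inter> {block_start lo p n..hi} = {}" if "i < n" for i
  proof -
    have "i = n - 1 \<or> i < n - 1 \<and> n - 1 < n" using that by auto
    then have "p i \<le> p (n - 1)" using inc[of i "n - 1"] by auto
    then show ?thesis using that by (auto simp: block_start_def)
  qed
  have "(\<Sum>D\<in>Pow ?X. cell_sum (Pair k ` ({lo..hi} - p ` {..<n} - D)) * g D)
    = (\<Sum>D\<in>Pow ?X. of_bool ((\<forall>i<n. card (D \<inter> ?J i) = 1) \<and> D \<subseteq> (\<Union>i<n. ?J i)) * g D)"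
  proof (rule sum.cong[OF refl])
    fix D assume DX: "D \<in> Pow ?X"
    then have D: "\<And>v. v \<in> D \<Longrightarrow> even (v - k)" by auto
    have e1: "{block_start lo p i..<p i} \<inter> D = D \<inter> ?J i" for i using D by auto
    have "D \<subseteq> {lo..hi} - p ` {..<n}" using DX par(1) by auto
    then have e2: "{block_start lo p n..hi} \<inter> D = {} \<longleftrightarrow> D \<subseteq> (\<Union>i<n. ?J i)"
    proof (intro iffI)
      assume *: "D \<subseteq> {lo..hi} - p ` {..<n}" "{block_start lo p n..hi} \<inter> D = {}"
      show "D \<subseteq> (\<Union>i<n. ?J i)"
      proof
        fix v assume v: "v \<in> D"
        then have "v \<in> (\<Union>i<n. {block_start lo p i..<p i})" using * unfolding cov by blast
        then show "v \<in> (\<Union>i<n. ?J i)" using D[OF v] by auto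
      qed
    next
      assume "D \<subseteq> (\<Union>i<n. ?J i)"
      then show "{block_start lo p n..hi} \<inter> D = {}" using dn by fastforce
    qed
    have "cell_sum (Pair k ` ({lo..hi} - p ` {..<n} - D))
      = of_bool ((\<forall>i<n. card ({block_start lo p i..<p i} \<inter> D) = 1) \<and> {block_start lo p n..hi} \<inter> D = {})"
      by (rule cell_sum_strip_D) (fact inc rng par lohi D)+
    then show "cell_sum (Pair k ` ({lo..hi} - p ` {..<n} - D)) * g D
      = of_bool ((\<forall>i<n. card (D \<inter> ?J i) = 1) \<and> D \<subseteq> (\<Union>i<n. ?J i)) * g D"
      unfolding e1 e2 by simp
  qed
  also have "\<dots> = (\<Sum>f\<in>PiE {..<n} ?J. g (f ` {..<n}))"
    by (rule sum_transversals[OF _ JX dis]) (auto intro: finite_subset[of _ "{lo..hi}"])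
  finally show ?thesis .
qed

text \<open>A strip starting with an up cell: the block before \<open>p 0\<close> has even length
  and loses nothing, and what follows \<open>p 0\<close> is a strip starting with a down cell. One
  choice fewer than there are removed cells remains. With no removed cell the strip is a path of odd
  length with up cells at both ends, which no loss of down cells can balance.\<close>

lemma strip_sum_U:
  fixes g :: "int set \<Rightarrow> real"
  assumes inc: "\<And>i j. i < j \<Longrightarrow> j < n \<Longrightarrow> p i < p j" and rng: "\<And>i. i < n \<Longrightarrow> p i \<in> {lo..hi}"
    and par: "\<And>i. i < n \<Longrightarrow> odd (p i - k)" "odd (hi - k)" "odd (lo - k)" and lohi: "lo \<le> hi"
  shows "(\<Sum>D\<in>Pow {v \<in> {lo..hi}. even (v - k)}. cell_sum (Pair k ` ({lo..hi} - p ` {..<n} - D)) * g D)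
    = (if n = 0 then 0
       else \<Sum>f\<in>PiE {..<n - 1} (\<lambda>i. {v \<in> {p i + 1..<p (Suc i)}. even (v - k)}). g (f ` {..<n - 1}))"
proof (cases n)
  case 0
  have "even (hi - lo)" using par(2,3) by presburger
  then obtain m where m: "hi - lo = 2 * m" by (elim dvdE)
  then have hi: "hi = lo + 2 * int (nat m)" using lohi by auto
  have "cell_sum (Pair k ` ({lo..hi} - p ` {..<n} - D)) = 0" if "D \<in> Pow {v \<in> {lo..hi}. even (v - k)}" for D
  proof -
    have "cell_sum (Pair k ` ({lo..lo + 2 * int (nat m)} - D))
      = of_bool (even (lo - k) \<and> card ({lo..lo + 2 * int (nat m)} \<inter> D) = 1)"
      by (rule cell_sum_odd_block) (use that in auto)
    then show ?thesis using par(3) 0 hi by simp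
  qed
  then have "(\<Sum>D\<in>Pow {v \<in> {lo..hi}. even (v - k)}. cell_sum (Pair k ` ({lo..hi} - p ` {..<n} - D)) * g D) = 0"
    by (intro sum.neutral ballI) (simp only: mult_zero_left)
  then show ?thesis using 0 by (simp only: refl if_True)
next
  case (Suc n')
  let ?q = "\<lambda>i. p (Suc i)"
  let ?Y = "{v \<in> {p 0 + 1..hi}. even (v - k)}"
  have p0: "lo \<le> p 0" "p 0 \<le> hi" using rng[of 0] Suc by auto
  have "even (p 0 - lo)" using par(1)[of 0] par(3) Suc by presburger
  then obtain m where m: "p 0 - lo = 2 * m" by (elim dvdE)
  then have p0m: "p 0 = lo + 2 * int (nat m)" using p0 by auto
  have head: "cell_sum (Pair k ` ({lo..<p 0} - D)) = of_bool ({lo..<p 0} \<inter> D = {})"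
    if "\<And>v. v \<in> D \<Longrightarrow> even (v - k)" for D
    using cell_sum_even_block[of D k lo "nat m"] that unfolding p0m by simp
  have pS: "p ` {..<n} = insert (p 0) (?q ` {..<n'})"
    using Suc by (simp add: lessThan_Suc_eq_insert_0 image_image)
  have less: "p 0 < ?q i" if "i < n'" for i using inc[of 0 "Suc i"] Suc that by auto
  have X: "{lo..hi} - p ` {..<n} - D = ({lo..<p 0} - D) \<union> ({p 0 + 1..hi} - ?q ` {..<n'} - D)" for D
  proof (rule Set.set_eqI)
    fix v
    have "v \<notin> ?q ` {..<n'}" if "v < p 0" using less that by fastforce
    then show "v \<in> {lo..hi} - p ` {..<n} - D \<longleftrightarrow> v \<in> ({lo..<p 0} - D) \<union> ({p 0 + 1..hi} - ?q ` {..<n'} - D)"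
      unfolding pS using p0 by auto
  qed
  have split: "cell_sum (Pair k ` ({lo..hi} - p ` {..<n} - D))
      = of_bool ({lo..<p 0} \<inter> D = {}) * cell_sum (Pair k ` ({p 0 + 1..hi} - ?q ` {..<n'} - D))"
    if "D \<in> Pow {v \<in> {lo..hi}. even (v - k)}" for D
  proof -
    have "cell_sum (Pair k ` ({lo..<p 0} - D)) = of_bool ({lo..<p 0} \<inter> D = {})"
      by (rule head) (use that in auto)
    then show ?thesis unfolding X by (subst cell_sum_row_Un) auto
  qed
  have "(\<Sum>D\<in>Pow {v \<in> {lo..hi}. even (v - k)}. cell_sum (Pair k ` ({lo..hi} - p ` {..<n} - D)) * g D)
    = (\<Sum>D\<in>Pow ?Y. cell_sum (Pair k ` ({p 0 + 1..hi} - ?q ` {..<n'} - D)) * g D)"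
  proof (rule sum.mono_neutral_cong_right)
    show "finite (Pow {v \<in> {lo..hi}. even (v - k)})"
      by (auto intro: finite_subset[of _ "{lo..hi}"])
    show "Pow ?Y \<subseteq> Pow {v \<in> {lo..hi}. even (v - k)}" using p0 by auto
    show "\<forall>D\<in>Pow {v \<in> {lo..hi}. even (v - k)} - Pow ?Y. cell_sum (Pair k ` ({lo..hi} - p ` {..<n} - D)) * g D = 0"
    proof
      fix D assume D: "D \<in> Pow {v \<in> {lo..hi}. even (v - k)} - Pow ?Y"
      then obtain v where v: "v \<in> D" "v \<notin> ?Y" "v \<in> {lo..hi}" "even (v - k)" by blast
      moreover have "v \<noteq> p 0" using v(4) par(1)[of 0] Suc by auto
      ultimately have "v \<in> {lo..<p 0} \<inter> D" by auto
      then show "cell_sum (Pair k ` ({lo..hi} - p ` {..<n} - D)) * g D = 0"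
        using split[of D] D by auto
    qed
    fix D assume D: "D \<in> Pow ?Y"
    then have "{lo..<p 0} \<inter> D = {}" "D \<in> Pow {v \<in> {lo..hi}. even (v - k)}" using p0 by auto
    then show "cell_sum (Pair k ` ({lo..hi} - p ` {..<n} - D)) * g D
      = cell_sum (Pair k ` ({p 0 + 1..hi} - ?q ` {..<n'} - D)) * g D" using split[of D] by simp
  qed
  also have "\<dots> = (\<Sum>f\<in>PiE {..<n'} (\<lambda>i. {v \<in> {block_start (p 0 + 1) ?q i..<?q i}. even (v - k)}). g (f ` {..<n'}))"
  proof (rule strip_sum_D)
    show "?q i \<in> {p 0 + 1..hi}" if "i < n'" for i
      using less[OF that] rng[of "Suc i"] that Suc by auto
    show "even (p 0 + 1 - k)" using par(1)[of 0] Suc by auto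
  qed (use inc par p0 Suc in auto)
  finally have eq: "(\<Sum>D\<in>Pow {v \<in> {lo..hi}. even (v - k)}. cell_sum (Pair k ` ({lo..hi} - p ` {..<n} - D)) * g D)
    = (\<Sum>f\<in>PiE {..<n'} (\<lambda>i. {v \<in> {block_start (p 0 + 1) ?q i..<?q i}. even (v - k)}). g (f ` {..<n'}))" .
  have "block_start (p 0 + 1) ?q i = p i + 1" for i
    by (auto simp: block_start_def)
  then show ?thesis unfolding eq using Suc by simp
qed

section \<open>Central factorials\<close>

text \<open>With \<open>x = 2 * t\<close>, \<open>even_fn\<close> and \<open>odd_fn\<close> are the
  divided central factorials t^[2j] / (2j)! and t^[2j+1] / (2j+1)!. The doubled variable fits cells
  of one parity, which are two columns apart.\<close>

definition even_fn :: "nat \<Rightarrow> real \<Rightarrow> real" where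
  "even_fn j x = (\<Prod>i<j. x\<^sup>2 - (2 * real i)\<^sup>2) / (4 ^ j * fact (2 * j))"

definition odd_fn :: "nat \<Rightarrow> real \<Rightarrow> real" where
  "odd_fn j x = x * (\<Prod>i<j. x\<^sup>2 - (2 * real i + 1)\<^sup>2) / (2 * 4 ^ j * fact (2 * j + 1))"

text \<open>After splitting the differences of squares, the linear factors on either side run
  through the same arithmetic progression of step 2; shifting its centre only affects the end
  factors, which are split off.\<close>

lemma even_fn_prod_shift:
  "(\<Prod>i<Suc j. (x + 1)\<^sup>2 - (2 * real i)\<^sup>2) = (x + 1) * (x + 1 + 2 * real j) * (\<Prod>i<j. x\<^sup>2 - (2 * real i + 1)\<^sup>2)"
proof (induction j)
  case (Suc j)
  show ?case
    by (subst prod.lessThan_Suc, subst Suc) (simp add: power2_eq_square algebra_simps)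
qed (simp add: power2_eq_square)

lemma odd_fn_prod_shift:
  "x * (\<Prod>i<j. (x + 1)\<^sup>2 - (2 * real i + 1)\<^sup>2) = (x + 2 * real j) * (\<Prod>i<j. x\<^sup>2 - (2 * real i)\<^sup>2)"
proof (induction j)
  case (Suc j)
  have "x * (\<Prod>i<Suc j. (x + 1)\<^sup>2 - (2 * real i + 1)\<^sup>2)
    = (x * (\<Prod>i<j. (x + 1)\<^sup>2 - (2 * real i + 1)\<^sup>2)) * ((x + 1)\<^sup>2 - (2 * real j + 1)\<^sup>2)"
    by simp
  then show ?case unfolding Suc by (simp add: power2_eq_square algebra_simps)
qed simp

lemma even_fn_diff: "even_fn (Suc j) (x + 1) - even_fn (Suc j) (x - 1) = odd_fn j x"
proof -
  let ?A = "\<Prod>i<j. x\<^sup>2 - (2 * real i + 1)\<^sup>2"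
  have 1: "(\<Prod>i<Suc j. (x - 1)\<^sup>2 - (2 * real i)\<^sup>2) = (x - 1) * (x - 1 - 2 * real j) * ?A"
  proof -
    have "(\<Prod>i<Suc j. (x - 1)\<^sup>2 - (2 * real i)\<^sup>2) = (\<Prod>i<Suc j. (- x + 1)\<^sup>2 - (2 * real i)\<^sup>2)"
      by (simp only: power2_commute[of x 1]) simp
    also have "\<dots> = (- x + 1) * (- x + 1 + 2 * real j) * ?A"
      unfolding even_fn_prod_shift[of "- x"] by simp
    also have "\<dots> = (x - 1) * (x - 1 - 2 * real j) * ?A" by (simp add: algebra_simps)
    finally show ?thesis .
  qed
  have "even_fn (Suc j) (x + 1) - even_fn (Suc j) (x - 1)
    = (((x + 1) * (x + 1 + 2 * real j) - (x - 1) * (x - 1 - 2 * real j)) * ?A) / (4 ^ Suc j * fact (2 * Suc j))"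
    unfolding even_fn_def even_fn_prod_shift 1 by (simp only: diff_divide_distrib left_diff_distrib)
  also have "(x + 1) * (x + 1 + 2 * real j) - (x - 1) * (x - 1 - 2 * real j) = 4 * (real j + 1) * x"
    by (simp add: algebra_simps)
  also have "fact (2 * Suc j) = 2 * (real j + 1) * fact (2 * j + 1)"
    by (simp add: algebra_simps)
  also have "4 * (real j + 1) * x * ?A / (4 ^ Suc j * (2 * (real j + 1) * fact (2 * j + 1)))
    = odd_fn j x"
    unfolding odd_fn_def by (simp add: divide_simps del: fact_Suc)
  finally show ?thesis .
qed

lemma odd_fn_diff: "odd_fn j (x + 1) - odd_fn j (x - 1) = even_fn j x"
proof -
  let ?B = "\<Prod>i<j. x\<^sup>2 - (2 * real i)\<^sup>2"
  let ?P = "\<Prod>i<j. (x + 1)\<^sup>2 - (2 * real i + 1)\<^sup>2" and ?M = "\<Prod>i<j. (x - 1)\<^sup>2 - (2 * real i + 1)\<^sup>2"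
  have M: "x * ?M = (x - 2 * real j) * ?B"
  proof -
    have "?M = (\<Prod>i<j. (- x + 1)\<^sup>2 - (2 * real i + 1)\<^sup>2)"
      by (simp only: power2_commute[of x 1]) simp
    then have "- x * ?M = (- x + 2 * real j) * ?B" using odd_fn_prod_shift[of "- x" j] by simp
    then show ?thesis by (simp add: algebra_simps)
  qed
  have "(x + 1) * ?P - (x - 1) * ?M = 2 * (2 * real j + 1) * ?B"
  \<comment> \<open>The shift identities hold only after multiplication by \<open>x\<close>, so 0 is
    treated apart; there, for \<open>j > 0\<close>, each of the three products has a zero factor at
    \<open>i = 0\<close>.\<close>
  proof (cases "x = 0")
    case True
    show ?thesis
    proof (cases j)
      case (Suc j')
      then have "?B = 0" "?P = 0" "?M = 0"
        by (intro prod_zero bexI[of _ 0]; use True in simp)+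
      then show ?thesis by (simp only: mult_zero_right diff_self)
    qed (use True in simp)
  next
    case False
    have "x * ((x + 1) * ?P - (x - 1) * ?M) = (x + 1) * (x * ?P) - (x - 1) * (x * ?M)"
      by (simp add: algebra_simps)
    also have "\<dots> = ((x + 1) * (x + 2 * real j) - (x - 1) * (x - 2 * real j)) * ?B"
      unfolding M odd_fn_prod_shift by (simp only: left_diff_distrib mult.assoc)
    also have "(x + 1) * (x + 2 * real j) - (x - 1) * (x - 2 * real j) = x * (2 * (2 * real j + 1))"
      by (simp add: algebra_simps)
    finally show ?thesis using False by (simp add: mult.assoc)
  qed
  moreover have "odd_fn j (x + 1) - odd_fn j (x - 1) = ((x + 1) * ?P - (x - 1) * ?M) / (2 * 4 ^ j * fact (2 * j + 1))"
    unfolding odd_fn_def by (simp only: diff_divide_distrib)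
  moreover have "fact (2 * j + 1) = (2 * real j + 1) * fact (2 * j)" by (simp add: algebra_simps)
  moreover have "2 * c * b / (2 * q * (c * f)) = b / (q * f)" if "c \<noteq> 0" for b c q f :: real
    using that by simp
  moreover have "2 * real j + 1 \<noteq> 0" by linarith
  ultimately show ?thesis unfolding even_fn_def by (simp only: not_False_eq_True)
qed

lemma odd_fn_minus: "odd_fn j (- x) = - odd_fn j x"
  by (simp add: odd_fn_def)

lemma even_fn_0 [simp]: "even_fn 0 x = 1"
  by (simp add: even_fn_def)

lemma telescope_parity:
  fixes F f :: "int \<Rightarrow> real"
  assumes step: "\<And>x. F (x + 1) - F (x - 1) = f x" and ab: "a \<le> b" "odd (a - k)" "odd (b - k)"
  shows "(\<Sum>v\<in>{v \<in> {a + 1..<b}. even (v - k)}. f v) = F b - F a"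
proof -
  have "even (b - a)" using ab by presburger
  then obtain m where m: "b - a = 2 * m" by (elim dvdE)
  define j where "j = nat m"
  have b: "b = a + 2 * int j" using m ab(1) unfolding j_def by auto
  show ?thesis unfolding b
  proof (induction j)
    case (Suc j)
    have "{v \<in> {a + 1..<a + 2 * int (Suc j)}. even (v - k)}
      = insert (a + 2 * int j + 1) {v \<in> {a + 1..<a + 2 * int j}. even (v - k)}"
    proof (intro equalityI subsetI)
      fix v assume v: "v \<in> {v \<in> {a + 1..<a + 2 * int (Suc j)}. even (v - k)}"
      moreover have "v \<noteq> a + 2 * int j" using v ab(2) by auto
      ultimately show "v \<in> insert (a + 2 * int j + 1) {v \<in> {a + 1..<a + 2 * int j}. even (v - k)}"
        by (auto simp del: even_diff)
    next
      fix v assume v: "v \<in> insert (a + 2 * int j + 1) {v \<in> {a + 1..<a + 2 * int j}. even (v - k)}"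
      have "even (a + 2 * int j + 1 - k)" using ab(2) by simp
      then show "v \<in> {v \<in> {a + 1..<a + 2 * int (Suc j)}. even (v - k)}" using v
        by (auto simp del: even_diff)
    qed
    moreover have "finite {v \<in> {a + 1..<a + 2 * int j}. even (v - k)}"
      by (rule finite_subset[of _ "{a + 1..<a + 2 * int j}"]) auto
    ultimately show ?case
      using Suc step[of "a + 2 * int j + 1"] by (simp add: algebra_simps)
  qed (simp add: )
qed

definition cell_factor :: "int \<Rightarrow> real" where
  "cell_factor v = (if v = 0 then 1 / 2 else 1)"

lemma odd_fn_sum:
  assumes "0 \<le> a" "a \<le> b" "odd (a - k)" "odd (b - k)"
  shows "(\<Sum>v\<in>{v \<in> {a + 1..<b}. even (v - k)}. odd_fn j (of_int v)) = even_fn (Suc j) (of_int b) - even_fn (Suc j) (of_int a)"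
  by (rule telescope_parity) (use assms even_fn_diff in auto)

lemma even_fn_sum:
  assumes "0 \<le> a" "a \<le> b" "odd (a - k)" "odd (b - k)"
  shows "(\<Sum>v\<in>{v \<in> {a + 1..<b}. even (v - k)}. cell_factor v * even_fn j (of_int v)) = odd_fn j (of_int b) - odd_fn j (of_int a)"
proof -
  have "(\<Sum>v\<in>{v \<in> {a + 1..<b}. even (v - k)}. cell_factor v * even_fn j (of_int v))
    = (\<Sum>v\<in>{v \<in> {a + 1..<b}. even (v - k)}. even_fn j (of_int v))"
    by (rule sum.cong) (use assms(1) in \<open>auto simp: cell_factor_def\<close>)
  also have "\<dots> = odd_fn j (of_int b) - odd_fn j (of_int a)"
    by (rule telescope_parity) (use assms odd_fn_diff in auto)
  finally show ?thesis .
qed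

text \<open>The boundary term at the west end disappears for both zigzags. For \<open>e = 1\<close>
  it is the value of an odd function at 0. For \<open>e = 0\<close> oddness gives
  \<open>odd_fn j 1\<close> as half of the central difference \<open>even_fn j 0\<close>, which is
  what the half weighted position 0 contributes.\<close>

lemma even_fn_sum_first:
  assumes e: "e = 0 \<or> e = 1" and eb: "e \<le> b" "even (e - k)" "odd (b - k)"
  shows "(\<Sum>v\<in>{v \<in> {e..<b}. even (v - k)}. cell_factor v * even_fn j (of_int v)) = odd_fn j (of_int b)"
  using e
proof
  assume "e = 1"
  then show ?thesis using even_fn_sum[of 0 b k j] eb by (simp add: odd_fn_def)
next
  assume e0: "e = 0"
  have b1: "1 \<le> b" using eb e0 by (cases "b = 0") auto
  have "{v \<in> {0..<b}. even (v - k)} = insert 0 {v \<in> {1 + 1..<b}. even (v - k)}"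
  proof -
    have "v \<noteq> 1" if "even (v - k)" for v using that eb(2) e0 by auto
    then have "v = 0 \<or> 1 + 1 \<le> v" if "even (v - k)" "0 \<le> v" for v using that by fastforce
    then show ?thesis using b1 eb(2) e0 by (auto simp del: even_diff)
  qed
  moreover have "finite {v \<in> {1 + 1..<b}. even (v - k)}"
    by (rule finite_subset[of _ "{1 + 1..<b}"]) auto
  ultimately have "(\<Sum>v\<in>{v \<in> {e..<b}. even (v - k)}. cell_factor v * even_fn j (of_int v))
    = cell_factor 0 * even_fn j 0 + (\<Sum>v\<in>{v \<in> {1 + 1..<b}. even (v - k)}. cell_factor v * even_fn j (of_int v))"
    unfolding e0 by simp
  also have "(\<Sum>v\<in>{v \<in> {1 + 1..<b}. even (v - k)}. cell_factor v * even_fn j (of_int v)) = odd_fn j (of_int b) - odd_fn j (of_int 1)"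
    by (rule even_fn_sum) (use b1 eb e0 in auto)
  also have "cell_factor 0 * even_fn j 0 = odd_fn j 1"
    using odd_fn_diff[of j 0] odd_fn_minus[of j 1] by (simp add: cell_factor_def)
  finally show ?thesis by simp
qed

section \<open>Transfer through the strips\<close>

text \<open>The west end \<open>h mod 2\<close> covers both zigzags: column 0 for even heights
  (upper half, quartered hexagons of \<open>Q'\<close>) and column 1 for odd heights (lower half,
  those of \<open>K\<close>). \<open>W\<close> is the doubled length of the base when
  \<open>k\<close> is 0.\<close>

definition half_region :: "int \<Rightarrow> int \<Rightarrow> int \<Rightarrow> (int \<times> int) set" where
  "half_region h W k = {(i, v). k \<le> i \<and> i < h \<and> h mod 2 \<le> v \<and> v \<le> W - i - 1}"

lemma finite_half_region: "finite (half_region h W k)"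
proof (rule finite_subset)
  show "half_region h W k \<subseteq> {k..h} \<times> {h mod 2..W - k}"
    by (auto simp: half_region_def)
qed simp

lemma half_region_Suc:
  "k < h \<Longrightarrow> half_region h W k = Pair k ` {h mod 2..W - k - 1} \<union> half_region h W (k + 1)"
  by (auto simp: half_region_def)

lemma half_region_empty: "half_region h W h = {}"
  by (auto simp: half_region_def)

text \<open>The matching sum of the top \<open>r\<close> strips with the base cells at \<open>P\<close> removed; no strip at all
  is left for \<open>r = 0\<close>, and then nothing may be removed.\<close>

definition half_sum :: "int \<Rightarrow> int \<Rightarrow> nat \<Rightarrow> int set \<Rightarrow> real" where
  "half_sum h W r P = (if r = 0 then of_bool (P = {})
     else cell_sum (half_region h W (h - int r) - Pair (h - int r) ` P))"

lemma cell_weight_vertical: "cell_weight {(k, v), (k + 1, v)} = cell_factor v"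
  by (auto simp: cell_weight_def cell_factor_def doubleton_eq_iff)

lemma cell_sum_cut:
  assumes fin: "finite A" "finite B" and A: "\<And>i v. (i, v) \<in> A \<Longrightarrow> i \<le> k" and B: "\<And>i v. (i, v) \<in> B \<Longrightarrow> k < i"
  shows "cell_sum (A \<union> B) = (\<Sum>D\<in>Pow {v. even (v - k) \<and> (k, v) \<in> A \<and> (k + 1, v) \<in> B}.
     (\<Prod>v\<in>D. cell_factor v) * cell_sum (A - Pair k ` D) * cell_sum (B - Pair (k + 1) ` D))"
proof -
  let ?X = "{v. even (v - k) \<and> (k, v) \<in> A \<and> (k + 1, v) \<in> B}"
  define e where "e v = {(k, v), (k + 1, v)}" for v :: int
  define C where "C = {l. cell_edge l \<and> l \<subseteq> A \<union> B \<and> \<not> l \<subseteq> A \<and> \<not> l \<subseteq> B}"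
  have AB: "A \<inter> B = {}" using A B by fastforce
  have inje: "inj e" by (auto simp: inj_def e_def doubleton_eq_iff)
  have Ceq: "C = e ` ?X"
  proof (intro equalityI subsetI)
    fix l assume "l \<in> C"
    then have l: "cell_edge l" "l \<subseteq> A \<union> B" "\<not> l \<subseteq> A" "\<not> l \<subseteq> B" by (auto simp: C_def)
    from l(1) show "l \<in> e ` ?X" unfolding cell_edge_def
    proof (elim disjE exE conjE)
      fix i v assume iv: "l = {(i, v), (i, v + 1)}"
      show ?thesis using l(2-4) A[of i v] A[of i "v + 1"] B[of i v] B[of i "v + 1"]
        unfolding iv by auto
    next
      fix i v assume iv: "even (v - i)" "l = {(i, v), (i + 1, v)}"
      have "(i, v) \<in> A" "(i + 1, v) \<in> B"
        using l(2-4) A[of "i + 1" v] B[of i v] unfolding iv(2) by auto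
      moreover from this have "i = k" using A[of i v] B[of "i + 1" v] by simp
      ultimately show ?thesis using iv by (auto simp: e_def)
    qed
  next
    fix l assume "l \<in> e ` ?X"
    then obtain v where v: "l = e v" "even (v - k)" "(k, v) \<in> A" "(k + 1, v) \<in> B" by auto
    moreover have "(k + 1, v) \<notin> A" "(k, v) \<notin> B" using v AB by blast+
    ultimately show "l \<in> C" by (auto simp: C_def e_def cell_edge_def)
  qed
  have dis: "disjoint C" unfolding disjoint_def Ceq by (auto simp: e_def)
  have "cell_sum (A \<union> B) = (\<Sum>V\<in>Pow C. (\<Prod>l\<in>V. cell_weight l) * cell_sum (A - \<Union>V) * cell_sum (B - \<Union>V))"
    by (rule match_sum_split[OF fin AB C_def dis])
  also have "\<dots> = (\<Sum>D\<in>Pow ?X. (\<Prod>l\<in>e ` D. cell_weight l) * cell_sum (A - \<Union>(e ` D)) * cell_sum (B - \<Union>(e ` D)))"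
  proof -
    have "inj_on ((`) e) (Pow ?X)" by (rule inj_onI) (simp only: inj_image_eq_iff[OF inje])
    moreover have "Pow C = (`) e ` Pow ?X" unfolding Ceq by (simp add: image_Pow_surj)
    ultimately show ?thesis by (simp only: sum.reindex o_def)
  qed
  also have "\<dots> = (\<Sum>D\<in>Pow ?X. (\<Prod>v\<in>D. cell_factor v) * cell_sum (A - Pair k ` D) * cell_sum (B - Pair (k + 1) ` D))"
  proof (rule sum.cong[OF refl])
    fix D assume "D \<in> Pow ?X"
    have "(\<Prod>l\<in>e ` D. cell_weight l) = (\<Prod>v\<in>D. cell_factor v)"
      using inj_on_subset[OF inje] by (subst prod.reindex) (auto simp: e_def cell_weight_vertical)
    moreover have "A - \<Union>(e ` D) = A - Pair k ` D" using A[of "k + 1"] by (auto simp: e_def)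
    moreover have "B - \<Union>(e ` D) = B - Pair (k + 1) ` D" using B[of k] by (auto simp: e_def)
    ultimately show "(\<Prod>l\<in>e ` D. cell_weight l) * cell_sum (A - \<Union>(e ` D)) * cell_sum (B - \<Union>(e ` D))
      = (\<Prod>v\<in>D. cell_factor v) * cell_sum (A - Pair k ` D) * cell_sum (B - Pair (k + 1) ` D)" by simp
  qed
  finally show ?thesis .
qed

lemma half_sum_rec:
  assumes r: "r > 0" and k: "k = h - int r" and W: "even W" and kpar: "\<And>v. v \<in> P \<Longrightarrow> odd (v - k)"
  shows "half_sum h W r P = (\<Sum>D\<in>Pow {v \<in> {h mod 2..W - k - 1}. even (v - k)}.
     cell_sum (Pair k ` ({h mod 2..W - k - 1} - P - D)) * ((\<Prod>v\<in>D. cell_factor v) * half_sum h W (r - 1) D))"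
proof -
  let ?S = "{h mod 2..W - k - 1}"
  let ?X = "{v \<in> ?S. even (v - k)}"
  define A where "A = Pair k ` (?S - P)"
  define B where "B = half_region h W (k + 1)"
  let ?Y = "{v. even (v - k) \<and> (k, v) \<in> A \<and> (k + 1, v) \<in> B}"
  have kh: "k < h" using r k by simp
  have "half_region h W k - Pair k ` P = A \<union> B"
    unfolding half_region_Suc[OF kh] A_def B_def by (auto simp: half_region_def)
  then have "half_sum h W r P = cell_sum (A \<union> B)"
    using r by (simp add: half_sum_def k[symmetric])
  also have "\<dots> = (\<Sum>D\<in>Pow ?Y. (\<Prod>v\<in>D. cell_factor v) * cell_sum (A - Pair k ` D) * cell_sum (B - Pair (k + 1) ` D))"
    by (rule cell_sum_cut) (auto simp: A_def B_def finite_half_region, auto simp: half_region_def)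
  also have "\<dots> = (\<Sum>D\<in>Pow ?X.
     cell_sum (Pair k ` (?S - P - D)) * ((\<Prod>v\<in>D. cell_factor v) * half_sum h W (r - 1) D))"
  proof (rule sum.mono_neutral_cong_left)
    show "finite (Pow ?X)" by (auto intro: finite_subset[of _ ?S])
    show "Pow ?Y \<subseteq> Pow ?X" by (auto simp: A_def)
    \<comment> \<open>The next strip is shorter at its east end, but the cell missing there lies
      over an up cell, which has no crossing. For \<open>r = 1\<close> there is no next strip; the
      nonempty \<open>D\<close> then contribute 0 by the convention for \<open>half_sum\<close> with
      no strips.\<close>
    have YX: "?Y = ?X" if "r \<noteq> 1"
    proof -
      have "k + 1 < h" using that k r by simp
      moreover have "v \<noteq> W - k - 1" "v \<notin> P" if "even (v - k)" for v using that W kpar[of v] by auto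
      ultimately show ?thesis by (fastforce simp: A_def B_def half_region_def)
    qed
    then show "\<forall>D\<in>Pow ?X - Pow ?Y. cell_sum (Pair k ` (?S - P - D)) * ((\<Prod>v\<in>D. cell_factor v) * half_sum h W (r - 1) D) = 0"
      by (cases "r = 1") (auto simp: half_sum_def)
    fix D assume D: "D \<in> Pow ?Y"
    have "A - Pair k ` D = Pair k ` (?S - P - D)" by (auto simp: A_def)
    moreover have "cell_sum (B - Pair (k + 1) ` D) = half_sum h W (r - 1) D"
    proof (cases "r = 1")
      case True
      then have "B = {}" using k half_region_empty[of h W] by (simp add: B_def)
      then show ?thesis using True D by (simp add: half_sum_def)
    next
      case False
      then have "h - int (r - 1) = k + 1" "(r - 1 = 0) = False" using r k by auto
      then show ?thesis by (simp only: half_sum_def B_def if_False)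
    qed
    ultimately show "(\<Prod>v\<in>D. cell_factor v) * cell_sum (A - Pair k ` D) * cell_sum (B - Pair (k + 1) ` D)
      = cell_sum (Pair k ` (?S - P - D)) * ((\<Prod>v\<in>D. cell_factor v) * half_sum h W (r - 1) D)" by simp
  qed
  finally show ?thesis .
qed

definition strip_fn :: "nat \<Rightarrow> nat \<Rightarrow> int \<Rightarrow> real" where
  "strip_fn r j v = (if even r then odd_fn j (of_int v) else even_fn j (of_int v))"

text \<open>Induction on the number of strips, the topmost ones being counted first. Summing the
  determinant of the strips above over the gaps between the removed cells raises the central
  factorials by one order and turns rows into differences of rows. The size grows by one at every
  second strip, so all but one number of removed cells give 0.\<close>

lemma half_sum_det:
  assumes W: "even W" "h \<le> W" and r: "int r \<le> h"
    and inc: "\<And>i j. i < j \<Longrightarrow> j < n \<Longrightarrow> p i < p j"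
    and rng: "\<And>i. i < n \<Longrightarrow> p i \<in> {h mod 2..W - (h - int r) - 1}"
    and par: "\<And>i. i < n \<Longrightarrow> odd (p i - (h - int r))"
  shows "half_sum h W r (p ` {..<n})
    = (if n = (r + 1) div 2 then det (mat n n (\<lambda>(i, j). strip_fn r j (p i))) else 0)"
  using r inc rng par
proof (induction r arbitrary: n p)
  case 0
  then show ?case by (auto simp: half_sum_def)
next
  case (Suc r)
  define k where "k = h - int (Suc r)"
  define lo where "lo = h mod 2"
  define hi where "hi = W - k - 1"
  note inc = Suc.prems(2) and rng = Suc.prems(3)[folded k_def, folded lo_def hi_def]
    and par = Suc.prems(4)[folded k_def]
  have lo01: "lo = 0 \<or> lo = 1" unfolding lo_def by auto
  have lohi: "lo \<le> hi"
  proof -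
    have "k < h" unfolding k_def by simp
    moreover have "h \<noteq> W" if "odd h" using that W(1) by auto
    ultimately show ?thesis using W lo01 unfolding lo_def hi_def
      by (cases "even h") (auto simp: odd_iff_mod_2_eq_one)
  qed
  have hipar: "odd (hi - k)" unfolding hi_def using W(1) by simp
  \<comment> \<open>The west end is the same column in all strips, so strips starting with a down
    cell and strips starting with an up cell alternate.\<close>
  have lopar: "even (lo - k) \<longleftrightarrow> odd r"
  proof -
    have "even (h mod 2 - h)" by presburger
    moreover have "lo - k = (h mod 2 - h) + (int r + 1)" unfolding lo_def k_def by simp
    ultimately show ?thesis by simp
  qed
  let ?w = "\<lambda>D. \<Prod>v\<in>D. cell_factor v"
  have rec: "half_sum h W (Suc r) (p ` {..<n}) = (\<Sum>D\<in>Pow {v \<in> {lo..hi}. even (v - k)}.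
     cell_sum (Pair k ` ({lo..hi} - p ` {..<n} - D)) * (?w D * half_sum h W r D))"
    using half_sum_rec[of "Suc r" k h W "p ` {..<n}"] W(1) par unfolding lo_def hi_def k_def by auto
  have mono: "p i \<le> p j" if "i \<le> j" "j < n" for i j using inc[of i j] that by (cases "i = j") auto
  have IH: "?w (f ` {..<m}) * half_sum h W r (f ` {..<m})
      = (if m = (r + 1) div 2 then det (mat m m (\<lambda>(i, j). cell_factor (f i) * strip_fn r j (f i))) else 0)"
    if f: "\<And>i j. i < j \<Longrightarrow> j < m \<Longrightarrow> f i < f j" "\<And>i. i < m \<Longrightarrow> lo \<le> f i \<and> f i < hi \<and> even (f i - k)" for f m
  proof -
    have k1: "h - int r = k + 1" unfolding k_def by simp
    have hs: "half_sum h W r (f ` {..<m})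
      = (if m = (r + 1) div 2 then det (mat m m (\<lambda>(i, j). strip_fn r j (f i))) else 0)"
    proof (rule Suc.IH)
      show "f i \<in> {h mod 2..W - (h - int r) - 1}" if "i < m" for i
        using f(2)[OF that] unfolding k1 lo_def hi_def by auto
      show "odd (f i - (h - int r))" if "i < m" for i using f(2)[OF that] unfolding k1 by auto
    qed (use Suc.prems(1) f in auto)
    have "inj_on f {..<m}"
      by (rule linorder_inj_onI) (use f(1) in \<open>fastforce+\<close>)
    then have "?w (f ` {..<m}) = (\<Prod>i<m. cell_factor (f i))" by (simp add: prod.reindex)
    then show ?thesis
      unfolding hs using det_scale[of m "\<lambda>i. cell_factor (f i)" "\<lambda>_. 1" "\<lambda>i j. strip_fn r j (f i)"]
      by (cases "m = (r + 1) div 2") (simp_all only: if_True if_False mult_1_right prod.neutral_const mult_zero_right simp_thms)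
  qed
  show ?case
  proof (cases "even (Suc r)")
    case True
    then have odd: "odd r" by simp
    let ?I = "\<lambda>i. {v \<in> {block_start lo p i..<p i}. even (v - k)}"
    have n_eq: "n = (r + 1) div 2 \<longleftrightarrow> n = (Suc r + 1) div 2" using odd by presburger
    have "half_sum h W (Suc r) (p ` {..<n})
      = (\<Sum>f\<in>PiE {..<n} ?I. ?w (f ` {..<n}) * half_sum h W r (f ` {..<n}))"
      unfolding rec by (rule strip_sum_D) (use inc rng par hipar lopar lohi odd in auto)
    also have "\<dots> = (\<Sum>f\<in>PiE {..<n} ?I. if n = (r + 1) div 2
        then det (mat n n (\<lambda>(i, j). cell_factor (f i) * strip_fn r j (f i))) else 0)"
    proof (rule sum.cong[OF refl], rule IH)
      fix f assume f: "f \<in> PiE {..<n} ?I"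
      then have fi: "block_start lo p i \<le> f i \<and> f i < p i \<and> even (f i - k)" if "i < n" for i
        using that by (auto simp: PiE_iff simp del: even_diff)
      show "f i < f j" if "i < j" "j < n" for i j
      proof -
        have "p i \<le> p (j - 1)" by (rule mono) (use that in auto)
        then show ?thesis using fi[of i] fi[of j] that by (auto simp: block_start_def)
      qed
      show "lo \<le> f i \<and> f i < hi \<and> even (f i - k)" if "i < n" for i
      proof -
        have "i - 1 < n" using that by simp
        then have "lo \<le> block_start lo p i" using rng[of "i - 1"] by (auto simp: block_start_def)
        then show ?thesis using fi[OF that] rng[OF that] by (auto simp del: even_diff)
      qed
    qed
    also have "\<dots> = (if n = (r + 1) div 2
        then det (mat n n (\<lambda>(i, j). \<Sum>v\<in>?I i. cell_factor v * strip_fn r j v)) else 0)"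
    proof -
      have "finite (?I i)" for i by (rule finite_subset[of _ "{block_start lo p i..<p i}"]) auto
      then show ?thesis by (subst det_row_sums) auto
    qed
    also have "det (mat n n (\<lambda>(i, j). \<Sum>v\<in>?I i. cell_factor v * strip_fn r j v))
      = det (mat n n (\<lambda>(i, j). if i = 0 then strip_fn (Suc r) j (p i)
          else strip_fn (Suc r) j (p i) - strip_fn (Suc r) j (p (i - 1))))"
    proof (rule det_mat_cong)
      fix i j assume i: "i < n" and "j < n"
      show "(case (i, j) of (i, j) \<Rightarrow> \<Sum>v\<in>?I i. cell_factor v * strip_fn r j v)
        = (case (i, j) of (i, j) \<Rightarrow> if i = 0 then strip_fn (Suc r) j (p i)
          else strip_fn (Suc r) j (p i) - strip_fn (Suc r) j (p (i - 1)))"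
      proof (cases "i = 0")
        case True
        have "(\<Sum>v\<in>{v \<in> {lo..<p 0}. even (v - k)}. cell_factor v * even_fn j (of_int v)) = odd_fn j (of_int (p 0))"
          by (rule even_fn_sum_first[OF lo01]) (use i True rng[of 0] par[of 0] lopar odd in auto)
        then show ?thesis using True odd by (simp add: strip_fn_def block_start_def)
      next
        case False
        have i1: "i - 1 < n" using i by simp
        have "0 \<le> p (i - 1)" using rng[OF i1] lo01 by auto
        moreover have "p (i - 1) \<le> p i" by (rule mono) (use i in auto)
        ultimately have "(\<Sum>v\<in>{v \<in> {p (i - 1) + 1..<p i}. even (v - k)}. cell_factor v * even_fn j (of_int v))
          = odd_fn j (of_int (p i)) - odd_fn j (of_int (p (i - 1)))"
          by (rule even_fn_sum) (use par[OF i1] par[OF i] in auto)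
        then show ?thesis using False odd by (simp add: strip_fn_def block_start_def)
      qed
    qed
    also have "\<dots> = det (mat n n (\<lambda>(i, j). strip_fn (Suc r) j (p i)))"
      by (rule det_row_differences)
    finally show ?thesis unfolding n_eq .
  next
    case False
    then have even: "even r" by simp
    let ?I = "\<lambda>i. {v \<in> {p i + 1..<p (Suc i)}. even (v - k)}"
    have n_eq: "n \<noteq> 0 \<and> n - 1 = (r + 1) div 2 \<longleftrightarrow> n = (Suc r + 1) div 2" using even by presburger
    have "half_sum h W (Suc r) (p ` {..<n})
      = (if n = 0 then 0 else \<Sum>f\<in>PiE {..<n - 1} ?I. ?w (f ` {..<n - 1}) * half_sum h W r (f ` {..<n - 1}))"
      unfolding rec by (rule strip_sum_U) (use inc rng par hipar lopar lohi even in auto)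
    also have "\<dots> = (if n = 0 then 0 else \<Sum>f\<in>PiE {..<n - 1} ?I. if n - 1 = (r + 1) div 2
        then det (mat (n - 1) (n - 1) (\<lambda>(i, j). odd_fn j (of_int (f i)))) else 0)"
    proof (rule if_cong[OF refl refl], rule sum.cong[OF refl])
      fix f assume f: "f \<in> PiE {..<n - 1} ?I"
      have fi: "p i < f i \<and> f i < p (Suc i) \<and> even (f i - k)" if "i < n - 1" for i
      proof -
        have "f i \<in> ?I i" by (rule PiE_mem[OF f]) (use that in simp)
        then show ?thesis by simp
      qed
      have lof: "lo \<le> p i \<and> f i < hi" if "i < n - 1" for i
      proof -
        have "i < n" "Suc i < n" using that by auto
        then have "p i \<in> {lo..hi}" "p (Suc i) \<in> {lo..hi}" using rng by blast+
        then show ?thesis using fi[OF that] by simp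
      qed
      have "?w (f ` {..<n - 1}) * half_sum h W r (f ` {..<n - 1}) = (if n - 1 = (r + 1) div 2
        then det (mat (n - 1) (n - 1) (\<lambda>(i, j). cell_factor (f i) * strip_fn r j (f i))) else 0)"
      proof (rule IH)
        show "f i < f j" if "i < j" "j < n - 1" for i j
        proof -
          have "i < n - 1" "Suc i \<le> j" "j < n" using that by auto
          then have "f i < p (Suc i)" "p (Suc i) \<le> p j" "p j < f j"
            using fi[of i] fi[of j] mono[of "Suc i" j] that by blast+
          then show ?thesis by simp
        qed
        show "lo \<le> f i \<and> f i < hi \<and> even (f i - k)" if "i < n - 1" for i
          using fi[OF that] lof[OF that] by auto
      qed
      also have "det (mat (n - 1) (n - 1) (\<lambda>(i, j). cell_factor (f i) * strip_fn r j (f i)))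
        = det (mat (n - 1) (n - 1) (\<lambda>(i, j). odd_fn j (of_int (f i))))"
      proof (rule det_mat_cong)
        fix i j assume i: "i < n - 1"
        \<comment> \<open>Here each crossing lies east of some removed cell, so column 0 and its
          weight 1/2 do not occur.\<close>
        have "f i > 0" using fi[OF i] lof[OF i] lo01 by auto
        then show "(case (i, j) of (i, j) \<Rightarrow> cell_factor (f i) * strip_fn r j (f i))
          = (case (i, j) of (i, j) \<Rightarrow> odd_fn j (of_int (f i)))"
          using even by (simp add: strip_fn_def cell_factor_def)
      qed
      finally show "?w (f ` {..<n - 1}) * half_sum h W r (f ` {..<n - 1}) = (if n - 1 = (r + 1) div 2
        then det (mat (n - 1) (n - 1) (\<lambda>(i, j). odd_fn j (of_int (f i)))) else 0)" .
    qed
    also have "\<dots> = (if n = 0 then 0 else if n - 1 = (r + 1) div 2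
        then det (mat (n - 1) (n - 1) (\<lambda>(i, j). \<Sum>v\<in>?I i. odd_fn j (of_int v))) else 0)"
    proof -
      have "finite (?I i)" for i by (rule finite_subset[of _ "{p i + 1..<p (Suc i)}"]) auto
      then show ?thesis by (subst det_row_sums) auto
    qed
    also have "\<dots> = (if n = (Suc r + 1) div 2 then det (mat n n (\<lambda>(i, j). strip_fn (Suc r) j (p i))) else 0)"
    proof (cases "n \<noteq> 0 \<and> n - 1 = (r + 1) div 2")
      case True
      then obtain m where m: "n = Suc m" by (cases n) auto
      have "det (mat n n (\<lambda>(i, j). strip_fn (Suc r) j (p i)))
        = det (mat n n (\<lambda>(i, j). if i = 0 then strip_fn (Suc r) j (p i)
          else strip_fn (Suc r) j (p i) - strip_fn (Suc r) j (p (i - 1))))"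
        by (rule det_row_differences[symmetric])
      \<comment> \<open>Since \<open>even_fn 0\<close> is the constant 1, taking row differences
        makes column 0 a unit vector, and the matrix shrinks by one.\<close>
      also have "\<dots> = det (mat m m (\<lambda>(i, j). strip_fn (Suc r) (Suc j) (p (Suc i)) - strip_fn (Suc r) (Suc j) (p i)))"
        unfolding m using det_unit_first_column[of "\<lambda>i j. if i = 0 then strip_fn (Suc r) j (p i)
          else strip_fn (Suc r) j (p i) - strip_fn (Suc r) j (p (i - 1))" m] even by (simp add: strip_fn_def)
      also have "\<dots> = det (mat m m (\<lambda>(i, j). \<Sum>v\<in>?I i. odd_fn j (of_int v)))"
      proof (rule det_mat_cong)
        fix i j assume i: "i < m"
        then have "i < n" "Suc i < n" using m by auto
        moreover have "0 \<le> p i" using rng[of i] lo01 \<open>i < n\<close> by auto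
        ultimately have "(\<Sum>v\<in>?I i. odd_fn j (of_int v))
          = even_fn (Suc j) (of_int (p (Suc i))) - even_fn (Suc j) (of_int (p i))"
          by (intro odd_fn_sum) (use mono[of i "Suc i"] par in auto)
        then show "(case (i, j) of (i, j) \<Rightarrow> strip_fn (Suc r) (Suc j) (p (Suc i)) - strip_fn (Suc r) (Suc j) (p i))
          = (case (i, j) of (i, j) \<Rightarrow> \<Sum>v\<in>?I i. odd_fn j (of_int v))"
          using even by (simp add: strip_fn_def)
      qed
      finally show ?thesis using True n_eq m by simp
    next
      case False
      then show ?thesis using n_eq by auto
    qed
    finally show ?thesis .
  qed
qed

section \<open>Vandermonde products and the closed enumeration of a half region\<close>

definition vdm :: "('a::linorder \<Rightarrow> real) \<Rightarrow> 'a set \<Rightarrow> real" where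
  "vdm X P = (\<Prod>q\<in>P. \<Prod>p\<in>{p \<in> P. p < q}. X q - X p)"

lemma increasing_inj_on:
  fixes p :: "nat \<Rightarrow> 'a::linorder"
  assumes "\<And>i j. i < j \<Longrightarrow> j < n \<Longrightarrow> p i < p j"
  shows "inj_on p {..<n}"
  by (rule inj_onI) (metis assms lessThan_iff linorder_neqE_nat order_less_irrefl)

lemma vdm_image:
  fixes p :: "nat \<Rightarrow> 'a::linorder"
  assumes inc: "\<And>i j. i < j \<Longrightarrow> j < n \<Longrightarrow> p i < p j"
  shows "vdm X (p ` {..<n}) = (\<Prod>j<n. \<Prod>i<j. X (p j) - X (p i))"
proof -
  have inj: "inj_on p {..<n}"
    by (rule increasing_inj_on) (rule inc)
  have less: "{q \<in> p ` {..<n}. q < p j} = p ` {..<j}" if "j < n" for j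
  proof -
    have "p i < p j \<longleftrightarrow> i < j" if "i < n" for i
      using inc[of i j] inc[of j i] that \<open>j < n\<close> by (metis linorder_neqE_nat order_less_asym order_less_irrefl)
    then show ?thesis using that by auto
  qed
  have "(\<Prod>p'\<in>{q \<in> p ` {..<n}. q < p j}. X (p j) - X p') = (\<Prod>i<j. X (p j) - X (p i))" if "j < n" for j
    unfolding less[OF that] using inj_on_subset[OF inj, of "{..<j}"] that by (subst prod.reindex) auto
  then show ?thesis unfolding vdm_def by (subst prod.reindex[OF inj]) auto
qed

lemma increasing_enumeration:
  fixes P :: "'a::linorder set"
  assumes "finite P"
  obtains p where "P = p ` {..<card P}" "\<And>i j. i < j \<Longrightarrow> j < card P \<Longrightarrow> p i < p j"
proof
  let ?p = "\<lambda>i. sorted_list_of_set P ! i"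
  show "P = ?p ` {..<card P}"
    using assms by (metis length_sorted_list_of_set lessThan_atLeast0 list.set_map map_nth set_sorted_list_of_set set_upt)
  show "?p i < ?p j" if "i < j" "j < card P" for i j
    using strict_sorted_list_of_set[of P] that assms
    by (simp add: sorted_wrt_iff_nth_less)
qed

lemma det_newton_scaled:
  fixes x :: "nat \<Rightarrow> real"
  shows "det (mat n n (\<lambda>(i, j). r i * (\<Prod>k<j. x i - c k) / d j))
    = (\<Prod>i<n. r i) * (\<Prod>j<n. \<Prod>i<j. x j - x i) / (\<Prod>j<n. d j)"
proof -
  have "det (mat n n (\<lambda>(i, j). r i * (\<Prod>k<j. x i - c k) / d j))
    = det (mat n n (\<lambda>(i, j). r i * inverse (d j) * (\<Prod>k<j. x i - c k)))"
    by (rule det_mat_cong) (simp add: divide_inverse mult_ac)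
  also have "\<dots> = (\<Prod>i<n. r i) * (\<Prod>j<n. inverse (d j)) * (\<Prod>j<n. \<Prod>i<j. x j - x i)"
    unfolding det_scale det_newton ..
  finally show ?thesis by (simp add: divide_inverse prod_inversef[symmetric] mult_ac o_def)
qed

lemma odd_fn_half: "odd_fn j v = (v / 2) * (\<Prod>i<j. (v / 2)\<^sup>2 - ((2 * real i + 1) / 2)\<^sup>2) / fact (2 * j + 1)"
proof -
  have "(\<Prod>i<j. v\<^sup>2 - (2 * real i + 1)\<^sup>2) = (\<Prod>i<j. 4 * ((v / 2)\<^sup>2 - ((2 * real i + 1) / 2)\<^sup>2))"
    by (rule prod.cong) (auto simp: power_divide)
  also have "\<dots> = 4 ^ j * (\<Prod>i<j. (v / 2)\<^sup>2 - ((2 * real i + 1) / 2)\<^sup>2)"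
    by (simp only: prod.distrib prod_constant card_lessThan)
  finally show ?thesis unfolding odd_fn_def by (simp only:) (simp del: fact_Suc)
qed

lemma even_fn_half: "even_fn j v = 1 * (\<Prod>i<j. (v / 2)\<^sup>2 - (real i)\<^sup>2) / fact (2 * j)"
proof -
  have "(\<Prod>i<j. v\<^sup>2 - (2 * real i)\<^sup>2) = (\<Prod>i<j. 4 * ((v / 2)\<^sup>2 - (real i)\<^sup>2))"
    by (rule prod.cong) (auto simp: power_divide power_mult_distrib)
  also have "\<dots> = 4 ^ j * (\<Prod>i<j. (v / 2)\<^sup>2 - (real i)\<^sup>2)"
    by (simp only: prod.distrib prod_constant card_lessThan)
  finally show ?thesis unfolding even_fn_def by (simp only:) simp
qed

lemma H2_odd: "H2 (2 * n + 1) = (\<Prod>j<n. fact (2 * j + 1))"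
proof -
  have "H2 (2 * n + 1) = (\<Prod>i=1..n. fact (2 * n + 1 - 2 * i))" by (simp add: H2_def)
  also have "\<dots> = (\<Prod>j<n. fact (2 * j + 1))"
    by (rule prod.reindex_bij_witness[of _ "\<lambda>j. n - j" "\<lambda>i. n - i"]) (auto simp del: fact_Suc intro!: arg_cong[of _ _ fact])
  finally show ?thesis .
qed

lemma H2_even: "H2 (2 * n) = (\<Prod>j<n. fact (2 * j))"
proof -
  have "H2 (2 * n) = (\<Prod>i=1..n. fact (2 * n - 2 * i))" by (simp add: H2_def)
  also have "\<dots> = (\<Prod>j<n. fact (2 * j))"
    by (rule prod.reindex_bij_witness[of _ "\<lambda>j. n - j" "\<lambda>i. n - i"]) (auto intro!: arg_cong[of _ _ fact])
  finally show ?thesis .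
qed

text \<open>Position \<open>p\<close> is the unit segment from \<open>p - 1\<close> to
  \<open>p\<close> on the base; the doubled abscissa of its midpoint is
  \<open>2 p - 1\<close>.\<close>

definition base_cells :: "nat set \<Rightarrow> (int \<times> int) set" where
  "base_cells S = (\<lambda>p. (0, 2 * int p - 1)) ` S"

text \<open>Squared abscissa of the midpoint of position \<open>p\<close>. Apart from the leading
  factor of the odd ones, the central factorials are polynomials in this quantity.\<close>

definition xsq :: "nat \<Rightarrow> real" where
  "xsq p = (real p - 1 / 2)\<^sup>2"

lemma base_cells_Pair: "base_cells S = Pair 0 ` (\<lambda>p. 2 * int p - 1) ` S"
  by (auto simp: base_cells_def)

text \<open>At half the argument the strip functions are Newton products in \<open>xsq\<close>.
  Their nodes drop out of the determinant, the normalising factorials leave as column factors, and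
  for even \<open>r\<close> the odd functions leave \<open>p - 1 / 2\<close> as a row
  factor.\<close>

lemma half_region_formula:
  assumes S: "S \<subseteq> {1..w}" and n: "n \<le> w" "n > 0" and r: "r = 2 * n \<or> r = 2 * n - 1"
  shows "cell_sum (half_region (int r) (2 * int w) 0 - base_cells S)
    = (if card S = n then (\<Prod>p\<in>S. if even r then real p - 1 / 2 else 1) * vdm xsq S
         / (\<Prod>j<n. if even r then fact (2 * j + 1) else fact (2 * j)) else 0)"
proof -
  have finS: "finite S" using S finite_subset by blast
  then obtain p where p: "S = p ` {..<card S}" "\<And>i j. i < j \<Longrightarrow> j < card S \<Longrightarrow> p i < p j"
    by (rule increasing_enumeration) blast
  let ?q = "\<lambda>i. 2 * int (p i) - 1" and ?m = "card S"
  let ?f = "\<lambda>s. if even r then real s - 1 / 2 else 1"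
  let ?c = "\<lambda>k. if even r then ((2 * real k + 1) / 2)\<^sup>2 else (real k)\<^sup>2"
  let ?d = "\<lambda>j. if even r then fact (2 * j + 1) else fact (2 * j) :: real"
  have pS: "1 \<le> p i \<and> p i \<le> w" if "i < ?m" for i
  proof -
    have "p i \<in> S" by (subst p(1)) (use that in simp)
    then show ?thesis using S by auto
  qed
  have "base_cells S = Pair 0 ` ?q ` {..<?m}"
    unfolding base_cells_Pair by (subst p(1)) (simp only: image_image)
  then have "cell_sum (half_region (int r) (2 * int w) 0 - base_cells S)
    = half_sum (int r) (2 * int w) r (?q ` {..<?m})"
    using n r by (auto simp: half_sum_def)
  also have "\<dots> = (if ?m = (r + 1) div 2 then det (mat ?m ?m (\<lambda>(i, j). strip_fn r j (?q i))) else 0)"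
  proof (rule half_sum_det)
    show "?q i \<in> {int r mod 2..2 * int w - (int r - int r) - 1}" if "i < ?m" for i
    proof -
      have "int r mod 2 \<le> 1" by presburger
      then show ?thesis using pS[OF that] by simp
    qed
  qed (use n r p(2) in auto)
  also have "det (mat ?m ?m (\<lambda>(i, j). strip_fn r j (?q i)))
    = det (mat ?m ?m (\<lambda>(i, j). ?f (p i) * (\<Prod>k<j. xsq (p i) - ?c k) / ?d j))"
  proof (rule det_mat_cong)
    fix i j assume "i < ?m"
    have "of_int (?q i) / 2 = real (p i) - 1 / 2" by (simp add: field_simps)
    then show "(case (i, j) of (i, j) \<Rightarrow> strip_fn r j (?q i))
      = (case (i, j) of (i, j) \<Rightarrow> ?f (p i) * (\<Prod>k<j. xsq (p i) - ?c k) / ?d j)"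
      unfolding strip_fn_def xsq_def odd_fn_half even_fn_half
      by (cases "even r") (simp_all only: prod.case if_True if_False)
  qed
  also have "\<dots> = (\<Prod>i<?m. ?f (p i)) * (\<Prod>j<?m. \<Prod>i<j. xsq (p j) - xsq (p i)) / (\<Prod>j<?m. ?d j)"
    by (rule det_newton_scaled)
  also have "(\<Prod>j<?m. \<Prod>i<j. xsq (p j) - xsq (p i)) = vdm xsq S"
  proof -
    have "vdm xsq (p ` {..<?m}) = (\<Prod>j<?m. \<Prod>i<j. xsq (p j) - xsq (p i))"
      by (rule vdm_image) (rule p(2))
    then show ?thesis by (simp only: p(1)[symmetric])
  qed
  also have "(\<Prod>i<?m. ?f (p i)) = (\<Prod>s\<in>S. ?f s)"
  proof -
    have "inj_on p {..<?m}" by (rule increasing_inj_on) (rule p(2))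
    from prod.reindex[OF this, of ?f] show ?thesis by (simp only: p(1)[symmetric] o_def)
  qed
  also have "(r + 1) div 2 = n" using n r by auto
  finally show ?thesis by (simp only: cong: if_cong)
qed

text \<open>For \<open>n = 0\<close> the region is empty and the set difference cannot notice
  \<open>S\<close>, while the right-hand side does; this is what the third hypothesis is
  for.\<close>

lemma upper_half_formula:
  assumes "S \<subseteq> {1..w}" "n \<le> w" "n = 0 \<Longrightarrow> S = {}"
  shows "cell_sum (half_region (2 * int n) (2 * int w) 0 - base_cells S)
    = (if card S = n then (\<Prod>p\<in>S. real p - 1 / 2) * vdm xsq S / H2 (2 * n + 1) else 0)"
proof (cases "n = 0")
  case True
  then show ?thesis using assms(3) half_region_empty[of 0] by (simp add: vdm_def H2_def base_cells_def)
next
  case False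
  then show ?thesis using half_region_formula[OF assms(1,2), of "2 * n"] unfolding H2_odd by simp
qed

lemma lower_half_formula:
  assumes "S \<subseteq> {1..w}" "n \<le> w" "n = 0 \<Longrightarrow> S = {}"
  shows "cell_sum (half_region (2 * int n - 1) (2 * int w) 0 - base_cells S)
    = (if card S = n then vdm xsq S / H2 (2 * n) else 0)"
proof (cases "n = 0")
  case True
  have "half_region (- 1) (2 * int w) 0 = {}" by (auto simp: half_region_def)
  then show ?thesis using assms(3) True by (simp add: vdm_def H2_def base_cells_def)
next
  case False
  then have "int (2 * n - 1) = 2 * int n - 1" "odd (2 * n - 1)" by auto
  then show ?thesis using half_region_formula[OF assms(1,2), of "2 * n - 1"] False unfolding H2_even by simp
qed

section \<open>From triangles to cells\<close>

fun cell_of :: "triangle \<Rightarrow> int \<times> int" where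
  "cell_of (Up j k) = (k, 2 * j + k + 1)"
| "cell_of (Down j k) = (k - 1, 2 * j + k + 1)"

lemma inj_cell_of: "inj cell_of"
proof (rule injI)
  fix s t assume "cell_of s = cell_of t"
  then show "s = t" by (cases s; cases t) (auto, presburger+)
qed

lemma cell_of_surj: "\<exists>t. cell_of t = c"
proof (cases c)
  case (Pair i v)
  show ?thesis
  proof (cases "odd (v - i)")
    case True
    then have "2 * ((v - i - 1) div 2) = v - i - 1" by simp
    then show ?thesis unfolding Pair by (intro exI[of _ "Up ((v - i - 1) div 2) i"]) simp
  next
    case False
    then have "2 * ((v - i - 2) div 2) = v - i - 2" by simp
    then show ?thesis unfolding Pair by (intro exI[of _ "Down ((v - i - 2) div 2) (i + 1)"]) simp
  qed
qed

text \<open>Equally oriented triangles with two common corners coincide, so a lozenge joins an up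
  triangle to the down triangle across one of its three sides.\<close>

lemma is_lozenge_iff:
  "is_lozenge l \<longleftrightarrow> (\<exists>j k. l = {Up j k, Down j k} \<or> l = {Up j k, Down (j - 1) (k + 1)} \<or> l = {Up j k, Down j (k + 1)})"
proof
  have UD: "\<exists>j k. {Up j k, Down j k} = {Up a b, Down c d} \<or> {Up j k, Down (j - 1) (k + 1)} = {Up a b, Down c d}
      \<or> {Up j k, Down j (k + 1)} = {Up a b, Down c d}"
    if "card (corners (Up a b) \<inter> corners (Down c d)) = 2" for a b c d
  proof -
    obtain x y where xy: "corners (Up a b) \<inter> corners (Down c d) = {x, y}" "x \<noteq> y"
      using \<open>card _ = 2\<close> by (auto simp: card_2_iff)
    then have "x \<in> corners (Up a b)" "x \<in> corners (Down c d)" "y \<in> corners (Up a b)" "y \<in> corners (Down c d)"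
      by blast+
    then have "c = a \<and> d = b \<or> c = a - 1 \<and> d = b + 1 \<or> c = a \<and> d = b + 1"
      using xy(2) by auto
    then show ?thesis by blast
  qed
  assume "is_lozenge l"
  then obtain s t where l: "l = {s, t}" "card (corners s \<inter> corners t) = 2" by (auto simp: is_lozenge_def)
  from l(2) obtain x y where xy: "corners s \<inter> corners t = {x, y}" "x \<noteq> y" by (auto simp: card_2_iff)
  then have xy': "x \<in> corners s" "x \<in> corners t" "y \<in> corners s" "y \<in> corners t" by blast+
  have c3: "card (corners u) = 3" for u by (cases u) auto
  have ne: "s \<noteq> t" using l(2) c3[of t] by auto
  show "\<exists>j k. l = {Up j k, Down j k} \<or> l = {Up j k, Down (j - 1) (k + 1)} \<or> l = {Up j k, Down j (k + 1)}"
  proof (cases s)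
    case s: (Up a b)
    show ?thesis
    proof (cases t)
      case t: (Up c d)
      have "a = c \<and> b = d" using xy' xy(2) unfolding s t by auto
      then show ?thesis using ne s t by simp
    next
      case t: (Down c d)
      show ?thesis using UD[of a b c d] l unfolding s t by metis
    qed
  next
    case s: (Down a b)
    show ?thesis
    proof (cases t)
      case t: (Up c d)
      show ?thesis using UD[of c d a b] l unfolding s t by (metis inf_commute insert_commute)
    next
      case t: (Down c d)
      have "a = c \<and> b = d" using xy' xy(2) unfolding s t by auto
      then show ?thesis using ne s t by simp
    qed
  qed
next
  have "corners (Up j k) \<inter> corners (Down j k) = {(j, k), (j + 1, k)}"
    "corners (Up j k) \<inter> corners (Down (j - 1) (k + 1)) = {(j, k), (j, k + 1)}"
    "corners (Up j k) \<inter> corners (Down j (k + 1)) = {(j + 1, k), (j, k + 1)}" for j k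
    by auto
  then have "card (corners (Up j k) \<inter> corners (Down j k)) = 2"
    "card (corners (Up j k) \<inter> corners (Down (j - 1) (k + 1))) = 2"
    "card (corners (Up j k) \<inter> corners (Down j (k + 1))) = 2" for j k
    by simp_all
  moreover assume "\<exists>j k. l = {Up j k, Down j k} \<or> l = {Up j k, Down (j - 1) (k + 1)} \<or> l = {Up j k, Down j (k + 1)}"
  ultimately show "is_lozenge l" unfolding is_lozenge_def by metis
qed

lemma cell_edge_image: "cell_edge (cell_of ` l) \<longleftrightarrow> is_lozenge l"
proof
  assume "is_lozenge l"
  then obtain j k where "l = {Up j k, Down j k} \<or> l = {Up j k, Down (j - 1) (k + 1)} \<or> l = {Up j k, Down j (k + 1)}"
    unfolding is_lozenge_iff by blast
  then show "cell_edge (cell_of ` l)"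
  proof (elim disjE)
    assume "l = {Up j k, Down j k}"
    then have "cell_of ` l = {(k - 1, 2 * j + k + 1), (k - 1 + 1, 2 * j + k + 1)}" by auto
    moreover have "even (2 * j + k + 1 - (k - 1))" by simp
    ultimately show ?thesis unfolding cell_edge_def by blast
  next
    assume "l = {Up j k, Down (j - 1) (k + 1)}"
    then have "cell_of ` l = {(k, 2 * j + k), (k, 2 * j + k + 1)}" by auto
    then show ?thesis unfolding cell_edge_def by blast
  next
    assume "l = {Up j k, Down j (k + 1)}"
    then have "cell_of ` l = {(k, 2 * j + k + 1), (k, 2 * j + k + 1 + 1)}" by auto
    then show ?thesis unfolding cell_edge_def by blast
  qed
next
  have l_eq: "l = {s, t}" if "cell_of ` l = {cell_of s, cell_of t}" for s t
    using that inj_image_eq_iff[OF inj_cell_of, of l "{s, t}"] by simp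
  assume "cell_edge (cell_of ` l)"
  then show "is_lozenge l" unfolding cell_edge_def
  proof (elim disjE exE conjE)
    fix k v assume l: "cell_of ` l = {(k, v), (k, v + 1)}"
    show ?thesis
    proof (cases "odd (v - k)")
      case True
      then obtain j where "v - k = 2 * j + 1" by (elim oddE)
      then have "v = 2 * j + k + 1" by simp
      then have "l = {Up j k, Down j (k + 1)}" using l by (intro l_eq) auto
      then show ?thesis unfolding is_lozenge_iff by blast
    next
      case False
      then have "even (v - k)" by simp
      then obtain j where "v - k = 2 * j" by (elim evenE)
      then have "v = 2 * j + k" by simp
      then have "l = {Up j k, Down (j - 1) (k + 1)}" using l by (intro l_eq) auto
      then show ?thesis unfolding is_lozenge_iff by blast
    qed
  next
    fix k v assume l: "even (v - k)" "cell_of ` l = {(k, v), (k + 1, v)}"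
    then obtain j where "v - k = 2 * j" by (elim evenE)
    then have "v = 2 * (j - 1) + (k + 1) + 1" by simp
    then have "l = {Up (j - 1) (k + 1), Down (j - 1) (k + 1)}" using l by (intro l_eq) auto
    then show ?thesis unfolding is_lozenge_iff by blast
  qed
qed

lemma M_eq_cell_sum:
  assumes "\<And>l. l \<subseteq> R \<Longrightarrow> is_lozenge l \<Longrightarrow> w l = cell_weight (cell_of ` l)"
  shows "M w R = cell_sum (cell_of ` R)"
  unfolding M_eq_match_sum
  by (rule match_sum_image[symmetric]) (use assms in \<open>auto simp: cell_edge_image inj_on_subset[OF inj_cell_of]\<close>)

text \<open>Strip \<open>k\<close> lies between the heights \<open>k\<close> and
  \<open>k + 1\<close>, so reflection in the line of height 0 sends it to strip
  \<open>- 1 - k\<close>.\<close>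

definition reflect :: "int \<times> int \<Rightarrow> int \<times> int" where
  "reflect c = (- 1 - fst c, snd c)"

lemma reflect_reflect [simp]: "reflect (reflect c) = c"
  by (simp add: reflect_def)

lemma inj_reflect: "inj reflect"
  by (metis injI reflect_reflect)

lemma reflect_image_image [simp]: "reflect ` reflect ` l = l"
  by (simp add: image_image)

lemma cell_sum_reflect: "cell_sum (reflect ` R) = cell_sum R"
proof (rule match_sum_image)
  show "inj_on reflect R" using inj_reflect inj_on_subset by blast
  have e: "cell_edge (reflect ` l)" if "cell_edge l" for l
    using that unfolding cell_edge_def
  proof (elim disjE exE conjE)
    fix k v assume "l = {(k, v), (k, v + 1)}"
    then have "reflect ` l = {(- 1 - k, v), (- 1 - k, v + 1)}" by (simp add: reflect_def)
    then show "(\<exists>k v. reflect ` l = {(k, v), (k, v + 1)}) \<or> (\<exists>k v. even (v - k) \<and> reflect ` l = {(k, v), (k + 1, v)})"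
      by blast
  next
    fix k v assume "even (v - k)" "l = {(k, v), (k + 1, v)}"
    then have "reflect ` l = {(- 2 - k, v), (- 2 - k + 1, v)}" "even (v - (- 2 - k))"
      by (auto simp: reflect_def)
    then show "(\<exists>k v. reflect ` l = {(k, v), (k, v + 1)}) \<or> (\<exists>k v. even (v - k) \<and> reflect ` l = {(k, v), (k + 1, v)})"
      by blast
  qed
  show "cell_edge (reflect ` l) = cell_edge l" for l using e[of l] e[of "reflect ` l"] by auto
  have w: "(\<exists>k. reflect ` l = {(k, 0), (k + 1, 0)})" if "l = {(k, 0), (k + 1, 0)}" for l k
    by (rule exI[of _ "- 2 - k"]) (use that in \<open>auto simp: reflect_def\<close>)
  have "(\<exists>k. reflect ` l = {(k, 0), (k + 1, 0)}) = (\<exists>k. l = {(k, 0), (k + 1, 0)})" for l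
    using w[of l] w[of "reflect ` l"] reflect_image_image by metis
  then show "cell_weight (reflect ` l) = cell_weight l" for l by (simp add: cell_weight_def)
qed

section \<open>The regions and their dents in cell coordinates\<close>

definition cells_in :: "(real \<Rightarrow> int \<Rightarrow> bool) \<Rightarrow> (int \<times> int) set" where
  "cells_in P = {(i, v). if odd (v - i)
     then P (of_int (v - 1) / 2) i \<and> P (of_int (v + 1) / 2) i \<and> P (of_int v / 2) (i + 1)
     else P (of_int (v - 1) / 2) (i + 1) \<and> P (of_int (v + 1) / 2) (i + 1) \<and> P (of_int v / 2) i}"

lemma cell_of_triangles_in: "cell_of ` triangles_in P = cells_in P"
proof -
  have "t \<in> triangles_in P \<longleftrightarrow> cell_of t \<in> cells_in P" for t
  proof (cases t)
    case (Up j k)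
    have "ucoord (j, k) = of_int (2 * j + k + 1 - 1) / 2" "ucoord (j + 1, k) = of_int (2 * j + k + 1 + 1) / 2"
      "ucoord (j, k + 1) = of_int (2 * j + k + 1) / 2"
      by (simp_all add: ucoord_def field_simps)
    note u = this
    have "t \<in> triangles_in P \<longleftrightarrow> P (ucoord (j, k)) k \<and> P (ucoord (j + 1, k)) k \<and> P (ucoord (j, k + 1)) (k + 1)"
      by (simp add: Up triangles_in_def)
    then show ?thesis unfolding u by (simp add: Up cells_in_def)
  next
    case (Down j k)
    have "ucoord (j, k) = of_int (2 * j + k + 1 - 1) / 2" "ucoord (j + 1, k) = of_int (2 * j + k + 1 + 1) / 2"
      "ucoord (j + 1, k - 1) = of_int (2 * j + k + 1) / 2"
      by (simp_all add: ucoord_def field_simps)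
    note u = this
    have "t \<in> triangles_in P \<longleftrightarrow> P (ucoord (j, k)) k \<and> P (ucoord (j + 1, k)) k \<and> P (ucoord (j + 1, k - 1)) (k - 1)"
      by (simp add: Down triangles_in_def)
    then show ?thesis unfolding u by (simp add: Down cells_in_def)
  qed
  note iff = this
  show ?thesis
  proof (rule Set.set_eqI)
    fix c
    obtain t where t: "cell_of t = c" using cell_of_surj by blast
    show "c \<in> cell_of ` triangles_in P \<longleftrightarrow> c \<in> cells_in P"
      unfolding t[symmetric] inj_image_mem_iff[OF inj_cell_of] by (rule iff)
  qed
qed

lemma zigzag_left_half: "zigzag_left k = of_int (- (k mod 2)) / 2"
  by (auto simp: zigzag_left_def even_iff_mod_2_eq_zero odd_iff_mod_2_eq_one)

lemma zigzag_right_half: "zigzag_right k = of_int (k mod 2) / 2"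
  by (auto simp: zigzag_right_def even_iff_mod_2_eq_zero odd_iff_mod_2_eq_one)

lemma half_le_iff: "(of_int a / 2 :: real) \<le> of_int b / 2 \<longleftrightarrow> a \<le> b"
  by (simp add: divide_le_cancel)

lemma minus_half: "real L - of_int k / 2 = of_int (2 * int L - k) / 2"
  "real L + of_int k / 2 = of_int (2 * int L + k) / 2"
  by simp_all

lemma cells_in_int:
  assumes "\<And>w k. P (of_int w / 2) k \<longleftrightarrow> R w k"
  shows "cells_in P = {(i, v). if odd (v - i) then R (v - 1) i \<and> R (v + 1) i \<and> R v (i + 1)
      else R (v - 1) (i + 1) \<and> R (v + 1) (i + 1) \<and> R v i}"
  unfolding cells_in_def assms ..

text \<open>\<open>f\<close> is the doubled zigzag. The last two hypotheses express that testing the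
  three corners of a triangle against it amounts to the single bound \<open>e \<le> v\<close>, for
  either orientation: in cell coordinates a zigzag is a straight vertical edge.\<close>

lemma cells_in_half_region:
  assumes zz: "\<And>k. zz k = of_int (f k) / 2" and h: "h mod 2 = e"
    and odd: "\<And>i v. odd (v - i) \<Longrightarrow> f i \<le> v - 1 \<and> f (i + 1) \<le> v \<longleftrightarrow> e \<le> v"
    and even: "\<And>i v. even (v - i) \<Longrightarrow> f (i + 1) \<le> v - 1 \<and> f i \<le> v \<longleftrightarrow> e \<le> v"
  shows "cells_in (\<lambda>u k. 0 \<le> k \<and> k \<le> h \<and> zz k \<le> u \<and> u \<le> real L - of_int k / 2) = half_region h (2 * int L) 0"
proof -
  define l where "l = int L"
  define R where "R v k \<longleftrightarrow> 0 \<le> k \<and> k \<le> h \<and> f k \<le> v \<and> v \<le> 2 * l - k" for v k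
  have R: "(if odd (v - i) then R (v - 1) i \<and> R (v + 1) i \<and> R v (i + 1)
      else R (v - 1) (i + 1) \<and> R (v + 1) (i + 1) \<and> R v i)
    \<longleftrightarrow> 0 \<le> i \<and> i < h \<and> e \<le> v \<and> v \<le> 2 * l - i - 1" for i v
  proof (cases "odd (v - i)")
    case True
    show ?thesis unfolding R_def if_P[OF True] using odd[OF True] by (smt (verit))
  next
    case False
    then have "v \<le> 2 * l - i - 1 \<longleftrightarrow> v \<le> 2 * l - i - 2" by presburger
    then show ?thesis unfolding R_def if_not_P[OF False] using even[of v i] False by (smt (verit))
  qed
  have P: "0 \<le> k \<and> k \<le> h \<and> zz k \<le> of_int w / 2 \<and> of_int w / 2 \<le> real L - of_int k / 2 \<longleftrightarrow> R w k" for w k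
    unfolding R_def zz l_def minus_half half_le_iff ..
  show ?thesis
    unfolding cells_in_int[where R = R, OF P] half_region_def h l_def[symmetric] R ..
qed

lemma cells_in_upper:
  "cells_in (\<lambda>u k. 0 \<le> k \<and> k \<le> 2 * int n \<and> zigzag_left k \<le> u \<and> u \<le> real L - of_int k / 2)
    = half_region (2 * int n) (2 * int L) 0"
  by (rule cells_in_half_region[where e = 0, OF zigzag_left_half]) presburger+

lemma cells_in_lower:
  "cells_in (\<lambda>u k. 0 \<le> k \<and> k \<le> 2 * int n - 1 \<and> zigzag_right k \<le> u \<and> u \<le> real L - of_int k / 2)
    = half_region (2 * int n - 1) (2 * int L) 0"
  by (rule cells_in_half_region[where e = 1, OF zigzag_right_half]) presburger+

definition dent_cells :: "nat \<Rightarrow> nat \<Rightarrow> (int \<times> int) set" where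
  "dent_cells p q = {(i, v). 0 \<le> i \<and> 2 * int p + i + 1 \<le> v \<and> v \<le> 2 * int q - i - 1}"

definition corner_cells :: "nat \<Rightarrow> (int \<times> int) set" where
  "corner_cells a = {(i, v). 0 \<le> i \<and> 0 \<le> v \<and> v \<le> 2 * int a - i - 1}"

lemma cell_of_up_dent: "cell_of ` up_dent p q = dent_cells p q"
proof -
  define R where "R v k \<longleftrightarrow> 0 \<le> k \<and> 2 * int p + k \<le> v \<and> v \<le> 2 * int q - k" for v k
  have R: "(if odd (v - i) then R (v - 1) i \<and> R (v + 1) i \<and> R v (i + 1)
      else R (v - 1) (i + 1) \<and> R (v + 1) (i + 1) \<and> R v i)
    \<longleftrightarrow> 0 \<le> i \<and> 2 * int p + i + 1 \<le> v \<and> v \<le> 2 * int q - i - 1" for i v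
    unfolding R_def by presburger
  have P: "0 \<le> k \<and> real p + of_int k / 2 \<le> of_int w / 2 \<and> of_int w / 2 \<le> real q - of_int k / 2 \<longleftrightarrow> R w k" for w k
    unfolding R_def minus_half half_le_iff ..
  show ?thesis
    unfolding up_dent_def cell_of_triangles_in cells_in_int[where R = R, OF P] dent_cells_def R ..
qed

lemma reflect_vimage: "reflect ` X = {c. reflect c \<in> X}"
  by (auto intro: rev_image_eqI)

lemma cell_of_down_dent: "cell_of ` down_dent p q = reflect ` dent_cells p q"
proof -
  define R where "R v k \<longleftrightarrow> k \<le> 0 \<and> 2 * int p - k \<le> v \<and> v \<le> 2 * int q + k" for v k
  have R: "(if odd (v - i) then R (v - 1) i \<and> R (v + 1) i \<and> R v (i + 1)
      else R (v - 1) (i + 1) \<and> R (v + 1) (i + 1) \<and> R v i)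
    \<longleftrightarrow> 0 \<le> - 1 - i \<and> 2 * int p + (- 1 - i) + 1 \<le> v \<and> v \<le> 2 * int q - (- 1 - i) - 1" for i v
    unfolding R_def by presburger
  have P: "k \<le> 0 \<and> real p - of_int k / 2 \<le> of_int w / 2 \<and> of_int w / 2 \<le> real q + of_int k / 2 \<longleftrightarrow> R w k" for w k
    unfolding R_def minus_half half_le_iff ..
  show ?thesis
    unfolding reflect_vimage down_dent_def cell_of_triangles_in cells_in_int[where R = R, OF P] dent_cells_def R
    by (rule Set.set_eqI) (simp only: mem_Collect_eq split_beta reflect_def fst_conv snd_conv)
qed

lemma cells_in_corner:
  "cells_in (\<lambda>u k. u \<le> real a - of_int k / 2) = {(i, v). v \<le> 2 * int a - i - 1}"
proof -
  have "(if odd (v - i)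
     then v - 1 \<le> 2 * int a - i \<and> v + 1 \<le> 2 * int a - i \<and> v \<le> 2 * int a - (i + 1)
     else v - 1 \<le> 2 * int a - (i + 1) \<and> v + 1 \<le> 2 * int a - (i + 1) \<and> v \<le> 2 * int a - i)
    \<longleftrightarrow> v \<le> 2 * int a - i - 1" for i v
    by presburger
  then show ?thesis unfolding cells_in_def minus_half half_le_iff by simp
qed

text \<open>The bend of the eastern boundary is undone by prolonging the base to
  \<open>L + z\<close>: the lower part is a half region of standard shape without the triangle over
  the segment from \<open>L\<close> to \<open>L + z\<close>. Thus \<open>z\<close> becomes one more
  dent.\<close>

lemma cells_in_N2_lower:
  "cells_in (\<lambda>u k. - (2 * int n - 1) \<le> k \<and> k \<le> 0 \<and> zigzag_right k \<le> u \<and>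
       u \<le> real L - of_int k / 2 \<and> u \<le> real (L + z) + of_int k / 2)
    = reflect ` (half_region (2 * int n - 1) (2 * int (L + z)) 0 - dent_cells L (L + z))"
proof -
  have m: "(2 * int n - 1) mod 2 = 1" by presburger
  define c where "c = int (L + z)"
  define l where "l = int L"
  define R where "R v k \<longleftrightarrow> - (2 * int n - 1) \<le> k \<and> k \<le> 0 \<and> k mod 2 \<le> v \<and> v \<le> 2 * l - k \<and> v \<le> 2 * c + k" for v k
  have R: "(if odd (v - i) then R (v - 1) i \<and> R (v + 1) i \<and> R v (i + 1)
      else R (v - 1) (i + 1) \<and> R (v + 1) (i + 1) \<and> R v i)
    \<longleftrightarrow> (0 \<le> - 1 - i \<and> - 1 - i < 2 * int n - 1 \<and> 1 \<le> v \<and> v \<le> 2 * c - (- 1 - i) - 1)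
        \<and> \<not> (0 \<le> - 1 - i \<and> 2 * l + (- 1 - i) + 1 \<le> v \<and> v \<le> 2 * c - (- 1 - i) - 1)" for i v
  proof -
    define a where "a = i mod 2"
    define b where "b = (i + 1) mod 2"
    have ab: "b = 1 - i mod 2" unfolding b_def by presburger
    show ?thesis
    proof (cases "odd (v - i)")
      case True
      then have "a \<le> v - 1 \<and> b \<le> v \<longleftrightarrow> 1 \<le> v" "v \<le> 2 * c + i \<longleftrightarrow> v \<le> 2 * c + i - 1"
        unfolding ab a_def by presburger+
      then show ?thesis unfolding R_def if_P[OF True] a_def[symmetric] b_def[symmetric] by (smt (verit))
    next
      case False
      then have "b \<le> v - 1 \<and> a \<le> v \<longleftrightarrow> 1 \<le> v" "v \<le> 2 * l - i - 1 \<longleftrightarrow> v \<le> 2 * l - i - 2"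
        unfolding ab a_def by presburger+
      then show ?thesis unfolding R_def if_not_P[OF False] a_def[symmetric] b_def[symmetric] by (smt (verit))
    qed
  qed
  have P: "- (2 * int n - 1) \<le> k \<and> k \<le> 0 \<and> zigzag_right k \<le> of_int w / 2 \<and>
       of_int w / 2 \<le> real L - of_int k / 2 \<and> of_int w / 2 \<le> real (L + z) + of_int k / 2 \<longleftrightarrow> R w k" for w k
    unfolding R_def l_def c_def zigzag_right_half minus_half half_le_iff ..
  show ?thesis
    unfolding reflect_vimage cells_in_int[where R = R, OF P] R half_region_def dent_cells_def m l_def c_def
    by (rule Set.set_eqI) (simp only: mem_Collect_eq split_beta reflect_def fst_conv snd_conv Diff_iff)
qed

text \<open>The two western sides lie on the zigzag path exactly if the lozenge is centred over
  abscissa 0 and the heights are in range. The second hypothesis supplies the range, which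
  \<open>cell_weight\<close> does not test.\<close>

lemma zigzag_weight_cell:
  assumes l: "is_lozenge l" and c: "\<And>i v. (i, v) \<in> cell_of ` l \<Longrightarrow> 0 \<le> v \<and> i < h \<and> (v = 0 \<longrightarrow> 0 \<le> i)"
  shows "zigzag_weight h l = cell_weight (cell_of ` l)"
proof -
  let ?Z = "{v. 0 \<le> snd v \<and> snd v \<le> h \<and> ucoord v = zigzag_left (snd v)}"
  have uz: "ucoord (j, k) = zigzag_left k \<longleftrightarrow> 2 * j + k = - (k mod 2)" for j k
  proof -
    have "ucoord (j, k) = of_int (2 * j + k) / 2" by (simp add: ucoord_def)
    moreover have "(of_int a / 2 :: real) = of_int b / 2 \<longleftrightarrow> a = b" for a b :: int by simp
    ultimately show ?thesis unfolding zigzag_left_half by metis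
  qed
  have "(\<exists>j k. l = {Up j k, Down j k} \<and> {(j, k), (j, k + 1), (j + 1, k - 1)} \<subseteq> ?Z)
    \<longleftrightarrow> (\<exists>k. cell_of ` l = {(k, 0), (k + 1, 0)})"
  proof
    assume "\<exists>j k. l = {Up j k, Down j k} \<and> {(j, k), (j, k + 1), (j + 1, k - 1)} \<subseteq> ?Z"
    then obtain j k where jk: "l = {Up j k, Down j k}" "{(j, k), (j, k + 1), (j + 1, k - 1)} \<subseteq> ?Z" by blast
    then have "2 * j + k = - (k mod 2)" "2 * j + (k + 1) = - ((k + 1) mod 2)"
      by (auto simp: uz)
    then have "2 * j + k + 1 = 0" by presburger
    then have "cell_of ` l = {(k - 1, 0), (k - 1 + 1, 0)}" unfolding jk(1) by auto
    then show "\<exists>k. cell_of ` l = {(k, 0), (k + 1, 0)}" by blast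
  next
    assume "\<exists>k. cell_of ` l = {(k, 0), (k + 1, 0)}"
    then obtain k where k: "cell_of ` l = {(k, 0), (k + 1, 0)}" by blast
    have kb: "0 \<le> k" "k + 1 < h" using c[of k 0] c[of "k + 1" 0] k by auto
    from l obtain j i where "l = {Up j i, Down j i} \<or> l = {Up j i, Down (j - 1) (i + 1)} \<or> l = {Up j i, Down j (i + 1)}"
      unfolding is_lozenge_iff by blast
    then have "l = {Up j i, Down j i} \<and> i = k + 1 \<and> 2 * j + i + 1 = 0"
      using k by (auto simp: doubleton_eq_iff)
    then have lj: "l = {Up j (k + 1), Down j (k + 1)}" and j: "2 * j + k + 2 = 0" by auto
    have "even k" using j by presburger
    then have "{(j, k + 1), (j, k + 1 + 1), (j + 1, k + 1 - 1)} \<subseteq> ?Z"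
      using kb j by (auto simp: uz)
    then show "\<exists>j k. l = {Up j k, Down j k} \<and> {(j, k), (j, k + 1), (j + 1, k - 1)} \<subseteq> ?Z"
      using lj by blast
  qed
  then show ?thesis unfolding zigzag_weight_def cell_weight_def Let_def by (simp only:)
qed

section \<open>Triangular dents\<close>

text \<open>Induction on the height inside the dent. On the lowest strip the horizontal neighbours
  of a down cell are removed base cells or lie outside \<open>R\<close>; higher up they are outside
  \<open>R\<close> or already matched to the cell below them. So every down cell of the dent must be
  matched upwards, and these vertical lozenges fill the rest of the dent.\<close>

lemma cell_sum_forced_dents:
  assumes fin: "finite R" and DR: "Dn \<subseteq> R" and pos: "\<And>i v. (i, v) \<in> Dn \<Longrightarrow> 0 \<le> i"
    and down: "\<And>i v. (i, v) \<in> Dn \<Longrightarrow> even (v - i) \<Longrightarrow>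
      (i, v + 1) \<in> Dn \<and> ((i, v - 1) \<in> Dn \<or> (i, v - 1) \<notin> R) \<and> (i + 1, v) \<in> Dn"
    and up: "\<And>i v. (i, v) \<in> Dn \<Longrightarrow> odd (v - i) \<Longrightarrow> 0 < i \<Longrightarrow> (i - 1, v) \<in> Dn"
  shows "cell_sum (R - {c \<in> Dn. fst c = 0 \<and> odd (snd c)})
    = (\<Prod>c\<in>{c \<in> Dn. even (snd c - fst c)}. cell_factor (snd c)) * cell_sum (R - Dn)"
proof -
  define base where "base = {c \<in> Dn. fst c = 0 \<and> odd (snd c)}"
  define Ev where "Ev = {c \<in> Dn. even (snd c - fst c)}"
  define e where "e c = {c, (fst c + 1, snd c)}" for c :: "int \<times> int"
  have inj: "inj_on e Ev"
    by (rule inj_onI) (auto simp: e_def Ev_def doubleton_eq_iff)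
  have dis: "e c \<inter> e d = {}" if "c \<in> Ev" "d \<in> Ev" "c \<noteq> d" for c d
    using that by (cases c; cases d) (auto simp: e_def Ev_def)
  have forced: "(int n, v) \<in> Ev \<Longrightarrow> e (int n, v) \<in> P"
    if P: "P \<in> edge_partitions cell_edge (R - base)" for P n v
  proof (induction n arbitrary: v)
    case less: 0
    note D = edge_partitionsD[OF P]
    have "(int 0, v) \<in> R - base" using less DR by (auto simp: Ev_def base_def)
    then obtain l where l: "l \<in> P" "(0, v) \<in> l" using D(1) by auto
    have nb: "(0, v + 1) \<notin> l" "(0, v - 1) \<notin> l"
      using D(5)[OF l(1)] less down[of 0 v] by (auto simp: Ev_def base_def)
    from D(4)[OF l(1)] show ?case unfolding cell_edge_def
    proof (elim disjE exE conjE)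
      fix k u assume "l = {(k, u), (k, u + 1)}"
      then show ?thesis using nb l(2) by auto
    next
      fix k u assume k: "even (u - k)" "l = {(k, u), (k + 1, u)}"
      then have "k = 0" "u = v" using l(2) less by (auto simp: Ev_def)
      then show ?thesis using k l(1) by (simp add: e_def)
    qed
  next
    case (Suc n)
    note D = edge_partitionsD[OF P]
    let ?i = "int (Suc n)"
    have DnR: "(?i, v) \<in> Dn" "even (v - ?i)" using Suc.prems by (auto simp: Ev_def)
    have "(?i, v) \<in> R - base" using DnR DR by (auto simp: base_def)
    then obtain l where l: "l \<in> P" "(?i, v) \<in> l" using D(1) by auto
    have above: "(?i, u) \<notin> l" if u: "(?i, u) \<in> Dn" "odd (u - ?i)" for u
    proof
      assume ul: "(?i, u) \<in> l"
      have "(int n, u) \<in> Dn" using up[OF u] by simp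
      then have "(int n, u) \<in> Ev" using u(2) by (auto simp: Ev_def)
      then have e: "e (int n, u) \<in> P" by (rule Suc.IH)
      moreover have "(?i, u) \<in> e (int n, u)" by (simp add: e_def)
      ultimately have "l = e (int n, u)" using disjointD[OF D(2) l(1) e] ul by blast
      moreover have "v \<noteq> u" using u(2) DnR(2) by auto
      ultimately show False using l(2) by (simp add: e_def)
    qed
    have nb: "(?i, v + 1) \<notin> l" "(?i, v - 1) \<notin> l"
    proof -
      have odd: "odd (v + 1 - ?i)" "odd (v - 1 - ?i)" using DnR(2) by simp_all
      show "(?i, v + 1) \<notin> l" by (rule above) (use odd down[OF DnR] in auto)
      have "(?i, v - 1) \<in> Dn \<or> (?i, v - 1) \<notin> R" using down[OF DnR] by blast
      then show "(?i, v - 1) \<notin> l" using above[OF _ odd(2)] D(5)[OF l(1)] by blast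
    qed
    from D(4)[OF l(1)] show ?case unfolding cell_edge_def
    proof (elim disjE exE conjE)
      fix k u assume "l = {(k, u), (k, u + 1)}"
      then show ?thesis using nb l(2) by auto
    next
      fix k u assume k: "even (u - k)" "l = {(k, u), (k + 1, u)}"
      then have "k = ?i" "u = v" using l(2) DnR(2) by auto
      then show ?thesis using k l(1) by (simp add: e_def)
    qed
  qed
  have "cell_sum (R - base) = (\<Prod>l\<in>e ` Ev. cell_weight l) * cell_sum ((R - base) - \<Union>(e ` Ev))"
  proof (rule match_sum_forced)
    show "finite (R - base)" using fin by simp
    show "disjoint (e ` Ev)" unfolding disjoint_def
    proof (intro ballI impI)
      fix l l' assume "l \<in> e ` Ev" "l' \<in> e ` Ev" "l \<noteq> l'"
      then obtain c d where "c \<in> Ev" "d \<in> Ev" "c \<noteq> d" "l = e c" "l' = e d" by blast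
      then show "l \<inter> l' = {}" using dis by simp
    qed
    show "{} \<notin> e ` Ev" by (auto simp: e_def)
    show "cell_edge l" if l: "l \<in> e ` Ev" for l
    proof -
      obtain i v where "l = {(i, v), (i + 1, v)}" "even (v - i)" using l by (auto simp: e_def Ev_def)
      then show ?thesis unfolding cell_edge_def by blast
    qed
    show "\<Union>(e ` Ev) \<subseteq> R - base"
    proof
      fix x assume "x \<in> \<Union>(e ` Ev)"
      then obtain i v where iv: "(i, v) \<in> Dn" "even (v - i)" "x = (i, v) \<or> x = (i + 1, v)"
        by (auto simp: e_def Ev_def)
      then show "x \<in> R - base" using DR down[OF iv(1,2)] pos[OF iv(1)] by (auto simp: base_def)
    qed
    fix P assume P: "P \<in> edge_partitions cell_edge (R - base)"
    show "e ` Ev \<subseteq> P"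
    proof
      fix l assume "l \<in> e ` Ev"
      then obtain i v where iv: "(i, v) \<in> Ev" "l = e (i, v)" by auto
      moreover have "i = int (nat i)" using iv(1) pos by (auto simp: Ev_def)
      ultimately show "l \<in> P" using forced[OF P, of "nat i" v] by simp
    qed
  qed
  also have "(\<Prod>l\<in>e ` Ev. cell_weight l) = (\<Prod>c\<in>Ev. cell_factor (snd c))"
    by (subst prod.reindex[OF inj])
       (auto simp: e_def cell_weight_vertical intro!: prod.cong)
  also have "(R - base) - \<Union>(e ` Ev) = R - Dn"
  proof -
    have "\<Union>(e ` Ev) \<subseteq> Dn" using down by (fastforce simp: e_def Ev_def)
    moreover have "x \<in> base \<union> \<Union>(e ` Ev)" if "x \<in> Dn" for x
    proof (cases x)
      case (Pair i v)
      show ?thesis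
      proof (cases "even (v - i)")
        case True
        then show ?thesis using that Pair by (auto simp: e_def Ev_def)
      next
        case odd: False
        show ?thesis
        proof (cases "i = 0")
          case True
          then show ?thesis using odd that Pair by (auto simp: base_def)
        next
          case False
          then have "(i - 1, v) \<in> Ev" using up[of i v] odd that Pair pos[of i v] by (auto simp: Ev_def)
          moreover have "x \<in> e (i - 1, v)" using Pair by (simp add: e_def)
          ultimately show ?thesis by blast
        qed
      qed
    qed
    moreover have "base \<subseteq> Dn" by (auto simp: base_def)
    ultimately show ?thesis by blast
  qed
  finally show ?thesis unfolding base_def Ev_def .
qed

lemma dent_cells_base: "(0, v) \<in> dent_cells p q \<and> odd v \<longleftrightarrow> (0, v) \<in> base_cells {p<..q}"
proof -
  have "\<exists>s\<in>{p<..q}. v = 2 * int s - 1" if "2 * int p + 1 \<le> v" "v \<le> 2 * int q - 1" "odd v"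
  proof -
    obtain j where j: "v = 2 * j + 1" using \<open>odd v\<close> by (elim oddE)
    show ?thesis by (rule bexI[of _ "nat (j + 1)"]) (use that j in auto)
  qed
  then show ?thesis by (auto simp: dent_cells_def base_cells_def)
qed

lemma corner_cells_base: "(0, v) \<in> corner_cells a \<and> odd v \<longleftrightarrow> (0, v) \<in> base_cells {0<..a}"
proof -
  have "0 \<le> v \<longleftrightarrow> 2 * int 0 + 0 + 1 \<le> v" if "odd v" using that by presburger
  then show ?thesis using dent_cells_base[of v 0 a] by (auto simp: dent_cells_def corner_cells_def)
qed

lemma base_cells_Un: "base_cells (A \<union> B) = base_cells A \<union> base_cells B"
  by (auto simp: base_cells_def)

lemma base_cells_disjoint: "A \<inter> B = {} \<Longrightarrow> base_cells A \<inter> base_cells B = {}"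
  by (auto simp: base_cells_def)

text \<open>Removing a triangular dent amounts to removing the unit triangles along its base: the rest
  of the dent is then covered by forced vertical lozenges. Those of the corner dent (the half
  triangle along the zigzag) include \<open>a\<close> lozenges of weight \<open>1/2\<close>.\<close>

lemma cell_sum_dents:
  assumes h: "h = 2 * int n \<or> h = 2 * int n - 1 \<and> a = 0" and a: "a \<le> n" "n \<le> w"
    and I: "\<And>p q. (p, q) \<in> I \<Longrightarrow> q \<le> w \<and> q \<le> p + n"
    and S: "S = {0<..a} \<union> (\<Union>(p, q)\<in>I. {p<..q})" and S0: "S0 \<inter> S = {}"
  shows "cell_sum (half_region h (2 * int w) 0 - base_cells (S0 \<union> S))
    = (1 / 2) ^ a * cell_sum (half_region h (2 * int w) 0 - base_cells S0
        - (corner_cells a \<union> (\<Union>(p, q)\<in>I. dent_cells p q)))"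
proof -
  define R where "R = half_region h (2 * int w) 0 - base_cells S0"
  define Dn where "Dn = corner_cells a \<union> (\<Union>(p, q)\<in>I. dent_cells p q)"
  have base: "{c \<in> Dn. fst c = 0 \<and> odd (snd c)} = base_cells S"
  proof (rule Set.set_eqI)
    fix c :: "int \<times> int"
    obtain i v where c: "c = (i, v)" by (cases c)
    have "c \<in> base_cells S \<longleftrightarrow> i = 0 \<and> ((0, v) \<in> base_cells {0<..a} \<or> (\<exists>(p, q)\<in>I. (0, v) \<in> base_cells {p<..q}))"
      unfolding c S by (auto simp: base_cells_def)
    also have "(0, v) \<in> base_cells {0<..a} \<longleftrightarrow> odd v \<and> (0, v) \<in> corner_cells a"
      using corner_cells_base by blast
    also have "(\<exists>(p, q)\<in>I. (0, v) \<in> base_cells {p<..q}) \<longleftrightarrow> odd v \<and> (\<exists>(p, q)\<in>I. (0, v) \<in> dent_cells p q)"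
      by (auto simp: dent_cells_base[symmetric])
    also have "(i = 0 \<and> (odd v \<and> (0, v) \<in> corner_cells a \<or> odd v \<and> (\<exists>(p, q)\<in>I. (0, v) \<in> dent_cells p q)))
      \<longleftrightarrow> c \<in> {c \<in> Dn. fst c = 0 \<and> odd (snd c)}"
      unfolding c Dn_def by auto
    finally show "c \<in> {c \<in> Dn. fst c = 0 \<and> odd (snd c)} \<longleftrightarrow> c \<in> base_cells S" ..
  qed
  have hm: "a > 0 \<Longrightarrow> h mod 2 = 0" and hm1: "h mod 2 \<le> 1" using h by auto
  have corner: "corner_cells a \<subseteq> half_region h (2 * int w) 0"
  proof (cases "a = 0")
    case False
    then show ?thesis using hm h a by (auto simp: corner_cells_def half_region_def)
  qed (auto simp: corner_cells_def)
  have dents: "dent_cells p q \<subseteq> half_region h (2 * int w) 0" if "(p, q) \<in> I" for p q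
  proof
    fix c assume "c \<in> dent_cells p q"
    then obtain i v where c: "c = (i, v)" "0 \<le> i" "2 * int p + i + 1 \<le> v" "v \<le> 2 * int q - i - 1"
      by (auto simp: dent_cells_def)
    have q: "int q \<le> int w" "int q \<le> int p + int n" using I[OF that] by auto
    have "i + 1 \<le> int n" using c q by linarith
    then have "i < h" using h c(2) by auto
    then show "c \<in> half_region h (2 * int w) 0" using c q hm1 by (auto simp: half_region_def)
  qed
  have Dh: "Dn \<subseteq> half_region h (2 * int w) 0" using corner dents by (fastforce simp: Dn_def)
  have DR: "Dn \<subseteq> R"
  proof
    fix c assume c: "c \<in> Dn"
    have "c \<notin> base_cells S0"
    proof
      assume b: "c \<in> base_cells S0"
      then have "fst c = 0 \<and> odd (snd c)" by (auto simp: base_cells_def)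
      then have "c \<in> base_cells S" using c base by blast
      then show False using b base_cells_disjoint[OF S0] by blast
    qed
    then show "c \<in> R" using Dh c by (auto simp: R_def)
  qed
  have pos: "0 \<le> i" if "(i, v) \<in> Dn" for i v
    using that by (auto simp: Dn_def corner_cells_def dent_cells_def)
  have nonneg: "0 \<le> v" if "(i, v) \<in> R" for i v
    using that h by (auto simp: R_def half_region_def)
  have down: "(i, v + 1) \<in> Dn \<and> ((i, v - 1) \<in> Dn \<or> (i, v - 1) \<notin> R) \<and> (i + 1, v) \<in> Dn"
    if iv: "(i, v) \<in> Dn" "even (v - i)" for i v
    using iv(1) unfolding Dn_def
  proof
    assume c: "(i, v) \<in> corner_cells a"
    then have "0 \<le> i" "0 \<le> v" "v \<le> 2 * int a - i - 1" by (auto simp: corner_cells_def)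
    moreover from this have "v \<le> 2 * int a - i - 2" using iv(2) by presburger
    ultimately have "(i, v + 1) \<in> corner_cells a" "(i + 1, v) \<in> corner_cells a"
      "v = 0 \<or> (i, v - 1) \<in> corner_cells a"
      by (auto simp: corner_cells_def)
    moreover have "v = 0 \<Longrightarrow> (i, v - 1) \<notin> R" using nonneg by fastforce
    ultimately show "(i, v + 1) \<in> corner_cells a \<union> (\<Union>(p, q)\<in>I. dent_cells p q) \<and>
      ((i, v - 1) \<in> corner_cells a \<union> (\<Union>(p, q)\<in>I. dent_cells p q) \<or> (i, v - 1) \<notin> R) \<and>
      (i + 1, v) \<in> corner_cells a \<union> (\<Union>(p, q)\<in>I. dent_cells p q)" by blast
  next
    assume "(i, v) \<in> (\<Union>(p, q)\<in>I. dent_cells p q)"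
    then obtain p q where pq: "(p, q) \<in> I" "(i, v) \<in> dent_cells p q" by auto
    then have "0 \<le> i" "2 * int p + i + 1 \<le> v" "v \<le> 2 * int q - i - 1" by (auto simp: dent_cells_def)
    moreover from this have "2 * int p + i + 2 \<le> v" "v \<le> 2 * int q - i - 2" using iv(2) by presburger+
    ultimately have "(i, v + 1) \<in> dent_cells p q" "(i + 1, v) \<in> dent_cells p q" "(i, v - 1) \<in> dent_cells p q"
      by (auto simp: dent_cells_def)
    then show "(i, v + 1) \<in> corner_cells a \<union> (\<Union>(p, q)\<in>I. dent_cells p q) \<and>
      ((i, v - 1) \<in> corner_cells a \<union> (\<Union>(p, q)\<in>I. dent_cells p q) \<or> (i, v - 1) \<notin> R) \<and>
      (i + 1, v) \<in> corner_cells a \<union> (\<Union>(p, q)\<in>I. dent_cells p q)" using pq(1) by blast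
  qed
  have up: "(i - 1, v) \<in> Dn" if "(i, v) \<in> Dn" "odd (v - i)" "0 < i" for i v
    using that by (fastforce simp: Dn_def corner_cells_def dent_cells_def)
  have "cell_sum (R - base_cells S) = (\<Prod>c\<in>{c \<in> Dn. even (snd c - fst c)}. cell_factor (snd c)) * cell_sum (R - Dn)"
    unfolding base[symmetric]
    by (rule cell_sum_forced_dents[OF _ DR pos down up]) (auto simp: R_def finite_half_region)
  also have "(\<Prod>c\<in>{c \<in> Dn. even (snd c - fst c)}. cell_factor (snd c)) = (1 / 2) ^ a"
  proof -
    have "finite Dn" using Dh finite_half_region finite_subset by blast
    then have fE: "finite {c \<in> Dn. even (snd c - fst c)}" by simp
    \<comment> \<open>In column 0 the forced lozenges start at the cells \<open>(2 * j, 0)\<close>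
      with \<open>j < a\<close>. Dents with a full triangle do not reach this column.\<close>
    have "(\<Prod>c\<in>{c \<in> Dn. even (snd c - fst c)}. cell_factor (snd c))
      = (\<Prod>c\<in>(\<lambda>j. (2 * int j, 0 :: int)) ` {..<a}. 1 / 2)"
    proof (rule prod.mono_neutral_cong_right[OF fE], goal_cases)
      case 1
      show "(\<lambda>j. (2 * int j, 0 :: int)) ` {..<a} \<subseteq> {c \<in> Dn. even (snd c - fst c)}"
        by (auto simp: Dn_def corner_cells_def)
    next
      case 2
      show ?case
      proof
      fix c assume c: "c \<in> {c \<in> Dn. even (snd c - fst c)} - (\<lambda>j. (2 * int j, 0 :: int)) ` {..<a}"
      show "cell_factor (snd c) = 1"
      proof (cases "snd c = 0")
        case True
        then obtain i where i: "c = (i, 0)" by (cases c) auto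
        then have "even i" "(i, 0) \<in> Dn" using c by auto
        then have "0 \<le> i" "i \<le> 2 * int a - 1" by (auto simp: Dn_def corner_cells_def dent_cells_def)
        moreover obtain j where "i = 2 * j" using \<open>even i\<close> by (elim evenE)
        ultimately have "c = (2 * int (nat j), 0)" "nat j < a" using i by auto
        then show ?thesis using c by blast
      qed (simp add: cell_factor_def)
      qed
    next
      case (3 c)
      then show ?case by (auto simp: cell_factor_def)
    qed
    also have "\<dots> = (1 / 2) ^ a"
      by (simp add: card_image inj_on_def)
    finally show ?thesis .
  qed
  moreover have "R - base_cells S = half_region h (2 * int w) 0 - base_cells (S0 \<union> S)"
    unfolding R_def base_cells_Un by blast
  ultimately show ?thesis unfolding R_def Dn_def by simp
qed

section \<open>A discrete Selberg sum on a quadratic lattice\<close>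

lemma prod_lessThan_add:
  fixes f :: "nat \<Rightarrow> 'a::comm_monoid_mult"
  shows "(\<Prod>k<m + n. f k) = (\<Prod>k<m. f k) * (\<Prod>k<n. f (m + k))"
  by (induction n) (simp_all add: mult.assoc)

definition left_prod :: "nat \<Rightarrow> nat \<Rightarrow> real" where
  "left_prod a s = (\<Prod>k<a. xsq s - xsq (Suc k))"

definition right_prod :: "nat \<Rightarrow> nat \<Rightarrow> nat \<Rightarrow> real" where
  "right_prod c t s = (\<Prod>k<c. xsq (t + k) - xsq s)"

text \<open>The fixed dents occupy the positions 1 to \<open>a\<close> and \<open>a + N + 1\<close>
  to \<open>a + N + c\<close>, and \<open>s\<close> runs through the gap of length \<open>N\<close>
  between them. The linear factor comes from the upper half alone.\<close>

definition racah_weight :: "nat \<Rightarrow> nat \<Rightarrow> nat \<Rightarrow> nat \<Rightarrow> real" where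
  "racah_weight a c N s = (real s - 1 / 2) * left_prod a s * right_prod c (a + N + 1) s"

lemma xsq_diff: "xsq q - xsq p = (real q - real p) * (real q + real p - 1)"
  by (simp add: xsq_def power2_eq_square algebra_simps)

lemma left_prod_fact: "b < t \<Longrightarrow> left_prod b t * fact (t - b - 1) = fact (t + b - 1)"
proof (induction b)
  case 0
  then show ?case by (simp add: left_prod_def)
next
  case (Suc b)
  then obtain d where d: "t = Suc (Suc (b + d))" by (metis add_Suc less_imp_Suc_add)
  have IH: "left_prod b t * fact (Suc d) = fact (t + b - 1)"
    using Suc unfolding d by simp
  have "left_prod (Suc b) t * fact d = left_prod b t * ((real d + 1) * fact d) * (real t + real b)"
    unfolding left_prod_def by (simp add: xsq_diff d algebra_simps)
  also have "(real d + 1) * fact d = fact (Suc d)" by simp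
  also have "left_prod b t * fact (Suc d) * (real t + real b) = fact (t + b - 1) * (real t + real b)"
    unfolding IH ..
  also have "\<dots> = fact (t + b)" using d by (simp add: algebra_simps)
  finally show ?case unfolding d by simp
qed

definition racah_total :: "nat \<Rightarrow> nat \<Rightarrow> nat \<Rightarrow> real" where
  "racah_total a c N = (\<Sum>s\<in>{a + 1..a + N}. racah_weight a c N s)"

text \<open>A free end of the gap is turned into an occupied position: the factor kills the weight
  at that end and is the distance that the enlarged product requires. \<open>racah_right\<close> is
  the same at the other end.\<close>

lemma racah_left: "racah_weight a c (Suc N) s * (xsq s - xsq (a + 1)) = racah_weight (Suc a) c N s"
  by (simp add: racah_weight_def left_prod_def mult_ac)

lemma racah_right: "racah_weight a c (Suc N) s * (xsq (a + Suc N) - xsq s) = racah_weight a (Suc c) N s"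
proof -
  have "right_prod (Suc c) (a + N + 1) s = (xsq (a + N + 1) - xsq s) * right_prod c (a + N + 2) s"
    unfolding right_prod_def by (subst prod.lessThan_Suc_shift) simp
  then show ?thesis by (simp add: racah_weight_def mult_ac)
qed

text \<open>The two end factors add up to \<open>xsq (a + Suc N) - xsq (a + 1)\<close>, which does
  not depend on \<open>s\<close>. Both shifted masses may be summed over the longer gap, since the
  additional end term vanishes.\<close>

lemma racah_total_rec:
  "racah_total a (Suc c) N = real N * (2 * real a + real N + 1) * racah_total a c (Suc N) - racah_total (Suc a) c N"
proof -
  have "racah_total (Suc a) c N = (\<Sum>s\<in>{a + 1..a + Suc N}. racah_weight (Suc a) c N s)"
    unfolding racah_total_def
  proof (rule sum.mono_neutral_left, goal_cases)
    case 3
    show ?case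
    proof
      fix s assume "s \<in> {a + 1..a + Suc N} - {Suc a + 1..Suc a + N}"
      then have "s = a + 1" by auto
      then show "racah_weight (Suc a) c N s = 0" using racah_left[of a c N s] by simp
    qed
  qed auto
  moreover have "racah_total a (Suc c) N = (\<Sum>s\<in>{a + 1..a + Suc N}. racah_weight a (Suc c) N s)"
    unfolding racah_total_def
  proof (rule sum.mono_neutral_left, goal_cases)
    case 3
    show ?case
    proof
      fix s assume "s \<in> {a + 1..a + Suc N} - {a + 1..a + N}"
      then have "s = a + Suc N" by auto
      then show "racah_weight a (Suc c) N s = 0" using racah_right[of a c N s] by simp
    qed
  qed auto
  ultimately have "racah_total a (Suc c) N + racah_total (Suc a) c N
    = (\<Sum>s\<in>{a + 1..a + Suc N}. racah_weight a c (Suc N) s * (xsq (a + Suc N) - xsq s)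
        + racah_weight a c (Suc N) s * (xsq s - xsq (a + 1)))"
    by (simp only: racah_left racah_right sum.distrib)
  also have "\<dots> = (\<Sum>s\<in>{a + 1..a + Suc N}. racah_weight a c (Suc N) s * (xsq (a + Suc N) - xsq (a + 1)))"
    by (rule sum.cong[OF refl]) (simp add: algebra_simps)
  also have "\<dots> = racah_total a c (Suc N) * (xsq (a + Suc N) - xsq (a + 1))"
    by (simp only: racah_total_def sum_distrib_right)
  also have "xsq (a + Suc N) - xsq (a + 1) = real N * (2 * real a + real N + 1)"
    by (simp add: xsq_diff algebra_simps)
  finally show ?thesis by (simp add: mult_ac)
qed

text \<open>The recurrence lowers \<open>c\<close> while raising \<open>a\<close> or
  \<open>N\<close>, so induction on \<open>c\<close> with the other parameters free leads to
  \<open>c = 0\<close>, an indefinite sum verified by induction on \<open>m\<close>.\<close>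

lemma racah_total_formula:
  "racah_total a c (Suc m) = fact c * fact a / (2 * fact (a + c + 1))
     * (fact (m + 1 + 2 * a + c) / fact m) * (fact (m + 1 + a + c) / fact (m + a))"
proof (induction c arbitrary: a m)
  case 0
  have w: "racah_weight a 0 N (a + m + 1) = (real (a + m) + 1 / 2) * (fact (m + 2 * a) / fact m)" for N m
  proof -
    have "left_prod a (a + m + 1) * fact m = fact (m + 2 * a)"
      using left_prod_fact[of a "a + m + 1"] by (simp add: mult_2 add.commute add.left_commute)
    then have "left_prod a (a + m + 1) = fact (m + 2 * a) / fact m" by (simp add: field_simps)
    then show ?thesis by (simp add: racah_weight_def right_prod_def)
  qed
  have "racah_total a 0 (Suc m) = (real a + real m + 1) / (2 * (real a + 1)) * (fact (m + 1 + 2 * a) / fact m)" for m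
  proof (induction m)
    case 0
    have "racah_total a 0 (Suc 0) = racah_weight a 0 (Suc 0) (a + 0 + 1)" by (simp add: racah_total_def)
    also have "\<dots> = (real a + 1 / 2) * fact (2 * a)" unfolding w by simp
    also have "\<dots> = (real a + real 0 + 1) / (2 * (real a + 1)) * (fact (0 + 1 + 2 * a) / fact 0)"
      by (simp add: field_simps)
    finally show ?case .
  next
    case (Suc m)
    have "racah_total a 0 (Suc (Suc m)) = racah_total a 0 (Suc m) + racah_weight a 0 (Suc m) (a + Suc m + 1)"
      by (simp add: racah_total_def racah_weight_def right_prod_def)
    also have "\<dots> = (real a + real m + 1) / (2 * (real a + 1)) * (fact (m + 1 + 2 * a) / fact m)
        + (real (a + Suc m) + 1 / 2) * (fact (Suc m + 2 * a) / fact (Suc m))"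
      unfolding Suc w ..
    also have "\<dots> = (real a + real (Suc m) + 1) / (2 * (real a + 1)) * (fact (Suc m + 1 + 2 * a) / fact (Suc m))"
    proof -
      define F where "F = (fact (Suc m + 2 * a) :: real)"
      define G where "G = (fact m :: real)"
      have "fact (m + 1 + 2 * a) = F" "fact (Suc m) = (real m + 1) * G"
        "fact (Suc m + 1 + 2 * a) = (real m + 2 + 2 * real a) * F" "G > 0"
        unfolding F_def G_def by (simp_all add: algebra_simps)
      then show ?thesis unfolding F_def[symmetric] G_def[symmetric]
        by (simp add: divide_simps) (simp add: algebra_simps)
    qed
    finally show ?case .
  qed
  moreover have "fact 0 * fact a / (2 * fact (a + 0 + 1)) * (fact (m + 1 + 2 * a + 0) / fact m)
      * (fact (m + 1 + a + 0) / fact (m + a))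
    = (real a + real m + 1) / (2 * (real a + 1)) * (fact (m + 1 + 2 * a) / fact m)"
  proof -
    have "fact (m + 1 + a + 0) = (real a + real m + 1) * fact (m + a)"
      "fact (a + 0 + 1) = (real a + 1) * fact a" "fact (m + 1 + 2 * a + 0) = (fact (m + 1 + 2 * a) :: real)"
      by (simp_all add: algebra_simps)
    note f = this
    show ?thesis unfolding f by (simp del: fact_Suc)
  qed
  ultimately show ?case by simp
next
  case (Suc c)
  define A where "A = (fact c :: real)"
  define B where "B = (fact a :: real)"
  define C where "C = (fact (a + c + 1) :: real)"
  define D where "D = (fact (m + 2 + 2 * a + c) :: real)"
  define E where "E = (fact m :: real)"
  define F where "F = (fact (m + 2 + a + c) :: real)"
  define G where "G = (fact (m + a) :: real)"
  have pos: "A > 0" "B > 0" "C > 0" "D > 0" "E > 0" "F > 0" "G > 0"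
    by (simp_all add: A_def B_def C_def D_def E_def F_def G_def)
  have f: "fact (Suc c) = (real c + 1) * A" "fact (Suc a) = (real a + 1) * B"
    "fact (a + Suc c + 1) = (real a + real c + 2) * C" "fact (Suc a + c + 1) = (real a + real c + 2) * C"
    "fact (m + 1 + 2 * a + Suc c) = D" "fact (Suc m + 1 + 2 * a + c) = D"
    "fact (m + 1 + 2 * Suc a + c) = (real m + 3 + 2 * real a + real c) * D"
    "fact (Suc m) = (real m + 1) * E"
    "fact (m + 1 + a + Suc c) = F" "fact (Suc m + 1 + a + c) = F" "fact (m + 1 + Suc a + c) = F"
    "fact (Suc m + a) = (real m + real a + 1) * G" "fact (m + Suc a) = (real m + real a + 1) * G"
    unfolding A_def B_def C_def D_def E_def F_def G_def by (simp_all add: algebra_simps)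
  have nz: "real a + real c + 2 \<noteq> 0" "real m + 1 \<noteq> 0" "real m + real a + 1 \<noteq> 0"
    by linarith+
  have "racah_total a (Suc c) (Suc m)
    = real (Suc m) * (2 * real a + real (Suc m) + 1)
        * (A * B / (2 * C) * (D / ((real m + 1) * E)) * (F / ((real m + real a + 1) * G)))
      - A * ((real a + 1) * B) / (2 * ((real a + real c + 2) * C))
        * ((real m + 3 + 2 * real a + real c) * D / E) * (F / ((real m + real a + 1) * G))"
    unfolding racah_total_rec Suc f A_def[symmetric] B_def[symmetric] C_def[symmetric] E_def[symmetric] ..
  also have "\<dots> = (A * B * D * F / (2 * C * E * G)) * ((2 * real a + real m + 2) / (real m + real a + 1)
      - (real a + 1) * (real m + 3 + 2 * real a + real c) / ((real a + real c + 2) * (real m + real a + 1)))"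
    using pos nz by (simp add: divide_simps) (simp add: algebra_simps)
  also have "(2 * real a + real m + 2) / (real m + real a + 1)
      - (real a + 1) * (real m + 3 + 2 * real a + real c) / ((real a + real c + 2) * (real m + real a + 1))
      = (real c + 1) / (real a + real c + 2)"
    using nz by (simp add: divide_simps) (simp add: algebra_simps)
  also have "(A * B * D * F / (2 * C * E * G)) * ((real c + 1) / (real a + real c + 2))
    = ((real c + 1) * A) * B / (2 * ((real a + real c + 2) * C)) * (D / E) * (F / G)"
    by (simp add: mult_ac)
  finally show ?case
    unfolding f A_def[symmetric] B_def[symmetric] C_def[symmetric] E_def[symmetric] G_def[symmetric] .
qed

section \<open>Hankel determinants of binomial coefficients\<close>

text \<open>By Vandermonde's convolution the rows on the left are unit triangular combinations of
  those on the right. The gain is that with upper index \<open>n + i\<close> the complementary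
  factorial (n - A - j)! depends on the column only.\<close>

lemma det_binomial_row_ops:
  "det (mat y y (\<lambda>(i, j). real (n + i choose (A + i + j)))) = det (mat y y (\<lambda>(i, j). real (n choose (A + i + j))))"
proof -
  let ?P = "mat y y (\<lambda>(i, l). real (i choose l))" and ?B = "mat y y (\<lambda>(i, j). real (n choose (A + i + j)))"
  have v: "(n + i choose (A + i + j)) = (\<Sum>l\<le>i. (i choose l) * (n choose (A + l + j)))" for i j
  proof -
    have "(i + n choose (A + i + j)) = (\<Sum>k\<le>A + i + j. (i choose k) * (n choose (A + i + j - k)))"
      by (rule vandermonde[symmetric])
    also have "\<dots> = (\<Sum>k\<le>i. (i choose k) * (n choose (A + i + j - k)))"
      by (rule sum.mono_neutral_right) (auto simp: binomial_eq_0)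
    also have "\<dots> = (\<Sum>l\<le>i. (i choose l) * (n choose (A + l + j)))"
      by (rule sum.reindex_bij_witness[of _ "\<lambda>l. i - l" "\<lambda>k. i - k"])
         (auto simp: binomial_symmetric[symmetric])
    finally show ?thesis by (simp add: add.commute)
  qed
  have "mat y y (\<lambda>(i, j). real (n + i choose (A + i + j))) = ?P * ?B"
  proof (rule eq_matI, goal_cases)
    case (1 i j)
    then have "(?P * ?B) $$ (i, j) = (\<Sum>l = 0..<y. real (i choose l) * real (n choose (A + l + j)))"
      by (auto simp: scalar_prod_def intro!: sum.cong)
    also have "\<dots> = (\<Sum>l\<le>i. real (i choose l) * real (n choose (A + l + j)))"
      by (rule sum.mono_neutral_right) (use 1 in \<open>auto simp: binomial_eq_0\<close>)
    finally show ?case using 1 by (simp add: v)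
  qed auto
  moreover have "det ?P = 1"
    by (subst det_lower_triangular[of y])
       (auto simp: diag_mat_def prod.list_conv_set_nth binomial_eq_0)
  ultimately show ?thesis by (simp add: det_mult[of _ y])
qed

text \<open>One sign serves all matrices of the given size. It need not be known, because positivity
  decides the sign of the final sum.\<close>

lemma det_reverse_columns:
  "\<exists>\<sigma>::real. \<sigma> \<in> {1, -1} \<and> (\<forall>A. det (mat y y (\<lambda>(i, j). A i (y - 1 - j))) = \<sigma> * det (mat y y (\<lambda>(i, j). A i j)))"
proof -
  define r where "r = (\<lambda>j. if j < y then y - 1 - j else j)"
  have r: "r permutes {0..<y}"
  proof (rule bij_imp_permutes)
    show "bij_betw r {0..<y} {0..<y}"
      by (rule bij_betw_byWitness[where f' = r]) (auto simp: r_def)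
  qed (auto simp: r_def)
  have "det (mat y y (\<lambda>(i, j). A i (y - 1 - j))) = of_int (sign r) * det (mat y y (\<lambda>(i, j). A i j))"
    for A :: "nat \<Rightarrow> nat \<Rightarrow> real"
  proof -
    have "det (mat y y (\<lambda>(i, j). A i (y - 1 - j))) = det (mat y y (\<lambda>(i, j). mat y y (\<lambda>(i, j). A j i) $$ (r i, j)))"
      by (subst det_transpose[symmetric, of _ y])
         (auto intro!: arg_cong[of _ _ det] eq_matI simp: r_def)
    also have "\<dots> = of_int (sign r) * det (mat y y (\<lambda>(i, j). A j i))"
      by (rule det_permute_rows) (use r in auto)
    also have "det (mat y y (\<lambda>(i, j). A j i)) = det (mat y y (\<lambda>(i, j). A i j))"
      by (subst det_transpose[symmetric, of _ y]) (auto intro!: arg_cong[of _ _ det] eq_matI)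
    finally show ?thesis .
  qed
  then show ?thesis by (intro exI[of _ "of_int (sign r)"]) (auto simp: sign_def)
qed

text \<open>Taking \<open>1 / fact (A + y - 1 + i)\<close> out of row \<open>i\<close> leaves a
  polynomial in \<open>i\<close> of degree \<open>y - 1 - j\<close>. Reversing the columns gives a
  Newton determinant at the points 0 to \<open>y - 1\<close>, whose Vandermonde product consists of
  factorials.\<close>

lemma det_inverse_fact:
  "\<exists>\<sigma>::real. \<sigma> \<in> {1, -1} \<and> det (mat y y (\<lambda>(i, j). 1 / fact (A + i + j))) = \<sigma> * (\<Prod>i<y. fact i / fact (A + y - 1 + i))"
proof -
  obtain \<sigma> :: real where s: "\<sigma> \<in> {1, -1}"
    "\<And>A. det (mat y y (\<lambda>(i, j). A i (y - 1 - j))) = \<sigma> * det (mat y y (\<lambda>(i, j). A i j))"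
    using det_reverse_columns[of y] by blast
  \<comment> \<open>Chosen such that \<open>real i - ?c k\<close> is
    \<open>A + y - 1 + i - k\<close>, the factor with index \<open>k\<close> of the falling
    factorial that starts at \<open>A + y - 1 + i\<close>.\<close>
  let ?c = "\<lambda>k. - (real A + real y - 1 - real k)"
  have ent: "1 / fact (A + i + j) = 1 / fact (A + y - 1 + i) * 1 * (\<Prod>k<y - 1 - j. real i - ?c k)"
    if "j < y" for i j
  proof -
    have "fact (A + y - 1 + i) = fact (A + y - 1 + i - d) * (\<Prod>k<d. real i - ?c k)" if "d \<le> y - 1" for d
      using that
    proof (induction d)
      case (Suc d)
      obtain t where t: "A + y - 1 + i - d = Suc t" "A + y - 1 + i - Suc d = t"
        using Suc.prems by (cases "A + y - 1 + i - d") auto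
      have "real (Suc t) = real i - ?c d" using t Suc.prems by linarith
      then have "fact (Suc t) = (real i - ?c d) * fact t" by (simp only: fact_Suc)
      then show ?case using Suc t by (simp add: mult_ac)
    qed simp
    from this[of "y - 1 - j"] have "fact (A + y - 1 + i) = fact (A + i + j) * (\<Prod>k<y - 1 - j. real i - ?c k)"
      using that by (simp add: add.commute add.left_commute)
    then have "(\<Prod>k<y - 1 - j. real i - ?c k) = fact (A + y - 1 + i) / fact (A + i + j)"
      by (simp add: field_simps)
    then show ?thesis by simp
  qed
  have "det (mat y y (\<lambda>(i, j). 1 / fact (A + i + j)))
    = det (mat y y (\<lambda>(i, j). 1 / fact (A + y - 1 + i) * 1 * (\<Prod>k<y - 1 - j. real i - ?c k)))"
    by (rule det_mat_cong) (use ent in simp)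
  also have "\<dots> = (\<Prod>i<y. 1 / fact (A + y - 1 + i)) * (\<Prod>j<y. 1) * det (mat y y (\<lambda>(i, j). \<Prod>k<y - 1 - j. real i - ?c k))"
    by (rule det_scale)
  also have "det (mat y y (\<lambda>(i, j). \<Prod>k<y - 1 - j. real i - ?c k)) = \<sigma> * det (mat y y (\<lambda>(i, j). \<Prod>k<j. real i - ?c k))"
    by (rule s(2))
  also have "det (mat y y (\<lambda>(i, j). \<Prod>k<j. real i - ?c k)) = (\<Prod>j<y. \<Prod>i<j. real j - real i)"
    by (rule det_newton)
  also have "\<dots> = (\<Prod>j<y. fact j)"
  proof (rule prod.cong[OF refl])
    fix j
    have "(\<Prod>i<j. real j - real i) = (\<Prod>i<j. real (Suc i))"
      by (rule prod.reindex_bij_witness[of _ "\<lambda>i. j - 1 - i" "\<lambda>i. j - 1 - i"]) auto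
    then show "(\<Prod>i<j. real j - real i) = fact j"
      by (simp add: fact_prod_Suc lessThan_atLeast0)
  qed
  finally have "det (mat y y (\<lambda>(i, j). 1 / fact (A + i + j)))
      = \<sigma> * ((\<Prod>i<y. 1 / fact (A + y - 1 + i)) * (\<Prod>j<y. fact j))" by simp
  also have "(\<Prod>i<y. 1 / fact (A + y - 1 + i) :: real) * (\<Prod>j<y. fact j) = (\<Prod>i<y. fact i / fact (A + y - 1 + i))"
    by (simp add: prod.distrib[symmetric])
  finally show ?thesis using s(1) by blast
qed


section \<open>Moments of the weight and the Selberg sum\<close>

lemma right_prod_split: "j \<le> t \<Longrightarrow> right_prod (c + j) (t - j) s = (\<Prod>k<j. xsq (t - Suc k) - xsq s) * right_prod c t s"
proof -
  assume jt: "j \<le> t"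
  have "(\<Prod>k<j. xsq (t - j + k) - xsq s) = (\<Prod>k<j. xsq (t - Suc k) - xsq s)"
    by (rule prod.reindex_bij_witness[of _ "\<lambda>k. j - Suc k" "\<lambda>k. j - Suc k"])
       (use jt in \<open>auto intro!: arg_cong[of _ _ xsq]\<close>)
  then show ?thesis
    unfolding right_prod_def add.commute[of c j] prod_lessThan_add using jt by simp
qed

lemma left_prod_split: "left_prod (a + i) s = left_prod a s * (\<Prod>k<i. xsq s - xsq (a + 1 + k))"
  unfolding left_prod_def prod_lessThan_add by simp

lemma xsq_mono: "1 \<le> p \<Longrightarrow> p \<le> q \<Longrightarrow> xsq p \<le> xsq q"
  unfolding xsq_def by (intro power_mono) auto

lemma racah_weight_nonneg:
  assumes "s \<in> {a + 1..a + N}"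
  shows "racah_weight a c N s \<ge> 0"
proof -
  have "left_prod a s \<ge> 0" unfolding left_prod_def
    by (rule prod_nonneg) (use assms in \<open>auto intro!: xsq_mono\<close>)
  moreover have "right_prod c (a + N + 1) s \<ge> 0" unfolding right_prod_def
    by (rule prod_nonneg) (use assms in \<open>auto intro!: xsq_mono\<close>)
  moreover have "real s - 1 / 2 \<ge> 0" using assms by auto
  ultimately show ?thesis unfolding racah_weight_def by simp
qed

text \<open>The two Newton products move the left end by \<open>i\<close> and the right end by
  \<open>j\<close> inwards, so the moment is the total mass for the parameters \<open>a + i\<close>,
  \<open>c + j\<close>, \<open>N - i - j\<close>. If \<open>i + j\<close> is at least
  \<open>N\<close>, every position is hit by a zero factor and the binomial coefficient vanishes
  too, so one formula holds throughout. Beyond row and column factors only \<open>i + j\<close>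
  enters.\<close>

lemma racah_moment:
  assumes "i < N" "j < N"
  shows "(\<Sum>s\<in>{a + 1..a + N}. racah_weight a c N s * (\<Prod>k<i. xsq s - xsq (a + 1 + k)) * (\<Prod>k<j. xsq (a + N - k) - xsq s))
    = (fact (a + i) * fact (N + 2 * a + c + i) / 2) * (fact (c + j) / fact (N + a - 1 - j))
        * real (a + c + N choose (a + c + 1 + i + j))" (is "(\<Sum>s\<in>_. ?F s) = _")
proof (cases "i + j < N")
  case True
  define m where "m = N - i - j - 1"
  have N: "N = m + 1 + i + j" using True by (simp add: m_def)
  have F: "?F s = racah_weight (a + i) (c + j) (Suc m) s" for s
  proof -
    have t: "a + i + Suc m + 1 = a + N + 1 - j" using N by simp
    have "right_prod (c + j) (a + N + 1 - j) s = (\<Prod>k<j. xsq (a + N - k) - xsq s) * right_prod c (a + N + 1) s"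
      by (subst right_prod_split) (use N in auto)
    then show ?thesis unfolding racah_weight_def left_prod_split t by simp
  qed
  have "(\<Sum>s\<in>{a + 1..a + N}. ?F s) = (\<Sum>s\<in>{a + i + 1..a + i + Suc m}. ?F s)"
  proof (rule sum.mono_neutral_right, goal_cases)
    case 3
    show ?case
    proof
      fix s assume s: "s \<in> {a + 1..a + N} - {a + i + 1..a + i + Suc m}"
      then have "s \<le> a + i \<or> a + N - j < s" using N by auto
      then show "?F s = 0"
      proof
        assume "s \<le> a + i"
        then have "(\<Prod>k<i. xsq s - xsq (a + 1 + k)) = 0"
          using s by (intro prod_zero bexI[of _ "s - a - 1"]) auto
        then show ?thesis by simp
      next
        assume "a + N - j < s"
        then have "(\<Prod>k<j. xsq (a + N - k) - xsq s) = 0"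
          using s by (intro prod_zero bexI[of _ "a + N - s"]) auto
        then show ?thesis by simp
      qed
    qed
  qed (use N in auto)
  also have "\<dots> = racah_total (a + i) (c + j) (Suc m)"
    unfolding racah_total_def F ..
  also have "\<dots> = fact (c + j) * fact (a + i) / (2 * fact (a + i + (c + j) + 1))
     * (fact (m + 1 + 2 * (a + i) + (c + j)) / fact m) * (fact (m + 1 + (a + i) + (c + j)) / fact (m + (a + i)))"
    by (rule racah_total_formula)
  also have "m + 1 + 2 * (a + i) + (c + j) = N + 2 * a + c + i" using N by simp
  also have "m + 1 + (a + i) + (c + j) = a + c + N" using N by simp
  also have "m + (a + i) = N + a - 1 - j" using N by simp
  also have "a + i + (c + j) + 1 = a + c + 1 + i + j" by simp
  also have "fact (c + j) * fact (a + i) / (2 * fact (a + c + 1 + i + j) :: real) * (fact (N + 2 * a + c + i) / fact m)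
      * (fact (a + c + N) / fact (N + a - 1 - j))
    = (fact (a + i) * fact (N + 2 * a + c + i) / 2) * (fact (c + j) / fact (N + a - 1 - j))
        * (fact (a + c + N) / (fact (a + c + 1 + i + j) * fact m))"
    by (simp add: mult_ac del: fact_Suc)
  also have "fact (a + c + N) / (fact (a + c + 1 + i + j) * fact m) = real (a + c + N choose (a + c + 1 + i + j))"
    using N by (subst binomial_fact) (simp_all del: fact_Suc)
  finally show ?thesis .
next
  case False
  have "?F s = 0" if s: "s \<in> {a + 1..a + N}" for s
  proof (cases "s \<le> a + i")
    case True
    then have "(\<Prod>k<i. xsq s - xsq (a + 1 + k)) = 0"
      using s by (intro prod_zero bexI[of _ "s - a - 1"]) auto
    then show ?thesis by simp
  next
    case F: False
    then have "(\<Prod>k<j. xsq (a + N - k) - xsq s) = 0"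
      using s False by (intro prod_zero bexI[of _ "a + N - s"]) auto
    then show ?thesis by simp
  qed
  then have "(\<Sum>s\<in>{a + 1..a + N}. ?F s) = 0" by (rule sum.neutral[OF ballI])
  then show ?thesis using False by (simp only:) (simp add: binomial_eq_0)
qed

text \<open>The hypothesis keeps \<open>n - A - j\<close> from truncating, so that each raised
  binomial coefficient splits into a row factor, a column factor and
  \<open>1 / fact (A + i + j)\<close>.\<close>

lemma det_binomial_hankel:
  assumes "A + y \<le> n + 1"
  shows "\<exists>\<sigma>::real. \<sigma> \<in> {1, -1} \<and> det (mat y y (\<lambda>(i, j). real (n choose (A + i + j))))
    = \<sigma> * (\<Prod>i<y. fact (n + i) * fact i / (fact (n - A - i) * fact (A + y - 1 + i)))"
proof -
  obtain \<sigma> :: real where s: "\<sigma> \<in> {1, -1}"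
    "det (mat y y (\<lambda>(i, j). 1 / fact (A + i + j))) = \<sigma> * (\<Prod>i<y. fact i / fact (A + y - 1 + i))"
    using det_inverse_fact[of y A] by blast
  have "det (mat y y (\<lambda>(i, j). real (n choose (A + i + j))))
    = det (mat y y (\<lambda>(i, j). fact (n + i) * (1 / fact (n - A - j)) * (1 / fact (A + i + j))))"
    unfolding det_binomial_row_ops[symmetric]
  proof (rule det_mat_cong)
    fix i j assume ij: "i < y" "j < y"
    then have "A + i + j \<le> n + i" "n + i - (A + i + j) = n - A - j" using assms by auto
    then show "(case (i, j) of (i, j) \<Rightarrow> real (n + i choose (A + i + j)))
      = (case (i, j) of (i, j) \<Rightarrow> fact (n + i) * (1 / fact (n - A - j)) * (1 / fact (A + i + j)))"
      by (simp add: binomial_fact)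
  qed
  also have "\<dots> = (\<Prod>i<y. fact (n + i)) * (\<Prod>j<y. 1 / fact (n - A - j)) * det (mat y y (\<lambda>(i, j). 1 / fact (A + i + j)))"
    by (rule det_scale)
  also have "\<dots> = \<sigma> * ((\<Prod>i<y. fact (n + i)) * (\<Prod>j<y. 1 / fact (n - A - j)) * (\<Prod>i<y. fact i / fact (A + y - 1 + i)))"
    unfolding s(2) by simp
  also have "(\<Prod>i<y. fact (n + i) :: real) * (\<Prod>j<y. 1 / fact (n - A - j)) * (\<Prod>i<y. fact i / fact (A + y - 1 + i))
    = (\<Prod>i<y. fact (n + i) * (1 / fact (n - A - i)) * (fact i / fact (A + y - 1 + i)))"
    by (simp only: prod.distrib)
  also have "\<dots> = (\<Prod>i<y. fact (n + i) * fact i / (fact (n - A - i) * fact (A + y - 1 + i)))"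
    by simp
  finally show ?thesis using s(1) by blast
qed

text \<open>Cauchy-Binet with Newton bases from opposite ends. Each of the two minors is a
  Vandermonde product up to sign, whence the square; the entries of the big matrix are moments known
  in product form.\<close>

lemma racah_selberg:
  assumes yN: "y \<le> N"
  shows "(\<Sum>S | S \<subseteq> {a + 1..a + N} \<and> card S = y. (\<Prod>s\<in>S. racah_weight a c N s) * (vdm xsq S)\<^sup>2)
    = (\<Prod>i<y. fact (a + i) * fact (c + i) * fact i * fact (N + 2 * a + c + i) * fact (a + c + N + i)
        / (2 * fact (N + a - 1 - i) * fact (N - 1 - i) * fact (a + c + y + i)))" (is "?Z = ?P")
proof -
  \<comment> \<open>The trivial denominator gives \<open>f\<close> the shape treated in
    \<open>det_newton_scaled\<close>.\<close>
  define f where "f j s = racah_weight a c N s * (\<Prod>k<j. xsq s - xsq (a + 1 + k)) / 1" for j s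
  define g where "g j s = (\<Prod>k<j. xsq (a + N - k) - xsq s)" for j s
  \<comment> \<open>The signs of the differences in \<open>g\<close>, which are opposite to those of
    a Newton product.\<close>
  define \<kappa> where "\<kappa> = (\<Prod>j<y. (- 1) ^ j :: real)"
  have kk: "\<kappa> * \<kappa> = 1" unfolding \<kappa>_def by (simp add: prod.distrib[symmetric] power_add[symmetric] mult_2[symmetric])
  have "det (mat y y (\<lambda>(i, j). \<Sum>s\<in>{a + 1..a + N}. f i s * g j s))
    = (\<Sum>S | S \<subseteq> {a + 1..a + N} \<and> card S = y.
        det (mat y y (\<lambda>(i, j). f j (sorted_list_of_set S ! i)))
        * det (mat y y (\<lambda>(i, j). g j (sorted_list_of_set S ! i))))"
    by (rule cauchy_binet) simp
  also have "\<dots> = (\<Sum>S | S \<subseteq> {a + 1..a + N} \<and> card S = y. \<kappa> * ((\<Prod>s\<in>S. racah_weight a c N s) * (vdm xsq S)\<^sup>2))"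
  proof (rule sum.cong[OF refl])
    fix S assume "S \<in> {S. S \<subseteq> {a + 1..a + N} \<and> card S = y}"
    then have S: "S \<subseteq> {a + 1..a + N}" "card S = y" "finite S" by (auto intro: finite_subset)
    define e where "e i = sorted_list_of_set S ! i" for i
    have inc: "e i < e j" if "i < j" "j < y" for i j
      using strict_sorted_list_of_set[of S] that S by (simp add: sorted_wrt_iff_nth_less e_def)
    have eS: "S = e ` {..<y}"
      using S(2,3) unfolding e_def
      by (metis length_sorted_list_of_set lessThan_atLeast0 list.set_map map_nth set_sorted_list_of_set set_upt)
    have v: "vdm xsq S = (\<Prod>j<y. \<Prod>i<j. xsq (e j) - xsq (e i))"
      unfolding eS by (rule vdm_image) (rule inc)
    have "det (mat y y (\<lambda>(i, j). f j (e i))) = (\<Prod>i<y. racah_weight a c N (e i)) * (\<Prod>j<y. \<Prod>i<j. xsq (e j) - xsq (e i)) / (\<Prod>j<y. 1)"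
      unfolding f_def by (rule det_newton_scaled)
    moreover have "(\<Prod>i<y. racah_weight a c N (e i)) = (\<Prod>s\<in>S. racah_weight a c N s)"
      unfolding eS by (subst prod.reindex) (auto intro!: increasing_inj_on inc)
    moreover have "det (mat y y (\<lambda>(i, j). g j (e i))) = \<kappa> * vdm xsq S"
    proof -
      have "det (mat y y (\<lambda>(i, j). g j (e i)))
        = det (mat y y (\<lambda>(i, j). 1 * (- 1) ^ j * (\<Prod>k<j. xsq (e i) - xsq (a + N - k))))"
      proof (rule det_mat_cong)
        fix i j
        have "(\<Prod>k<j. xsq (a + N - k) - xsq (e i)) = (\<Prod>k<j. (- 1) * (xsq (e i) - xsq (a + N - k)))"
          by (rule prod.cong) auto
        also have "\<dots> = (- 1) ^ j * (\<Prod>k<j. xsq (e i) - xsq (a + N - k))"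
          by (simp only: prod.distrib prod_constant card_lessThan)
        finally show "(case (i, j) of (i, j) \<Rightarrow> g j (e i))
          = (case (i, j) of (i, j) \<Rightarrow> 1 * (- 1) ^ j * (\<Prod>k<j. xsq (e i) - xsq (a + N - k)))"
          by (simp add: g_def)
      qed
      also have "\<dots> = (\<Prod>i<y. 1) * (\<Prod>j<y. (- 1) ^ j) * det (mat y y (\<lambda>(i, j). \<Prod>k<j. xsq (e i) - xsq (a + N - k)))"
        by (rule det_scale)
      also have "det (mat y y (\<lambda>(i, j). \<Prod>k<j. xsq (e i) - xsq (a + N - k))) = (\<Prod>j<y. \<Prod>i<j. xsq (e j) - xsq (e i))"
        by (rule det_newton)
      finally show ?thesis by (simp add: v \<kappa>_def)
    qed
    ultimately show "det (mat y y (\<lambda>(i, j). f j (sorted_list_of_set S ! i)))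
        * det (mat y y (\<lambda>(i, j). g j (sorted_list_of_set S ! i)))
      = \<kappa> * ((\<Prod>s\<in>S. racah_weight a c N s) * (vdm xsq S)\<^sup>2)"
      unfolding e_def[symmetric] v[symmetric] by (simp add: power2_eq_square)
  qed
  also have "\<dots> = \<kappa> * ?Z" by (simp add: sum_distrib_left)
  finally have 1: "det (mat y y (\<lambda>(i, j). \<Sum>s\<in>{a + 1..a + N}. f i s * g j s)) = \<kappa> * ?Z" .
  obtain \<sigma> :: real where s: "\<sigma> \<in> {1, -1}" "det (mat y y (\<lambda>(i, j). real (a + c + N choose (a + c + 1 + i + j))))
    = \<sigma> * (\<Prod>i<y. fact (a + c + N + i) * fact i / (fact (a + c + N - (a + c + 1) - i) * fact (a + c + 1 + y - 1 + i)))"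
    using det_binomial_hankel[of "a + c + 1" y "a + c + N"] yN by auto
  have "det (mat y y (\<lambda>(i, j). \<Sum>s\<in>{a + 1..a + N}. f i s * g j s))
    = det (mat y y (\<lambda>(i, j). (fact (a + i) * fact (N + 2 * a + c + i) / 2) * (fact (c + j) / fact (N + a - 1 - j))
        * real (a + c + N choose (a + c + 1 + i + j))))"
  proof (rule det_mat_cong)
    fix i j assume "i < y" "j < y"
    then have "i < N" "j < N" using yN by auto
    from racah_moment[OF this, of a c]
    show "(case (i, j) of (i, j) \<Rightarrow> \<Sum>s\<in>{a + 1..a + N}. f i s * g j s)
      = (case (i, j) of (i, j) \<Rightarrow> (fact (a + i) * fact (N + 2 * a + c + i) / 2) * (fact (c + j) / fact (N + a - 1 - j))
        * real (a + c + N choose (a + c + 1 + i + j)))"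
      by (simp add: f_def g_def)
  qed
  also have "\<dots> = (\<Prod>i<y. fact (a + i) * fact (N + 2 * a + c + i) / 2) * (\<Prod>j<y. fact (c + j) / fact (N + a - 1 - j))
      * det (mat y y (\<lambda>(i, j). real (a + c + N choose (a + c + 1 + i + j))))"
    by (rule det_scale)
  also have "\<dots> = \<sigma> * ((\<Prod>i<y. fact (a + i) * fact (N + 2 * a + c + i) / 2) * (\<Prod>j<y. fact (c + j) / fact (N + a - 1 - j))
      * (\<Prod>i<y. fact (a + c + N + i) * fact i / (fact (a + c + N - (a + c + 1) - i) * fact (a + c + 1 + y - 1 + i))))"
    unfolding s(2) by simp
  also have "(\<Prod>i<y. fact (a + i) * fact (N + 2 * a + c + i) / 2) * (\<Prod>j<y. fact (c + j) / fact (N + a - 1 - j))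
      * (\<Prod>i<y. fact (a + c + N + i) * fact i / (fact (a + c + N - (a + c + 1) - i) * fact (a + c + 1 + y - 1 + i)))
    = ?P"
    unfolding prod.distrib[symmetric]
  proof (rule prod.cong[OF refl])
    fix i
    have "a + c + N - (a + c + 1) - i = N - 1 - i" "a + c + 1 + y - 1 + i = a + c + y + i" by auto
    then show "fact (a + i) * fact (N + 2 * a + c + i) / 2 * (fact (c + i) / fact (N + a - 1 - i)) *
         (fact (a + c + N + i) * fact i / (fact (a + c + N - (a + c + 1) - i) * fact (a + c + 1 + y - 1 + i))) =
         fact (a + i) * fact (c + i) * fact i * fact (N + 2 * a + c + i) * fact (a + c + N + i)
        / (2 * fact (N + a - 1 - i) * fact (N - 1 - i) * fact (a + c + y + i) :: real)"
      by (simp only: times_divide_eq_left times_divide_eq_right divide_divide_eq_left mult_ac)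
  qed
  finally have 2: "\<kappa> * ?Z = \<sigma> * ?P" unfolding 1 .
  have "?Z = (\<kappa> * \<kappa>) * ?Z" unfolding kk by simp
  also have "\<dots> = (\<kappa> * \<sigma>) * ?P" unfolding mult.assoc 2 ..
  finally have Z: "?Z = (\<kappa> * \<sigma>) * ?P" .
  \<comment> \<open>The signs \<open>\<kappa>\<close> and \<open>\<sigma>\<close> agree because \<open>?Z\<close> cannot be negative; neither has to be computed.\<close>
  have "?Z \<ge> 0"
  proof (intro sum_nonneg mult_nonneg_nonneg prod_nonneg)
    fix S s assume "S \<in> {S. S \<subseteq> {a + 1..a + N} \<and> card S = y}" "s \<in> S"
    then show "0 \<le> racah_weight a c N s" by (intro racah_weight_nonneg) auto
  qed auto
  moreover have "?P > 0" by (rule prod_pos) simp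
  moreover have "\<kappa> = 1 \<or> \<kappa> = - 1" using kk by (metis square_eq_1_iff)
  then have "\<kappa> * \<sigma> = 1 \<or> \<kappa> * \<sigma> = - 1" using s(1) by auto
  ultimately show ?thesis using Z by auto
qed

section \<open>Alternating blocks\<close>

text \<open>The union of every second one of the consecutive intervals of lengths \<open>s ! 0, s ! 1, \<dots>\<close>,
  starting with the first one if \<open>c\<close>.\<close>

fun blocks :: "bool \<Rightarrow> nat list \<Rightarrow> nat set" where
  "blocks c [] = {}"
| "blocks c (x # s) = (if c then {0<..x} else {}) \<union> (+) x ` blocks (\<not> c) s"

lemma plus_image_Ioc: "(+) x ` {p<..q} = {x + p<..x + q}" for x p q :: nat
  by (auto simp: image_iff intro!: bexI[of _ "_ - x"])

lemma blocks_append: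
  "blocks c (s @ t) = blocks c s \<union> (+) (sum_list s) ` blocks (if even (length s) then c else \<not> c) t"
proof (induction s arbitrary: c)
  case (Cons x s)
  have "(+) x ` (+) (sum_list s) ` X = (+) (x + sum_list s) ` X" for X
    by (auto simp: image_image add.assoc)
  then show ?case by (simp add: Cons image_Un Un_assoc)
qed simp

lemma blocks_subset: "blocks c s \<subseteq> {0<..sum_list s}"
proof (induction s arbitrary: c)
  case (Cons x s)
  show ?case using Cons[of "\<not> c"] by (auto split: if_splits)
qed simp

lemma finite_blocks: "finite (blocks c s)"
  using blocks_subset finite_subset by blast

lemma blocks_Un: "blocks c s \<union> blocks (\<not> c) s = {0<..sum_list s}"
proof (induction s arbitrary: c)
  case (Cons x s)
  have "blocks c (x # s) \<union> blocks (\<not> c) (x # s) = {0<..x} \<union> (+) x ` (blocks c s \<union> blocks (\<not> c) s)"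
    by auto
  also have "\<dots> = {0<..x} \<union> {x<..x + sum_list s}" unfolding Cons plus_image_Ioc by simp
  finally show ?case by auto
qed simp

lemma blocks_Int: "blocks c s \<inter> blocks (\<not> c) s = {}"
proof (induction s arbitrary: c)
  case (Cons x s)
  have "(+) x ` blocks c s \<inter> (+) x ` blocks (\<not> c) s = {}"
    using Cons[of c] by auto
  moreover have "{0<..x} \<inter> (+) x ` blocks d s = {}" for d
    using blocks_subset[of d s] by auto
  ultimately show ?case
    by (cases c) (simp_all only: blocks.simps if_True if_False not_True_eq_False not_False_eq_True, blast+)
qed simp

lemma osum_Cons: "osum (x # s) = x + esum s" and esum_Cons: "esum (x # s) = osum s"
proof -
  have sh: "(\<Sum>i | i \<in> {1..length (x # s)} \<and> P i. entry (x # s) i)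
    = (if P 1 then x else 0) + (\<Sum>i | i \<in> {1..length s} \<and> P (Suc i). entry s i)" for P
  proof -
    have "{i. i \<in> {1..length (x # s)} \<and> P i} = (if P 1 then {1} else {}) \<union> Suc ` {i. i \<in> {1..length s} \<and> P (Suc i)}"
      (is "?L = ?R")
    proof (intro equalityI subsetI)
      fix i assume i: "i \<in> ?L"
      show "i \<in> ?R"
      proof (cases "i = 1")
        case False
        then obtain j where "i = Suc j" "1 \<le> j" using i by (cases i) auto
        then show ?thesis using i by auto
      qed (use i in auto)
    qed (auto split: if_splits)
    then have "(\<Sum>i | i \<in> {1..length (x # s)} \<and> P i. entry (x # s) i)
      = (\<Sum>i\<in>(if P 1 then {1} else {}). entry (x # s) i) + (\<Sum>i\<in>Suc ` {i. i \<in> {1..length s} \<and> P (Suc i)}. entry (x # s) i)"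
      by (simp only:) (rule sum.union_disjoint, auto)
    also have "(\<Sum>i\<in>Suc ` {i. i \<in> {1..length s} \<and> P (Suc i)}. entry (x # s) i)
      = (\<Sum>i | i \<in> {1..length s} \<and> P (Suc i). entry s i)"
      by (subst sum.reindex) (auto intro!: sum.cong simp: entry_def nth_Cons')
    finally show ?thesis by (simp add: entry_def)
  qed
  show "osum (x # s) = x + esum s" unfolding osum_def esum_def sh by simp
  show "esum (x # s) = osum s" unfolding osum_def esum_def sh by simp
qed

lemma sum_list_osum_esum: "sum_list s = osum s + esum s"
  by (induction s) (simp_all add: osum_Cons esum_Cons, simp add: osum_def esum_def)

lemma card_blocks: "card (blocks c s) = (if c then osum s else esum s)"
proof (induction s arbitrary: c)
  case Nil
  then show ?case by (simp add: osum_def esum_def)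
next
  case (Cons x s)
  have "{0<..x} \<inter> (+) x ` blocks d s = {}" for d
    using blocks_subset[of d s] by auto
  moreover have "card ((+) x ` blocks d s) = (if d then osum s else esum s)" for d
    using Cons by (simp add: card_image)
  ultimately show ?case
    by (auto simp: osum_Cons esum_Cons card_Un_disjoint finite_blocks)
qed

lemma psum_0 [simp]: "psum s 0 = 0"
  by (simp add: psum_def)

lemma psum_Suc: "psum s (Suc k) = psum s k + entry s (Suc k)"
  by (simp add: psum_def)

lemma psum_Cons_Suc: "psum (x # s) (Suc k) = x + psum s k"
  by (induction k) (simp_all add: psum_Suc entry_def)

lemma psum_le: "psum s k \<le> sum_list s"
proof (induction s arbitrary: k)
  case Nil
  then show ?case by (simp add: psum_def entry_def)
next
  case (Cons x s)
  then show ?case by (cases k) (auto simp: psum_Cons_Suc)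
qed

lemma blocks_eq_UN:
  "blocks c s = (\<Union>i\<in>{i. i \<in> {1..length s} \<and> odd i = c}. {psum s (i - 1)<..psum s i})"
proof (induction s arbitrary: c)
  case (Cons x s)
  have set: "{i. i \<in> {1..length (x # s)} \<and> odd i = c} = (if c then {1} else {}) \<union> Suc ` {i. i \<in> {1..length s} \<and> odd i = (\<not> c)}"
    (is "?L = ?R")
  proof (intro equalityI subsetI)
    fix i assume i: "i \<in> ?L"
    show "i \<in> ?R"
    proof (cases "i = 1")
      case False
      then obtain j where "i = Suc j" "1 \<le> j" using i by (cases i) auto
      then show ?thesis using i by auto
    qed (use i in auto)
  qed (auto split: if_splits)
  have "{psum (x # s) (Suc i - 1)<..psum (x # s) (Suc i)} = (+) x ` {psum s (i - 1)<..psum s i}" if "1 \<le> i" for i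
    using that by (cases i) (simp_all add: psum_Cons_Suc plus_image_Ioc)
  then have "(\<Union>i\<in>Suc ` {i. i \<in> {1..length s} \<and> odd i = (\<not> c)}. {psum (x # s) (i - 1)<..psum (x # s) i})
    = (\<Union>i\<in>{i. i \<in> {1..length s} \<and> odd i = (\<not> c)}. (+) x ` {psum s (i - 1)<..psum s i})"
    unfolding UN_simps(10) by (intro SUP_cong refl) auto
  also have "\<dots> = (+) x ` blocks (\<not> c) s" unfolding Cons by (simp only: image_UN)
  finally show ?case unfolding set UN_Un by (simp add: psum_def entry_def)
qed simp

lemma entry_le_esum: "i \<in> {1..length s} \<Longrightarrow> even i \<Longrightarrow> entry s i \<le> esum s"
  unfolding esum_def by (rule member_le_sum) auto

lemma entry_le_osum: "i \<in> {1..length s} \<Longrightarrow> odd i \<Longrightarrow> entry s i \<le> osum s"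
  unfolding osum_def by (rule member_le_sum) auto

lemma blocks_rev:
  "blocks c (rev s) = (\<lambda>p. sum_list s + 1 - p) ` blocks (if odd (length s) then c else \<not> c) s"
proof (induction s arbitrary: c)
  case (Cons x s)
  let ?d = "if odd (length (x # s)) then c else \<not> c"
  have 1: "(\<lambda>p. x + sum_list s + 1 - p) ` (+) x ` X = (\<lambda>p. sum_list s + 1 - p) ` X" for X
    by (auto simp: image_image)
  have 2: "(\<lambda>p. x + sum_list s + 1 - p) ` {0<..x} = {sum_list s<..sum_list s + x}"
  proof (intro equalityI subsetI)
    fix q assume "q \<in> {sum_list s<..sum_list s + x}"
    then have "q = x + sum_list s + 1 - (x + sum_list s + 1 - q)" "x + sum_list s + 1 - q \<in> {0<..x}" by auto
    then show "q \<in> (\<lambda>p. x + sum_list s + 1 - p) ` {0<..x}" by (rule image_eqI)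
  qed auto
  have 3: "(\<lambda>p. x + sum_list s + 1 - p) ` (if d then {0<..x} else {}) = (if d then {sum_list s<..sum_list s + x} else {})" for d
    by (cases d) (simp_all only: if_True if_False image_empty 2)
  have "blocks c (rev (x # s)) = blocks c (rev s) \<union> (+) (sum_list s) ` blocks (if even (length s) then c else \<not> c) [x]"
    by (simp add: blocks_append)
  also have "\<dots> = (\<lambda>p. sum_list s + 1 - p) ` blocks (\<not> ?d) s \<union> (if ?d then {sum_list s<..sum_list s + x} else {})"
    unfolding Cons by (simp add: plus_image_Ioc)
  also have "\<dots> = (\<lambda>p. x + sum_list s + 1 - p) ` blocks ?d (x # s)"
    by (simp only: blocks.simps image_Un 1 3 Un_commute)
  also have "x + sum_list s = sum_list (x # s)" by simp
  finally show ?case .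
qed simp

lemma blocks_replicate_0: "blocks c (replicate k 0) = {}"
  by (induction k arbitrary: c) auto

lemma map_entry_pad: "length s \<le> m \<Longrightarrow> map (entry s) [1..<Suc m] = s @ replicate (m - length s) 0"
  by (rule nth_equalityI) (auto simp: entry_def nth_append simp del: upt_Suc)

text \<open>The first \<open>Suc m\<close> entries are \<open>s\<close> padded by zeros. Cutting off
  the last of them is harmless since by parity its block is not selected; it is the gap that merges
  with \<open>x + y\<close> in the middle entry of \<open>t_plus\<close> or
  \<open>t_minus\<close>.\<close>

lemma map_entry_prefix:
  assumes "length s \<le> Suc m" and "c = even m"
  shows "blocks (\<not> c) (map (entry s) [1..<Suc m]) = blocks (\<not> c) s"
    and "sum_list (map (entry s) [1..<Suc m]) + entry s (Suc m) = sum_list s"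
proof -
  have "map (entry s) [1..<Suc m] @ [entry s (Suc m)] = map (entry s) [1..<Suc (Suc m)]" by simp
  also have "\<dots> = s @ replicate (Suc m - length s) 0" by (rule map_entry_pad[OF assms(1)])
  finally have eq: "map (entry s) [1..<Suc m] @ [entry s (Suc m)] = s @ replicate (Suc m - length s) 0" .
  have "blocks (\<not> c) (map (entry s) [1..<Suc m] @ [entry s (Suc m)]) = blocks (\<not> c) (map (entry s) [1..<Suc m])"
    using assms(2) by (simp add: blocks_append del: upt_Suc)
  moreover have "blocks (\<not> c) (s @ replicate (Suc m - length s) 0) = blocks (\<not> c) s"
    by (simp add: blocks_append blocks_replicate_0)
  ultimately show "blocks (\<not> c) (map (entry s) [1..<Suc m]) = blocks (\<not> c) s" unfolding eq by simp
  have "sum_list (map (entry s) [1..<Suc m] @ [entry s (Suc m)]) = sum_list (s @ replicate (Suc m - length s) 0)"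
    unfolding eq ..
  then show "sum_list (map (entry s) [1..<Suc m]) + entry s (Suc m) = sum_list s"
    by (simp add: sum_list_replicate del: upt_Suc)
qed

text \<open>The dents of the second sequence are measured from the east end of the base, so their
  positions are reflected.\<close>

definition mirror :: "nat \<Rightarrow> nat set \<Rightarrow> nat set" where
  "mirror w X = (\<lambda>p. w + 1 - p) ` X"

lemma plus_mirror: "X \<subseteq> {0<..w} \<Longrightarrow> (+) d ` mirror w X = mirror (d + w) X"
  unfolding mirror_def image_image by (rule image_cong) auto

text \<open>The leading 0 moves the blocks with odd index in \<open>as\<close> to even index, where
  a quartered hexagon has its dents. Read backwards, the odd number of entries of \<open>bs\<close>
  keeps the parity right at the east end. So the dents of this hexagon are the fixed dents of the
  upper half.\<close>

lemma t_plus_blocks: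
  "blocks False (t_plus x y as bs) = blocks True as \<union> mirror (N2_length x y as bs) (blocks True bs)"
  "sum_list (t_plus x y as bs) = N2_length x y as bs"
proof -
  define m where "m = 2 * ((len as + 1) div 2) - 1"
  define n where "n = 2 * ((len bs + 1) div 2) - 1"
  have len: "length s \<le> Suc (2 * ((len s + 1) div 2) - 1)" "odd (2 * ((len s + 1) div 2) - 1)"
    "Suc (2 * ((len s + 1) div 2) - 1) = 2 * ((len s + 1) div 2)" for s
    by (auto simp: len_def)
  let ?A = "map (entry as) [1..<Suc m]" and ?B = "map (entry bs) [1..<Suc n]"
  let ?g = "entry as (Suc m) + x + y + entry bs (Suc n)"
  have t: "t_plus x y as bs = 0 # ?A @ [?g] @ rev ?B"
    unfolding t_plus_def Let_def m_def n_def len(3) by simp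
  have A: "blocks True ?A = blocks True as" "sum_list ?A + entry as (Suc m) = sum_list as"
    using map_entry_prefix[of as m False] len[of as] unfolding m_def by auto
  have B: "blocks True ?B = blocks True bs" "sum_list ?B + entry bs (Suc n) = sum_list bs"
    using map_entry_prefix[of bs n False] len[of bs] unfolding n_def by auto
  have lA: "odd (length ?A)" "odd (length ?B)" using len(2) unfolding m_def n_def by auto
  show s: "sum_list (t_plus x y as bs) = N2_length x y as bs"
    using A(2) B(2) unfolding t N2_length_def by (simp del: upt_Suc)
  have "blocks False (t_plus x y as bs) = blocks True (?A @ [?g] @ rev ?B)" unfolding t by simp
  also have "\<dots> = blocks True ?A \<union> (+) (sum_list ?A) ` blocks False ([?g] @ rev ?B)"
    unfolding blocks_append using lA by simp
  also have "blocks False ([?g] @ rev ?B) = (+) ?g ` blocks True (rev ?B)" by simp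
  also have "blocks True (rev ?B) = mirror (sum_list ?B) (blocks True ?B)"
    unfolding blocks_rev mirror_def using lA by simp
  also have "(+) (sum_list ?A) ` (+) ?g ` mirror (sum_list ?B) (blocks True ?B)
    = mirror (sum_list ?A + (?g + sum_list ?B)) (blocks True ?B)"
  proof -
    have 1: "blocks True ?B \<subseteq> {0<..sum_list ?B}" by (rule blocks_subset)
    then have 2: "blocks True ?B \<subseteq> {0<..?g + sum_list ?B}" by auto
    show ?thesis unfolding plus_mirror[OF 1] plus_mirror[OF 2] ..
  qed
  also have "sum_list ?A + (?g + sum_list ?B) = N2_length x y as bs"
    using A(2) B(2) unfolding N2_length_def by simp
  finally show "blocks False (t_plus x y as bs) = blocks True as \<union> mirror (N2_length x y as bs) (blocks True bs)"
    unfolding A B .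
qed

text \<open>The analogue for the lower half. The final entry \<open>z\<close> is the dent by which
  the eastern boundary was straightened.\<close>

lemma t_minus_blocks:
  "blocks False (t_minus x y z as bs) = blocks False as \<union> mirror (N2_length x y as bs) (blocks False bs)
     \<union> {N2_length x y as bs<..N2_length x y as bs + z}"
  "sum_list (t_minus x y z as bs) = N2_length x y as bs + z"
proof -
  define m where "m = 2 * (len as div 2)"
  define n where "n = 2 * (len bs div 2)"
  have len: "length s \<le> Suc (2 * (len s div 2))" for s
    by (auto simp: len_def)
  have ev: "even m" "even n" unfolding m_def n_def by auto
  let ?A = "map (entry as) [1..<Suc m]" and ?B = "map (entry bs) [1..<Suc n]"
  let ?g = "entry as (Suc m) + x + y + entry bs (Suc n)"
  have t: "t_minus x y z as bs = ?A @ [?g] @ rev ?B @ [z]"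
    unfolding t_minus_def Let_def m_def n_def by simp
  have A: "blocks False ?A = blocks False as" "sum_list ?A + entry as (Suc m) = sum_list as"
    using map_entry_prefix[of as m True] len[of as] ev unfolding m_def by auto
  have B: "blocks False ?B = blocks False bs" "sum_list ?B + entry bs (Suc n) = sum_list bs"
    using map_entry_prefix[of bs n True] len[of bs] ev unfolding n_def by auto
  have lA: "even (length ?A)" "even (length ?B)" using ev by auto
  show s: "sum_list (t_minus x y z as bs) = N2_length x y as bs + z"
    using A(2) B(2) unfolding t N2_length_def by (simp del: upt_Suc)
  have "blocks False (t_minus x y z as bs) = blocks False ?A \<union> (+) (sum_list ?A) ` blocks False ([?g] @ rev ?B @ [z])"
    unfolding t blocks_append[of False ?A] using lA by simp
  also have "blocks False ([?g] @ rev ?B @ [z]) = (+) ?g ` blocks True (rev ?B @ [z])" by simp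
  also have "blocks True (rev ?B @ [z]) = mirror (sum_list ?B) (blocks False ?B) \<union> (+) (sum_list ?B) ` {0<..z}"
    unfolding blocks_append blocks_rev mirror_def using lA by simp
  also have "(+) (sum_list ?A) ` (+) ?g ` (mirror (sum_list ?B) (blocks False ?B) \<union> (+) (sum_list ?B) ` {0<..z})
    = mirror (sum_list ?A + (?g + sum_list ?B)) (blocks False ?B)
      \<union> {sum_list ?A + (?g + sum_list ?B)<..sum_list ?A + (?g + sum_list ?B) + z}"
  proof -
    have 1: "blocks False ?B \<subseteq> {0<..sum_list ?B}" by (rule blocks_subset)
    then have 2: "blocks False ?B \<subseteq> {0<..?g + sum_list ?B}" by auto
    show ?thesis unfolding image_Un plus_mirror[OF 1] plus_mirror[OF 2] plus_image_Ioc
      by (simp add: add.assoc)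
  qed
  also have "sum_list ?A + (?g + sum_list ?B) = N2_length x y as bs"
    using A(2) B(2) unfolding N2_length_def by simp
  finally show "blocks False (t_minus x y z as bs) = blocks False as \<union> mirror (N2_length x y as bs) (blocks False bs)
     \<union> {N2_length x y as bs<..N2_length x y as bs + z}"
    unfolding A B Un_assoc .
qed

section \<open>Vandermonde products of disjoint unions\<close>

lemma vdm_insert:
  assumes fin: "finite A" and b: "b \<notin> A"
    and mono: "\<And>p q. p \<in> insert b A \<Longrightarrow> q \<in> insert b A \<Longrightarrow> p < q \<Longrightarrow> X p \<le> X q"
  shows "vdm X (insert b A) = vdm X A * (\<Prod>a\<in>A. \<bar>X b - X a\<bar>)"
proof -
  have 1: "{p \<in> insert b A. p < b} = {p \<in> A. p < b}" by auto
  have 2: "(\<Prod>p\<in>{p \<in> insert b A. p < q}. X q - X p)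
      = (\<Prod>p\<in>{p \<in> A. p < q}. X q - X p) * (if b < q then X q - X b else 1)" if "q \<in> A" for q
  proof (cases "b < q")
    case True
    then have "{p \<in> insert b A. p < q} = insert b {p \<in> A. p < q}" by auto
    then show ?thesis using fin b True by simp
  next
    case False
    then have "{p \<in> insert b A. p < q} = {p \<in> A. p < q}" by auto
    then show ?thesis using False by simp
  qed
  have "vdm X (insert b A) = (\<Prod>p\<in>{p \<in> A. p < b}. X b - X p)
    * (\<Prod>q\<in>A. (\<Prod>p\<in>{p \<in> A. p < q}. X q - X p) * (if b < q then X q - X b else 1))"
    unfolding vdm_def using fin b 1 2 by simp
  also have "\<dots> = vdm X A * ((\<Prod>p\<in>{p \<in> A. p < b}. X b - X p) * (\<Prod>q\<in>A. if b < q then X q - X b else 1))"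
    by (simp add: vdm_def prod.distrib mult_ac)
  also have "(\<Prod>p\<in>{p \<in> A. p < b}. X b - X p) = (\<Prod>p\<in>A. if p < b then X b - X p else 1)"
    using fin by (simp add: prod.inter_filter)
  also have "(\<Prod>p\<in>A. if p < b then X b - X p else 1) * (\<Prod>q\<in>A. if b < q then X q - X b else 1)
    = (\<Prod>a\<in>A. \<bar>X b - X a\<bar>)"
    unfolding prod.distrib[symmetric]
  proof (rule prod.cong[OF refl])
    fix a assume a: "a \<in> A"
    then have "a \<noteq> b" using b by auto
    then have "a < b \<or> b < a" by auto
    then have "a < b \<and> X a \<le> X b \<or> b < a \<and> X b \<le> X a" using mono[of a b] mono[of b a] a by blast
    then show "(if a < b then X b - X a else 1) * (if b < a then X a - X b else 1) = \<bar>X b - X a\<bar>" by auto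
  qed
  finally show ?thesis .
qed

text \<open>Absolute values free the mixed product from the order in which elements of
  \<open>A\<close> and \<open>B\<close> interlace. The mixed products for two different dent sets
  can therefore be merged into one over their union.\<close>

lemma vdm_Un:
  assumes fin: "finite A" "finite B" and AB: "A \<inter> B = {}"
    and mono: "\<And>p q. p \<in> A \<union> B \<Longrightarrow> q \<in> A \<union> B \<Longrightarrow> p < q \<Longrightarrow> X p \<le> X q"
  shows "vdm X (A \<union> B) = vdm X A * vdm X B * (\<Prod>a\<in>A. \<Prod>b\<in>B. \<bar>X a - X b\<bar>)"
  using fin(1) AB mono
proof (induction A rule: finite_induct)
  case empty
  then show ?case by (simp add: vdm_def)
next
  case (insert x A)
  have "vdm X (insert x A \<union> B) = vdm X (insert x (A \<union> B))" by simp
  also have "\<dots> = vdm X (A \<union> B) * (\<Prod>a\<in>A \<union> B. \<bar>X x - X a\<bar>)"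
    by (rule vdm_insert) (use insert fin in auto)
  also have "vdm X (A \<union> B) = vdm X A * vdm X B * (\<Prod>a\<in>A. \<Prod>b\<in>B. \<bar>X a - X b\<bar>)"
    by (rule insert.IH) (use insert.prems in auto)
  also have "(\<Prod>a\<in>A \<union> B. \<bar>X x - X a\<bar>) = (\<Prod>a\<in>A. \<bar>X x - X a\<bar>) * (\<Prod>a\<in>B. \<bar>X x - X a\<bar>)"
    by (rule prod.union_disjoint) (use insert fin in auto)
  also have "vdm X A * vdm X B * (\<Prod>a\<in>A. \<Prod>b\<in>B. \<bar>X a - X b\<bar>)
      * ((\<Prod>a\<in>A. \<bar>X x - X a\<bar>) * (\<Prod>a\<in>B. \<bar>X x - X a\<bar>))
    = (vdm X A * (\<Prod>a\<in>A. \<bar>X x - X a\<bar>)) * vdm X B * (\<Prod>a\<in>insert x A. \<Prod>b\<in>B. \<bar>X a - X b\<bar>)"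
    using insert.hyps by (simp add: mult_ac)
  also have "vdm X A * (\<Prod>a\<in>A. \<bar>X x - X a\<bar>) = vdm X (insert x A)"
    by (rule vdm_insert[symmetric]) (use insert in auto)
  finally show ?case .
qed

lemma vdm_xsq_pos:
  assumes "P \<subseteq> {0<..}"
  shows "vdm xsq P > 0"
  unfolding vdm_def
proof (intro prod_pos)
  fix q p assume "q \<in> P" "p \<in> {p \<in> P. p < q}"
  then have "0 < (real q - real p)" "0 < real q + real p - 1" using assms by force+
  then show "0 < xsq q - xsq p" unfolding xsq_diff by (rule mult_pos_pos)
qed

text \<open>The origin of the weight: its factors are the distances from a crossing to all fixed
  dents, those to the west forming \<open>left_prod\<close> and those to the east
  \<open>right_prod\<close>.\<close>

lemma prod_abs_racah_weight:
  assumes s: "s \<in> {a + 1..a + N}" and U: "U = {0<..a} \<union> {a + N<..a + N + c}"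
  shows "(real s - 1 / 2) * (\<Prod>u\<in>U. \<bar>xsq s - xsq u\<bar>) = racah_weight a c N s"
proof -
  have "(\<Prod>u\<in>U. \<bar>xsq s - xsq u\<bar>) = (\<Prod>u\<in>{0<..a}. \<bar>xsq s - xsq u\<bar>) * (\<Prod>u\<in>{a + N<..a + N + c}. \<bar>xsq s - xsq u\<bar>)"
    unfolding U by (rule prod.union_disjoint) auto
  also have "(\<Prod>u\<in>{0<..a}. \<bar>xsq s - xsq u\<bar>) = left_prod a s"
    unfolding left_prod_def
    by (rule prod.reindex_bij_witness[of _ Suc "\<lambda>u. u - 1"]) (use s in \<open>auto simp: xsq_mono\<close>)
  also have "(\<Prod>u\<in>{a + N<..a + N + c}. \<bar>xsq s - xsq u\<bar>) = right_prod c (a + N + 1) s"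
    unfolding right_prod_def
    by (rule prod.reindex_bij_witness[of _ "\<lambda>k. a + N + 1 + k" "\<lambda>u. u - (a + N + 1)"])
       (use s in \<open>auto simp: abs_of_nonpos xsq_mono\<close>)
  finally show ?thesis by (simp add: racah_weight_def mult.assoc)
qed

section \<open>Rewriting the factorial products in terms of \<open>H\<close> and
  \<open>T\<close>\<close>

lemma H_add: "H (m + y) = H m * (\<Prod>i<y. fact (m + i))"
  by (simp add: H_def prod_lessThan_add)

lemma fact_pochhammer: "fact (k + m) = fact k * pochhammer (real (Suc k)) m"
  by (induction m) (simp_all add: pochhammer_Suc algebra_simps)

lemma prod_reverse: "(\<Prod>i<y. f (y - 1 - i)) = (\<Prod>i<y. f i)" for f :: "nat \<Rightarrow> 'a::comm_monoid_mult"
  by (rule prod.reindex_bij_witness[of _ "\<lambda>i. y - 1 - i" "\<lambda>i. y - 1 - i"]) auto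

text \<open>The rising factorial with index \<open>i\<close> runs from \<open>u + i + 1\<close> to
  \<open>u + n + 2 y - 1 - i\<close> and is a quotient of two factorials; those in the numerator
  occur in reverse order. For \<open>i < y\<close> the length \<open>n + 2 y - 1 - 2 i\<close> is
  positive, so nothing truncates.\<close>

lemma T_fact: "T (u + 1) (n + 2 * y - 1) y = (\<Prod>i<y. fact (u + n + y + i)) / (\<Prod>i<y. fact (u + i))"
proof -
  have "T (u + 1) (n + 2 * y - 1) y = (\<Prod>i<y. fact (u + n + y + (y - 1 - i)) / fact (u + i))"
    unfolding T_def
  proof (rule prod.cong[OF refl])
    fix i assume "i \<in> {..<y}"
    then have e: "u + i + (n + 2 * y - 1 - 2 * i) = u + n + y + (y - 1 - i)" by auto
    have "fact (u + n + y + (y - 1 - i)) = fact (u + i) * pochhammer (real (u + 1 + i)) (n + 2 * y - 1 - 2 * i)"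
      using fact_pochhammer[of "u + i" "n + 2 * y - 1 - 2 * i"] unfolding e by simp
    then show "pochhammer (real (u + 1 + i)) (n + 2 * y - 1 - 2 * i) = fact (u + n + y + (y - 1 - i)) / fact (u + i)"
      by simp
  qed
  then show ?thesis unfolding prod_dividef prod_reverse[of "\<lambda>i. fact (u + n + y + i)"] .
qed

text \<open>Everything is expressed by the products \<open>F m\<close> of \<open>y\<close>
  consecutive factorials. The quotient of the \<open>H\<close> contributes
  \<open>F (2 * a + c + y) * F c\<close>; its first factor cancels against a denominator in the
  quotient of the \<open>T\<close>, which accounts for all the remaining ones.\<close>

lemma racah_product_eq:
  fixes a c x y :: nat
  defines "N \<equiv> x + y"
  shows "(\<Prod>i<y. fact (a + i) * fact (c + i) * fact i * fact (N + 2 * a + c + i) * fact (a + c + N + i)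
        / (2 * fact (N + a - 1 - i) * fact (N - 1 - i) * fact (a + c + y + i)))
    = 1 / 2 ^ y * ((H (2 * a + c + 2 * y) * H (c + y)) / (H (2 * a + c + y) * H c))
      * ((T (x + 1) (2 * a + c + 2 * y - 1) y * T (x + a + 1) (c + 2 * y - 1) y)
        / (T 1 (2 * a + c + 2 * y - 1) y * T (a + 1) (c + 2 * y - 1) y))"
proof -
  define F where "F m = (\<Prod>i<y. fact (m + i) :: real)" for m
  have Fpos: "F m > 0" for m unfolding F_def by (intro prod_pos) simp
  have Hpos: "H m > 0" for m unfolding H_def by (intro prod_pos) simp
  have r: "(\<Prod>i<y. fact (N + a - 1 - i)) = F (x + a)" "(\<Prod>i<y. fact (N - 1 - i)) = F x"
  proof -
    have "(\<Prod>i<y. fact (N + a - 1 - i) :: real) = (\<Prod>i<y. fact (x + a + (y - 1 - i)))"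
      by (rule prod.cong) (auto simp: N_def intro!: arg_cong[of _ _ fact])
    then show "(\<Prod>i<y. fact (N + a - 1 - i)) = F (x + a)"
      unfolding F_def prod_reverse[of "\<lambda>i. fact (x + a + i)"] .
    have "(\<Prod>i<y. fact (N - 1 - i) :: real) = (\<Prod>i<y. fact (x + (y - 1 - i)))"
      by (rule prod.cong) (auto simp: N_def intro!: arg_cong[of _ _ fact])
    then show "(\<Prod>i<y. fact (N - 1 - i)) = F x"
      unfolding F_def prod_reverse[of "\<lambda>i. fact (x + i)"] .
  qed
  have L: "(\<Prod>i<y. fact (a + i) * fact (c + i) * fact i * fact (N + 2 * a + c + i) * fact (a + c + N + i)
        / (2 * fact (N + a - 1 - i) * fact (N - 1 - i) * fact (a + c + y + i)))
    = F a * F c * F 0 * F (N + 2 * a + c) * F (a + c + N) / (2 ^ y * F (x + a) * F x * F (a + c + y))"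
    unfolding prod_dividef prod.distrib r by (simp add: F_def)
  have T1: "T (x + 1) (2 * a + c + 2 * y - 1) y = F (N + 2 * a + c) / F x"
    unfolding T_fact F_def N_def by (simp add: add_ac)
  have T2: "T (x + a + 1) (c + 2 * y - 1) y = F (a + c + N) / F (x + a)"
    unfolding T_fact F_def N_def by (simp add: add_ac)
  have T3: "T 1 (2 * a + c + 2 * y - 1) y = F (2 * a + c + y) / F 0"
    using T_fact[of 0 "2 * a + c" y] unfolding F_def by simp
  have T4: "T (a + 1) (c + 2 * y - 1) y = F (a + c + y) / F a"
    unfolding T_fact F_def by (simp add: add_ac)
  have H1: "H (2 * a + c + 2 * y) = H (2 * a + c + y) * F (2 * a + c + y)"
    using H_add[of "2 * a + c + y" y] unfolding F_def by (simp add: mult_2 add_ac)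
  have H2': "H (c + y) = H c * F c" unfolding H_add F_def ..
  note nz = Fpos[THEN less_imp_neq, symmetric] Hpos[THEN less_imp_neq, symmetric]
  show ?thesis
    unfolding L T1 T2 T3 T4 H1 H2' using nz by (simp add: divide_simps mult_ac)
qed

lemma T_pos: "u > 0 \<Longrightarrow> T u n m > 0"
  unfolding T_def by (intro prod_pos pochhammer_pos) simp

section \<open>The quartered hexagons and the region cut in two\<close>

definition dent_union :: "(nat \<times> nat) set \<Rightarrow> (int \<times> int) set" where
  "dent_union I = (\<Union>(p, q)\<in>I. dent_cells p q)"

lemma corner_cells_0 [simp]: "corner_cells 0 = {}"
  by (auto simp: corner_cells_def)

lemma base_cells_empty [simp]: "base_cells {} = {}"
  by (simp add: base_cells_def)

definition t_dent_pairs :: "nat list \<Rightarrow> (nat \<times> nat) set" where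
  "t_dent_pairs t = (\<lambda>i. (psum t (2 * i - 1), psum t (2 * i))) ` {1..length t div 2}"

lemma cell_of_t_dents: "cell_of ` t_dents t = dent_union (t_dent_pairs t)"
  by (simp add: t_dents_def dent_union_def t_dent_pairs_def image_UN cell_of_up_dent)

lemma t_dent_pairs_blocks: "(\<Union>(p, q)\<in>t_dent_pairs t. {p<..q}) = blocks False t"
proof -
  have "{i. i \<in> {1..length t} \<and> odd i = False} = (\<lambda>i. 2 * i) ` {1..length t div 2}"
    by (auto elim!: evenE)
  then have "blocks False t = (\<Union>i\<in>{1..length t div 2}. {psum t (2 * i - 1)<..psum t (2 * i)})"
    unfolding blocks_eq_UN by (simp only: UN_simps)
  then show ?thesis by (simp add: t_dent_pairs_def)
qed

lemma psum_pred: "1 \<le> i \<Longrightarrow> psum t i = psum t (i - 1) + entry t i"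
  using psum_Suc[of t "i - 1"] by simp

lemma t_dent_pairs_bounds:
  assumes "(p, q) \<in> t_dent_pairs t"
  shows "q \<le> sum_list t \<and> q \<le> p + esum t"
proof -
  obtain i where i: "i \<in> {1..length t div 2}" "p = psum t (2 * i - 1)" "q = psum t (2 * i)"
    using assms by (auto simp: t_dent_pairs_def)
  have "entry t (2 * i) \<le> esum t" by (rule entry_le_esum) (use i in auto)
  then show ?thesis using psum_pred[of "2 * i" t] psum_le[of t "2 * i"] i by auto
qed

lemma cell_sum_t_dents:
  assumes "h = 2 * int (esum t) \<or> h = 2 * int (esum t) - 1"
  shows "cell_sum (half_region h (2 * int (sum_list t)) 0 - base_cells (blocks False t))
    = cell_sum (half_region h (2 * int (sum_list t)) 0 - dent_union (t_dent_pairs t))"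
proof -
  have "cell_sum (half_region h (2 * int (sum_list t)) 0 - base_cells ({} \<union> blocks False t))
    = (1 / 2) ^ 0 * cell_sum (half_region h (2 * int (sum_list t)) 0 - base_cells {}
        - (corner_cells 0 \<union> (\<Union>(p, q)\<in>t_dent_pairs t. dent_cells p q)))"
  proof (rule cell_sum_dents)
    show "h = 2 * int (esum t) \<or> h = 2 * int (esum t) - 1 \<and> 0 = (0::nat)" using assms by simp
    show "esum t \<le> sum_list t" by (simp add: sum_list_osum_esum)
    show "blocks False t = {0<..0} \<union> (\<Union>(p, q)\<in>t_dent_pairs t. {p<..q})"
      by (simp add: t_dent_pairs_blocks)
  qed (use t_dent_pairs_bounds in auto)
  then show ?thesis by (simp add: dent_union_def)
qed

lemma blocks_subset_Icc: "blocks c t \<subseteq> {1..sum_list t}"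
  using blocks_subset[of c t] by fastforce

lemma blocks_esum_0: "esum t = 0 \<Longrightarrow> blocks False t = {}"
  using card_blocks[of False t] finite_blocks[of False t] by simp

text \<open>The dents alone occupy \<open>esum t\<close> positions of the base, which is precisely
  the number demanded by the height \<open>2 * esum t\<close>. So the formula for a half region
  applies without any sum.\<close>

lemma Q'_formula:
  "Q' t = (\<Prod>p\<in>blocks False t. real p - 1 / 2) * vdm xsq (blocks False t) / H2 (2 * esum t + 1)"
proof -
  let ?h = "2 * int (esum t)"
  let ?R = "half_region ?h (2 * int (sum_list t)) 0 - dent_union (t_dent_pairs t)"
  have "Q'_region t = triangles_in (\<lambda>u k. 0 \<le> k \<and> k \<le> 2 * int (esum t) \<and>
       zigzag_left k \<le> u \<and> u \<le> real (sum_list t) - of_int k / 2) - t_dents t"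
    by (simp add: Q'_region_def sum_list_osum_esum)
  then have cells: "cell_of ` Q'_region t = ?R"
    by (simp add: image_set_diff[OF inj_cell_of] cell_of_triangles_in cells_in_upper cell_of_t_dents)
  have "Q' t = cell_sum (cell_of ` Q'_region t)"
    unfolding Q'_def
  proof (rule M_eq_cell_sum)
    fix l assume l: "l \<subseteq> Q'_region t" "is_lozenge l"
    show "zigzag_weight ?h l = cell_weight (cell_of ` l)"
    proof (rule zigzag_weight_cell[OF l(2)])
      fix i v assume "(i, v) \<in> cell_of ` l"
      then have "(i, v) \<in> ?R" using l(1) cells by blast
      then show "0 \<le> v \<and> i < ?h \<and> (v = 0 \<longrightarrow> 0 \<le> i)" by (auto simp: half_region_def)
    qed
  qed
  also have "\<dots> = cell_sum (half_region ?h (2 * int (sum_list t)) 0 - base_cells (blocks False t))"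
    unfolding cells by (rule cell_sum_t_dents[symmetric]) simp
  also have "\<dots> = (\<Prod>p\<in>blocks False t. real p - 1 / 2) * vdm xsq (blocks False t) / H2 (2 * esum t + 1)"
    using upper_half_formula[OF blocks_subset_Icc[of False t], of "esum t"] blocks_esum_0[of t]
      sum_list_osum_esum[of t] card_blocks[of False t] by simp
  finally show ?thesis .
qed

text \<open>As for \<open>Q'\<close>, with an odd height. For \<open>esum t = 0\<close> the value 1
  fixed in the definition agrees with the empty products on the right.\<close>

lemma K_formula: "K t = vdm xsq (blocks False t) / H2 (2 * esum t)"
proof (cases "esum t \<ge> 1")
  case False
  then show ?thesis using blocks_esum_0[of t] by (simp add: K_def vdm_def H2_def)
next
  case True
  let ?h = "2 * int (esum t) - 1"
  let ?R = "half_region ?h (2 * int (sum_list t)) 0 - dent_union (t_dent_pairs t)"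
  have "K_region t = triangles_in (\<lambda>u k. 0 \<le> k \<and> k \<le> 2 * int (esum t) - 1 \<and>
       zigzag_right k \<le> u \<and> u \<le> real (sum_list t) - of_int k / 2) - t_dents t"
    by (simp add: K_region_def sum_list_osum_esum)
  then have cells: "cell_of ` K_region t = ?R"
    by (simp only: image_set_diff[OF inj_cell_of] cell_of_triangles_in cells_in_lower cell_of_t_dents)
  have "K t = M (\<lambda>_. 1) (K_region t)" using True by (simp add: K_def)
  also have "\<dots> = cell_sum (cell_of ` K_region t)"
  proof (rule M_eq_cell_sum)
    fix l assume l: "l \<subseteq> K_region t" "is_lozenge l"
    have "v \<noteq> 0" if "(i, v) \<in> cell_of ` l" for i v
    proof -
      have "(i, v) \<in> ?R" using l(1) cells that by blast
      moreover have "?h mod 2 = 1" by presburger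
      ultimately show ?thesis by (auto simp: half_region_def)
    qed
    then have "\<nexists>k. cell_of ` l = {(k, 0), (k + 1, 0)}" by (metis insertI1)
    then show "1 = cell_weight (cell_of ` l)" by (simp add: cell_weight_def)
  qed
  also have "\<dots> = cell_sum (half_region ?h (2 * int (sum_list t)) 0 - base_cells (blocks False t))"
    unfolding cells by (rule cell_sum_t_dents[symmetric]) simp
  also have "\<dots> = vdm xsq (blocks False t) / H2 (2 * esum t)"
    using lower_half_formula[OF blocks_subset_Icc[of False t], of "esum t"] blocks_esum_0[of t]
      sum_list_osum_esum[of t] card_blocks[of False t] by simp
  finally show ?thesis .
qed

section \<open>The two halves of the region and the cut along the base line\<close>

text \<open>The index starts at 2 because the first entry gives the half triangle at the zigzag,
  which is described by \<open>corner_cells\<close>. \<open>c\<close> is true for the dents above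
  the line.\<close>

definition as_dent_pairs :: "bool \<Rightarrow> nat list \<Rightarrow> (nat \<times> nat) set" where
  "as_dent_pairs c s = (\<lambda>i. (psum s (i - 1), psum s i)) ` {i. i \<in> {2..length s} \<and> odd i = c}"

definition bs_dent_pairs :: "bool \<Rightarrow> nat \<Rightarrow> nat list \<Rightarrow> (nat \<times> nat) set" where
  "bs_dent_pairs c w s = (\<lambda>j. (w - psum s j, w - psum s (j - 1))) ` {j. j \<in> {1..length s} \<and> odd j = c}"

lemma dent_union_Un: "dent_union (I \<union> J) = dent_union I \<union> dent_union J"
  by (auto simp: dent_union_def)

lemma cell_of_a_dents:
  "cell_of ` a_dents s = dent_union (as_dent_pairs True s) \<union> reflect ` dent_union (as_dent_pairs False s)"
proof -
  have "{2..length s} = {i. i \<in> {2..length s} \<and> odd i = True} \<union> {i. i \<in> {2..length s} \<and> odd i = False}"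
    (is "_ = ?A \<union> ?B") by auto
  then have "a_dents s = (\<Union>i\<in>?A. (if even i then down_dent else up_dent) (psum s (i - 1)) (psum s i))
      \<union> (\<Union>i\<in>?B. (if even i then down_dent else up_dent) (psum s (i - 1)) (psum s i))"
    unfolding a_dents_def by (metis (no_types) UN_Un)
  also have "\<dots> = (\<Union>i\<in>?A. up_dent (psum s (i - 1)) (psum s i)) \<union> (\<Union>i\<in>?B. down_dent (psum s (i - 1)) (psum s i))"
    by (intro arg_cong2[of _ _ _ _ "(\<union>)"] SUP_cong refl) auto
  finally show ?thesis
    by (simp add: image_Un image_UN cell_of_up_dent cell_of_down_dent dent_union_def as_dent_pairs_def)
qed

lemma cell_of_b_dents:
  "cell_of ` b_dents w s = dent_union (bs_dent_pairs True w s) \<union> reflect ` dent_union (bs_dent_pairs False w s)"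
proof -
  have "{1..length s} = {i. i \<in> {1..length s} \<and> odd i = True} \<union> {i. i \<in> {1..length s} \<and> odd i = False}"
    (is "_ = ?A \<union> ?B") by auto
  then have "b_dents w s = (\<Union>i\<in>?A. (if even i then down_dent else up_dent) (w - psum s i) (w - psum s (i - 1)))
      \<union> (\<Union>i\<in>?B. (if even i then down_dent else up_dent) (w - psum s i) (w - psum s (i - 1)))"
    unfolding b_dents_def by (metis (no_types) UN_Un)
  also have "\<dots> = (\<Union>i\<in>?A. up_dent (w - psum s i) (w - psum s (i - 1))) \<union> (\<Union>i\<in>?B. down_dent (w - psum s i) (w - psum s (i - 1)))"
    by (intro arg_cong2[of _ _ _ _ "(\<union>)"] SUP_cong refl) auto
  finally show ?thesis
    by (simp add: image_Un image_UN cell_of_up_dent cell_of_down_dent dent_union_def bs_dent_pairs_def)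
qed

lemma as_dent_pairs_bounds:
  assumes "(p, q) \<in> as_dent_pairs c s"
  shows "q \<le> sum_list s \<and> q \<le> p + (if c then osum s else esum s)"
proof -
  obtain i where i: "i \<in> {2..length s}" "odd i = c" "p = psum s (i - 1)" "q = psum s i"
    using assms by (auto simp: as_dent_pairs_def)
  have "entry s i \<le> (if c then osum s else esum s)"
    using entry_le_osum[of i s] entry_le_esum[of i s] i by auto
  then show ?thesis using psum_pred[of i s] psum_le[of s i] i by auto
qed

lemma bs_dent_pairs_bounds:
  assumes "(p, q) \<in> bs_dent_pairs c w s"
  shows "q \<le> w \<and> q \<le> p + (if c then osum s else esum s)"
proof -
  obtain i where i: "i \<in> {1..length s}" "odd i = c" "p = w - psum s i" "q = w - psum s (i - 1)"
    using assms by (auto simp: bs_dent_pairs_def)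
  have "entry s i \<le> (if c then osum s else esum s)"
    using entry_le_osum[of i s] entry_le_esum[of i s] i by auto
  then show ?thesis using psum_pred[of i s] i by auto
qed

lemma as_dent_pairs_blocks:
  "(if c then {0<..entry s 1} else {}) \<union> (\<Union>(p, q)\<in>as_dent_pairs c s. {p<..q}) = blocks c s"
proof (cases s)
  case Nil
  then show ?thesis by (simp add: as_dent_pairs_def entry_def)
next
  case (Cons x r)
  then have "1 \<in> {1..length s}" by simp
  then have "{i. i \<in> {1..length s} \<and> odd i = c} = (if c then {1} else {}) \<union> {i. i \<in> {2..length s} \<and> odd i = c}"
    by (auto simp: le_Suc_eq numeral_2_eq_2 not_less_eq_eq dest: antisym)
  then show ?thesis
    unfolding blocks_eq_UN by (simp add: as_dent_pairs_def psum_def)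
qed

lemma mirror_Ioc: "q \<le> w \<Longrightarrow> mirror w {p<..q} = {w - q<..w - p}"
proof (intro equalityI subsetI)
  fix r assume "q \<le> w" "r \<in> {w - q<..w - p}"
  then have "r = w + 1 - (w + 1 - r)" "w + 1 - r \<in> {p<..q}" by auto
  then show "r \<in> mirror w {p<..q}" unfolding mirror_def by (rule image_eqI)
qed (auto simp: mirror_def)

lemma bs_dent_pairs_blocks:
  assumes "sum_list s \<le> w"
  shows "(\<Union>(p, q)\<in>bs_dent_pairs c w s. {p<..q}) = mirror w (blocks c s)"
proof -
  have "psum s i \<le> w" for i using psum_le[of s i] assms by simp
  then have "mirror w {psum s (i - 1)<..psum s i} = {w - psum s i<..w - psum s (i - 1)}" for i
    by (rule mirror_Ioc)
  moreover have "mirror w (\<Union>i\<in>J. X i) = (\<Union>i\<in>J. mirror w (X i))" for J and X :: "nat \<Rightarrow> nat set"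
    unfolding mirror_def by (rule image_UN)
  ultimately show ?thesis
    unfolding blocks_eq_UN by (simp add: bs_dent_pairs_def)
qed

lemma dent_union_nonneg: "c \<in> dent_union I \<Longrightarrow> 0 \<le> fst c"
  by (auto simp: dent_union_def dent_cells_def)

lemma half_region_nonneg: "c \<in> half_region h w 0 \<Longrightarrow> 0 \<le> fst c"
  by (auto simp: half_region_def)

definition N2_upper_cells :: "nat \<Rightarrow> nat \<Rightarrow> nat list \<Rightarrow> nat list \<Rightarrow> (int \<times> int) set" where
  "N2_upper_cells x y as bs = half_region (N2_above y as bs) (2 * int (N2_length x y as bs)) 0
     - (corner_cells (entry as 1) \<union> dent_union (as_dent_pairs True as \<union> bs_dent_pairs True (N2_length x y as bs) bs))"

definition N2_lower_cells :: "nat \<Rightarrow> nat \<Rightarrow> nat \<Rightarrow> nat list \<Rightarrow> nat list \<Rightarrow> (int \<times> int) set" where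
  "N2_lower_cells x y z as bs = half_region (N2_below y z as bs) (2 * int (N2_length x y as bs + z)) 0
     - dent_union (insert (N2_length x y as bs, N2_length x y as bs + z)
         (as_dent_pairs False as \<union> bs_dent_pairs False (N2_length x y as bs) bs))"

lemma cell_of_N2_region:
  "cell_of ` N2_region x y z as bs = N2_upper_cells x y as bs \<union> reflect ` N2_lower_cells x y z as bs"
proof -
  define L where "L = N2_length x y as bs"
  define U where "U = half_region (N2_above y as bs) (2 * int L) 0"
  define V where "V = half_region (N2_below y z as bs) (2 * int (L + z)) 0"
  define DU where "DU = dent_union (as_dent_pairs True as \<union> bs_dent_pairs True L bs)"
  define DL where "DL = dent_union (as_dent_pairs False as \<union> bs_dent_pairs False L bs)"
  have up: "cell_of ` N2_upper x y as bs = U - corner_cells (entry as 1)"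
  proof -
    have "cell_of ` N2_upper x y as bs = U - {(i, v). v \<le> 2 * int (entry as 1) - i - 1}"
      unfolding N2_upper_def image_set_diff[OF inj_cell_of] cell_of_triangles_in N2_above_def cells_in_corner
        L_def[symmetric] cells_in_upper U_def ..
    also have "\<dots> = U - corner_cells (entry as 1)"
      by (auto simp: U_def half_region_def corner_cells_def N2_above_def)
    finally show ?thesis .
  qed
  have low: "cell_of ` N2_lower x y z as bs = reflect ` (V - dent_cells L (L + z))"
    unfolding N2_lower_def cell_of_triangles_in N2_below_def L_def[symmetric] V_def
    by (rule cells_in_N2_lower)
  have "cell_of ` N2_region x y z as bs = ((U - corner_cells (entry as 1)) \<union> reflect ` (V - dent_cells L (L + z)))
      - (dent_union (as_dent_pairs True as) \<union> reflect ` dent_union (as_dent_pairs False as))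
      - (dent_union (bs_dent_pairs True L bs) \<union> reflect ` dent_union (bs_dent_pairs False L bs))"
    unfolding N2_region_def image_set_diff[OF inj_cell_of] image_Un up low cell_of_a_dents cell_of_b_dents L_def ..
  also have "\<dots> = ((U - corner_cells (entry as 1)) \<union> reflect ` (V - dent_cells L (L + z))) - (DU \<union> reflect ` DL)"
    unfolding DU_def DL_def dent_union_Un image_Un by blast
  \<comment> \<open>Upper cells lie in strips of index at least 0 and reflected ones in strips of
    negative index, so the dents of one half do not meet the other half.\<close>
  also have "\<dots> = (U - (corner_cells (entry as 1) \<union> DU)) \<union> reflect ` (V - (dent_cells L (L + z) \<union> DL))"
  proof -
    have refl: "fst c < 0" if "c \<in> reflect ` X" "\<And>d. d \<in> X \<Longrightarrow> 0 \<le> fst d" for c X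
      using that by (fastforce simp: reflect_def)
    have "c \<notin> reflect ` DL" if "c \<in> U" for c
    proof
      assume "c \<in> reflect ` DL"
      then have "fst c < 0" by (rule refl) (unfold DL_def, rule dent_union_nonneg)
      then show False using half_region_nonneg[of c] that unfolding U_def by fastforce
    qed
    moreover have "c \<notin> DU" if "c \<in> reflect ` V" for c
    proof
      assume "c \<in> DU"
      then have "0 \<le> fst c" unfolding DU_def by (rule dent_union_nonneg)
      moreover have "fst c < 0" using that by (rule refl) (unfold V_def, rule half_region_nonneg)
      ultimately show False by simp
    qed
    ultimately show ?thesis unfolding image_set_diff[OF inj_reflect] image_Un by blast
  qed
  also have "dent_cells L (L + z) \<union> DL = dent_union (insert (L, L + z) (as_dent_pairs False as \<union> bs_dent_pairs False L bs))"
    by (simp add: dent_union_def DL_def)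
  finally show ?thesis unfolding N2_upper_cells_def N2_lower_cells_def U_def V_def DU_def L_def .
qed

text \<open>The cut runs between strip -1 and strip 0. A crossing lozenge sits in an odd column,
  hence never in column 0, and so has weight 1.\<close>

lemma cell_sum_cut_base:
  assumes fin: "finite A" "finite B" and A0: "\<And>i v. (i, v) \<in> A \<Longrightarrow> 0 \<le> i \<and> 0 \<le> v"
    and B0: "\<And>i v. (i, v) \<in> B \<Longrightarrow> 0 \<le> i \<and> 0 \<le> v"
  shows "cell_sum (A \<union> reflect ` B) = (\<Sum>S\<in>Pow {p. p \<ge> 1 \<and> (0, 2 * int p - 1) \<in> A \<inter> B}.
     cell_sum (A - base_cells S) * cell_sum (B - base_cells S))"
proof -
  let ?X = "{p. p \<ge> 1 \<and> (0, 2 * int p - 1) \<in> A \<inter> B}"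
  let ?V = "{v. even (v - - 1) \<and> (- 1, v) \<in> reflect ` B \<and> (- 1 + 1, v) \<in> A}"
  define q where "q p = 2 * int p - 1" for p
  have injq: "inj q" by (auto simp: inj_def q_def)
  have B': "(i, v) \<in> reflect ` B \<longleftrightarrow> (- 1 - i, v) \<in> B" for i v
    unfolding reflect_vimage by (simp add: reflect_def)
  have V: "?V = q ` ?X"
  proof (intro equalityI subsetI)
    fix v assume v: "v \<in> ?V"
    then have mem: "(0, v) \<in> A" "(0, v) \<in> B" and "odd v" unfolding B' by auto
    then obtain j where j: "v = 2 * j + 1" by (elim oddE)
    then have "v = 2 * int (nat j + 1) - 1" using A0[OF mem(1)] by simp
    then show "v \<in> q ` ?X" using mem unfolding q_def by (intro image_eqI[of _ _ "nat j + 1"]) auto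
  qed (auto simp: B' q_def)
  have "cell_sum (reflect ` B \<union> A) = (\<Sum>D\<in>Pow ?V. (\<Prod>v\<in>D. cell_factor v)
      * cell_sum (reflect ` B - Pair (- 1) ` D) * cell_sum (A - Pair (- 1 + 1) ` D))"
  proof (rule cell_sum_cut)
    show "i \<le> - 1" if "(i, v) \<in> reflect ` B" for i v using that B0[of "- 1 - i" v] unfolding B' by simp
    show "- 1 < i" if "(i, v) \<in> A" for i v using A0[OF that] by simp
  qed (use fin in auto)
  also have "\<dots> = (\<Sum>S\<in>Pow ?X. (\<Prod>v\<in>q ` S. cell_factor v)
      * cell_sum (reflect ` B - Pair (- 1) ` q ` S) * cell_sum (A - Pair (- 1 + 1) ` q ` S))"
  proof -
    have "inj_on ((`) q) (Pow ?X)" by (rule inj_onI) (simp only: inj_image_eq_iff[OF injq])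
    moreover have "Pow ?V = (`) q ` Pow ?X" unfolding V by (simp add: image_Pow_surj)
    ultimately show ?thesis by (simp only: sum.reindex o_def)
  qed
  also have "\<dots> = (\<Sum>S\<in>Pow ?X. cell_sum (A - base_cells S) * cell_sum (B - base_cells S))"
  proof (rule sum.cong[OF refl])
    fix S
    have "(\<Prod>v\<in>q ` S. cell_factor v) = 1"
      by (rule prod.neutral) (auto simp: q_def cell_factor_def, presburger)
    moreover have base: "base_cells S = Pair 0 ` q ` S" unfolding base_cells_Pair q_def ..
    moreover have "reflect ` B - Pair (- 1) ` q ` S = reflect ` (B - base_cells S)"
      unfolding base image_set_diff[OF inj_reflect] by (simp add: image_image reflect_def)
    ultimately show "(\<Prod>v\<in>q ` S. cell_factor v) * cell_sum (reflect ` B - Pair (- 1) ` q ` S)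
        * cell_sum (A - Pair (- 1 + 1) ` q ` S) = cell_sum (A - base_cells S) * cell_sum (B - base_cells S)"
      by (simp add: cell_sum_reflect)
  qed
  finally show ?thesis by (simp only: Un_commute)
qed

section \<open>The product formula\<close>

lemma base_mem_corner_dents:
  assumes "1 \<le> p"
  shows "(0, 2 * int p - 1) \<in> corner_cells a \<union> dent_union I \<longleftrightarrow> p \<in> {0<..a} \<union> (\<Union>(p, q)\<in>I. {p<..q})"
  using assms by (fastforce simp: corner_cells_def dent_union_def dent_cells_def)

lemma mirror_card: "X \<subseteq> {0<..w} \<Longrightarrow> card (mirror w X) = card X"
  unfolding mirror_def by (rule card_image) (fastforce simp: inj_on_def)

lemma mirror_Un: "mirror w (X \<union> Y) = mirror w X \<union> mirror w Y"
  unfolding mirror_def by (rule image_Un)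

lemma mirror_disjoint: "X \<subseteq> {0<..w} \<Longrightarrow> Y \<subseteq> {0<..w} \<Longrightarrow> X \<inter> Y = {} \<Longrightarrow> mirror w X \<inter> mirror w Y = {}"
proof -
  assume X: "X \<subseteq> {0<..w}" and Y: "Y \<subseteq> {0<..w}" and XY: "X \<inter> Y = {}"
  have "w + 1 - p \<noteq> w + 1 - q" if "p \<in> X" "q \<in> Y" for p q
  proof -
    have "p \<le> w" "q \<le> w" "p \<noteq> q" using that X Y XY by auto
    then show ?thesis by simp
  qed
  then show ?thesis unfolding mirror_def by blast
qed

text \<open>The factor \<open>2 ^ entry as 1\<close> compares two ways of removing the same base
  cells. Here the whole corner half triangle is cut off, together with its forced lozenges of weight
  1/2; in \<open>Q'\<close> only the full triangle over the base is removed, and these lozenges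
  still count.\<close>

lemma M_N2_formula:
  fixes x y z :: nat and as bs :: "nat list"
  defines "a \<equiv> sum_list as" and "c \<equiv> sum_list bs + z"
  shows "M_N2 x y z as bs = 2 ^ entry as 1 * Q' (t_plus x y as bs) * K (t_minus x y z as bs)
    * ((H2 (2 * osum as + 2 * osum bs + 1) * H2 (2 * esum as + 2 * esum bs + 2 * z))
       / (H2 (2 * osum as + 2 * osum bs + 2 * y + 1) * H2 (2 * esum as + 2 * esum bs + 2 * y + 2 * z)))
    * (\<Sum>S | S \<subseteq> {a + 1..a + (x + y)} \<and> card S = y. (\<Prod>s\<in>S. racah_weight a c (x + y) s) * (vdm xsq S)\<^sup>2)"
proof -
  define N where "N = x + y"
  define L where "L = N2_length x y as bs"
  define n where "n = y + osum as + osum bs"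
  define n' where "n' = y + z + esum as + esum bs"
  define P where "P = blocks True as \<union> mirror L (blocks True bs)"
  define R where "R = blocks False as \<union> mirror L (blocks False bs) \<union> {L<..L + z}"
  define A where "A = N2_upper_cells x y as bs"
  define B where "B = N2_lower_cells x y z as bs"
  define IU where "IU = as_dent_pairs True as \<union> bs_dent_pairs True L bs"
  define IL where "IL = insert (L, L + z) (as_dent_pairs False as \<union> bs_dent_pairs False L bs)"
  have L: "L = a + N + sum_list bs" "L + z = a + N + c"
    by (simp_all add: L_def N2_length_def a_def N_def c_def)
  have A: "A = half_region (2 * int n) (2 * int L) 0 - (corner_cells (entry as 1) \<union> dent_union IU)"
    by (simp add: A_def N2_upper_cells_def N2_above_def n_def L_def IU_def)
  have B: "B = half_region (2 * int n' - 1) (2 * int (L + z)) 0 - (corner_cells 0 \<union> dent_union IL)"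
    by (simp add: B_def N2_lower_cells_def N2_below_def n'_def L_def IL_def)
  have bsL: "blocks d bs \<subseteq> {0<..L}" for d using blocks_subset[of d bs] L by auto
  have asS: "blocks d as \<subseteq> {0<..a}" for d unfolding a_def by (rule blocks_subset)
  have bsS: "mirror L (blocks d bs) \<subseteq> {a + N<..L}" for d
  proof -
    have "mirror L (blocks d bs) \<subseteq> mirror L {0<..sum_list bs}"
      unfolding mirror_def by (rule image_mono) (rule blocks_subset)
    also have "\<dots> = {a + N<..L}" using mirror_Ioc[of "sum_list bs" L 0] L by simp
    finally show ?thesis .
  qed
  have fin: "finite P" "finite R"
    by (simp_all add: P_def R_def finite_blocks mirror_def)
  \<comment> \<open>Upper and lower dents alternate without gaps, so together they fill everything
    outside the free interval. This is why the weight depends only on \<open>a\<close> and on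
    \<open>c\<close>, the total of \<open>bs\<close> plus \<open>z\<close>.\<close>
  have PR: "P \<union> R = {0<..a} \<union> {a + N<..a + N + c}"
  proof -
    have "P \<union> R = (blocks True as \<union> blocks (\<not> True) as) \<union> mirror L (blocks True bs \<union> blocks (\<not> True) bs) \<union> {L<..L + z}"
      unfolding P_def R_def mirror_Un by auto
    also have "\<dots> = {0<..a} \<union> {a + N<..L} \<union> {L<..L + z}"
      unfolding blocks_Un a_def using mirror_Ioc[of "sum_list bs" L 0] L by (simp add: a_def)
    also have "\<dots> = {0<..a} \<union> {a + N<..a + N + c}" unfolding L(2)[symmetric] using L(1) by auto
    finally show ?thesis .
  qed
  have disj: "P \<inter> R = {}"
  proof -
    have "mirror L (blocks True bs) \<inter> mirror L (blocks False bs) = {}"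
      by (rule mirror_disjoint) (use bsL blocks_Int[of True bs] in auto)
    moreover have "blocks True as \<inter> blocks False as = {}" using blocks_Int[of True as] by simp
    moreover have "{0<..a} \<inter> {a + N<..L} = {}" "{0<..a} \<inter> {L<..L + z} = {}" "{a + N<..L} \<inter> {L<..L + z} = {}"
      using L by auto
    ultimately show ?thesis unfolding P_def R_def using asS bsS by blast
  qed
  have cardP: "card P = osum as + osum bs"
  proof -
    have "card P = card (blocks True as) + card (mirror L (blocks True bs))"
      unfolding P_def
    proof (rule card_Un_disjoint)
      show "blocks True as \<inter> mirror L (blocks True bs) = {}" using asS[of True] bsS[of True] by fastforce
    qed (simp_all add: finite_blocks mirror_def)
    then show ?thesis using mirror_card[OF bsL[of True]] by (simp add: card_blocks)
  qed
  have cardR: "card R = esum as + esum bs + z"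
  proof -
    have "card R = card (blocks False as \<union> mirror L (blocks False bs)) + card {L<..L + z}"
      unfolding R_def
    proof (rule card_Un_disjoint)
      show "(blocks False as \<union> mirror L (blocks False bs)) \<inter> {L<..L + z} = {}"
        using asS[of False] bsS[of False] L by fastforce
    qed (simp_all add: finite_blocks mirror_def)
    also have "card (blocks False as \<union> mirror L (blocks False bs)) = card (blocks False as) + card (mirror L (blocks False bs))"
    proof (rule card_Un_disjoint)
      show "blocks False as \<inter> mirror L (blocks False bs) = {}" using asS[of False] bsS[of False] by fastforce
    qed (simp_all add: finite_blocks mirror_def)
    finally show ?thesis using mirror_card[OF bsL[of False]] by (simp add: card_blocks)
  qed
  have dU: "{0<..entry as 1} \<union> (\<Union>(p, q)\<in>IU. {p<..q}) = P"
    using as_dent_pairs_blocks[of True as] bs_dent_pairs_blocks[of bs L True] L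
    unfolding IU_def P_def UN_Un by auto
  have dL: "{0<..0} \<union> (\<Union>(p, q)\<in>IL. {p<..q}) = R"
    using as_dent_pairs_blocks[of False as] bs_dent_pairs_blocks[of bs L False] L
    unfolding IL_def R_def UN_insert UN_Un by auto
  have a1n: "entry as 1 \<le> n"
  proof (cases "as = []")
    case False
    then show ?thesis using entry_le_osum[of 1 as] by (cases as) (auto simp: n_def)
  qed (simp add: entry_def)
  have nL: "n \<le> L" "n' \<le> L + z"
    using sum_list_osum_esum[of as] sum_list_osum_esum[of bs]
    by (auto simp: L_def N2_length_def n_def n'_def)
  have bndU: "q \<le> L \<and> q \<le> p + n" if "(p, q) \<in> IU" for p q
    using as_dent_pairs_bounds[of p q True as] bs_dent_pairs_bounds[of p q True L bs] that L
    by (auto simp: IU_def n_def a_def)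
  have bndL: "q \<le> L + z \<and> q \<le> p + n'" if "(p, q) \<in> IL" for p q
    using as_dent_pairs_bounds[of p q False as] bs_dent_pairs_bounds[of p q False L bs] that L
    by (auto simp: IL_def n'_def a_def)
  have A0: "0 \<le> i \<and> 0 \<le> v \<and> i < 2 * int n" if "(i, v) \<in> A" for i v
    using that by (auto simp: A half_region_def)
  have B0: "0 \<le> i \<and> 1 \<le> v" if "(i, v) \<in> B" for i v
  proof -
    have "(2 * int n' - 1) mod 2 = 1" by presburger
    then show ?thesis using that by (auto simp: B half_region_def)
  qed
  have cells: "cell_of ` N2_region x y z as bs = A \<union> reflect ` B"
    unfolding A_def B_def by (rule cell_of_N2_region)
  define X where "X = {p. p \<ge> 1 \<and> (0, 2 * int p - 1) \<in> A \<inter> B}"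
  have "M_N2 x y z as bs = cell_sum (cell_of ` N2_region x y z as bs)"
    unfolding M_N2_def
  proof (rule M_eq_cell_sum)
    fix l assume l: "l \<subseteq> N2_region x y z as bs" "is_lozenge l"
    show "zigzag_weight (N2_above y as bs) l = cell_weight (cell_of ` l)"
    proof (rule zigzag_weight_cell[OF l(2)])
      fix i v assume "(i, v) \<in> cell_of ` l"
      then have "(i, v) \<in> A \<union> reflect ` B" using l(1) cells by blast
      then show "0 \<le> v \<and> i < N2_above y as bs \<and> (v = 0 \<longrightarrow> 0 \<le> i)"
      proof
        assume "(i, v) \<in> A"
        then show ?thesis using A0[of i v] by (simp add: N2_above_def n_def)
      next
        assume "(i, v) \<in> reflect ` B"
        then have "(- 1 - i, v) \<in> B" unfolding reflect_vimage by (simp add: reflect_def)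
        then show ?thesis using B0[of "- 1 - i" v] by (simp add: N2_above_def)
      qed
    qed
  qed
  also have "\<dots> = (\<Sum>S\<in>Pow X. cell_sum (A - base_cells S) * cell_sum (B - base_cells S))"
    unfolding cells X_def
    by (rule cell_sum_cut_base) (use A0 B0 in \<open>force simp: A B finite_half_region\<close>)+
  also have "\<dots> = (\<Sum>S | S \<subseteq> {a + 1..a + N} \<and> card S = y.
      2 ^ entry as 1 * ((\<Prod>p\<in>S \<union> P. real p - 1 / 2) * vdm xsq (S \<union> P) / H2 (2 * n + 1)) * (vdm xsq (S \<union> R) / H2 (2 * n')))"
  proof -
    have Xmid: "X \<subseteq> {a + 1..a + N}"
    proof
      fix p assume p: "p \<in> X"
      then have p1: "1 \<le> p" by (simp add: X_def)
      have "p \<notin> P" using p base_mem_corner_dents[OF p1, of "entry as 1" IU] unfolding dU A X_def by auto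
      moreover have "p \<notin> R" using p base_mem_corner_dents[OF p1, of 0 IL] unfolding dL B X_def by auto
      ultimately have "p \<notin> {0<..a} \<union> {a + N<..a + N + c}" unfolding PR[symmetric] by blast
      moreover have "p \<le> L" using p by (auto simp: X_def A half_region_def)
      ultimately show "p \<in> {a + 1..a + N}" using p1 L by auto
    qed
    have midX: "{a + 1..a + N} \<subseteq> X" if nn: "n > 0" "n' > 0"
    proof
      fix p assume p: "p \<in> {a + 1..a + N}"
      then have p1: "1 \<le> p" by simp
      have "p \<notin> P \<union> R" unfolding PR using p by auto
      then have "(0, 2 * int p - 1) \<notin> corner_cells (entry as 1) \<union> dent_union IU"
        "(0, 2 * int p - 1) \<notin> corner_cells 0 \<union> dent_union IL"
        unfolding base_mem_corner_dents[OF p1] dU dL by auto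
      moreover have "(0, 2 * int p - 1) \<in> half_region (2 * int n) (2 * int L) 0"
        using p nn L by (auto simp: half_region_def)
      moreover have "(0, 2 * int p - 1) \<in> half_region (2 * int n' - 1) (2 * int (L + z)) 0"
      proof -
        have "(2 * int n' - 1) mod 2 = 1" by presburger
        then show ?thesis using p nn L by (auto simp: half_region_def)
      qed
      ultimately show "p \<in> X" using p1 by (simp add: X_def A B)
    qed
    have finX: "finite X" using Xmid finite_subset by blast
    \<comment> \<open>A half without strips admits no crossing; its height then forces
      \<open>y = 0\<close> as well, so that the empty set is the only index on both sides.\<close>
    have n0: "n = 0 \<Longrightarrow> X = {} \<and> P = {} \<and> y = 0"
      using cardP fin(1) by (auto simp: X_def A half_region_def n_def)
    have n0': "n' = 0 \<Longrightarrow> X = {} \<and> R = {} \<and> y = 0"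
      using cardR fin(2) by (auto simp: X_def B half_region_def n'_def)
    have SP: "S \<inter> P = {}" "S \<inter> R = {}" "finite S" if "S \<subseteq> {a + 1..a + N}" for S
    proof -
      have "{a + 1..a + N} \<inter> (P \<union> R) = {}" unfolding PR by auto
      then show "S \<inter> P = {}" "S \<inter> R = {}" using that by blast+
      show "finite S" using that finite_subset by blast
    qed
    have PL: "P \<subseteq> {1..L}"
      using asS[of True] bsS[of True] L unfolding P_def by fastforce
    have RL: "R \<subseteq> {1..L + z}"
      using asS[of False] bsS[of False] L unfolding R_def by fastforce
    have half: "(1 / 2 :: real) ^ k * c' = d \<Longrightarrow> c' = 2 ^ k * d" for k c' d
      by (auto simp: power_one_over)
    have cU: "cell_sum (A - base_cells S) = 2 ^ entry as 1
        * (if card S = y then (\<Prod>p\<in>S \<union> P. real p - 1 / 2) * vdm xsq (S \<union> P) / H2 (2 * n + 1) else 0)" if S: "S \<subseteq> X" for S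
    proof -
      have Sm: "S \<subseteq> {a + 1..a + N}" using S Xmid by blast
      have "cell_sum (half_region (2 * int n) (2 * int L) 0 - base_cells (S \<union> P))
        = (1 / 2) ^ entry as 1 * cell_sum (half_region (2 * int n) (2 * int L) 0 - base_cells S
            - (corner_cells (entry as 1) \<union> (\<Union>(p, q)\<in>IU. dent_cells p q)))"
        by (rule cell_sum_dents) (use a1n nL bndU dU SP[OF Sm] in auto)
      moreover have "half_region (2 * int n) (2 * int L) 0 - base_cells S
            - (corner_cells (entry as 1) \<union> (\<Union>(p, q)\<in>IU. dent_cells p q)) = A - base_cells S"
        unfolding A dent_union_def by blast
      moreover have "cell_sum (half_region (2 * int n) (2 * int L) 0 - base_cells (S \<union> P))
        = (if card (S \<union> P) = n then (\<Prod>p\<in>S \<union> P. real p - 1 / 2) * vdm xsq (S \<union> P) / H2 (2 * n + 1) else 0)"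
        by (rule upper_half_formula) (use PL Sm L nL n0 S in auto)
      \<comment> \<open>The height of a half fixes the number of its dents. Both halves thus ask for
        the same number \<open>y\<close> of crossings.\<close>
      moreover have "card (S \<union> P) = n \<longleftrightarrow> card S = y"
        using card_Un_disjoint[OF SP(3)[OF Sm] fin(1) SP(1)[OF Sm]] cardP by (auto simp: n_def)
      ultimately have "(1 / 2) ^ entry as 1 * cell_sum (A - base_cells S)
        = (if card S = y then (\<Prod>p\<in>S \<union> P. real p - 1 / 2) * vdm xsq (S \<union> P) / H2 (2 * n + 1) else 0)"
        by (simp only:)
      then show ?thesis by (rule half)
    qed
    have cL: "cell_sum (B - base_cells S)
        = (if card S = y then vdm xsq (S \<union> R) / H2 (2 * n') else 0)" if S: "S \<subseteq> X" for S
    proof -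
      have Sm: "S \<subseteq> {a + 1..a + N}" using S Xmid by blast
      have "cell_sum (half_region (2 * int n' - 1) (2 * int (L + z)) 0 - base_cells (S \<union> R))
        = (1 / 2) ^ 0 * cell_sum (half_region (2 * int n' - 1) (2 * int (L + z)) 0 - base_cells S
            - (corner_cells 0 \<union> (\<Union>(p, q)\<in>IL. dent_cells p q)))"
        by (rule cell_sum_dents) (use nL bndL dL SP[OF Sm] in auto)
      moreover have "half_region (2 * int n' - 1) (2 * int (L + z)) 0 - base_cells S
            - (corner_cells 0 \<union> (\<Union>(p, q)\<in>IL. dent_cells p q)) = B - base_cells S"
        unfolding B dent_union_def by blast
      moreover have "cell_sum (half_region (2 * int n' - 1) (2 * int (L + z)) 0 - base_cells (S \<union> R))
        = (if card (S \<union> R) = n' then vdm xsq (S \<union> R) / H2 (2 * n') else 0)"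
        by (rule lower_half_formula) (use RL Sm L nL n0' S in auto)
      moreover have "card (S \<union> R) = n' \<longleftrightarrow> card S = y"
        using card_Un_disjoint[OF SP(3)[OF Sm] fin(2) SP(2)[OF Sm]] cardR by (auto simp: n'_def)
      ultimately show ?thesis by simp
    qed
    show ?thesis
    proof (rule sum.mono_neutral_cong_right)
      show "finite (Pow X)" using finX by simp
      show "{S. S \<subseteq> {a + 1..a + N} \<and> card S = y} \<subseteq> Pow X"
      proof
        fix S assume S: "S \<in> {S. S \<subseteq> {a + 1..a + N} \<and> card S = y}"
        show "S \<in> Pow X"
        proof (cases "n > 0 \<and> n' > 0")
          case True
          then show ?thesis using S midX by blast
        next
          case False
          then have "y = 0" using n0 n0' by blast
          then show ?thesis using S SP(3)[of S] by simp
        qed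
      qed
      show "\<forall>S\<in>Pow X - {S. S \<subseteq> {a + 1..a + N} \<and> card S = y}. cell_sum (A - base_cells S) * cell_sum (B - base_cells S) = 0"
      proof
        fix S assume S: "S \<in> Pow X - {S. S \<subseteq> {a + 1..a + N} \<and> card S = y}"
        then have "S \<subseteq> X" "card S \<noteq> y" using Xmid by auto
        then show "cell_sum (A - base_cells S) * cell_sum (B - base_cells S) = 0" by (simp add: cL)
      qed
      fix S assume S: "S \<in> {S. S \<subseteq> {a + 1..a + N} \<and> card S = y}"
      then have "S \<subseteq> X" using \<open>{S. S \<subseteq> {a + 1..a + N} \<and> card S = y} \<subseteq> Pow X\<close> by blast
      then show "cell_sum (A - base_cells S) * cell_sum (B - base_cells S)
        = 2 ^ entry as 1 * ((\<Prod>p\<in>S \<union> P. real p - 1 / 2) * vdm xsq (S \<union> P) / H2 (2 * n + 1)) * (vdm xsq (S \<union> R) / H2 (2 * n'))"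
        using S by (simp add: cL cU)
    qed
  qed
  also have "\<dots> = (\<Sum>S | S \<subseteq> {a + 1..a + N} \<and> card S = y.
      (2 ^ entry as 1 * ((\<Prod>p\<in>P. real p - 1 / 2) * vdm xsq P / H2 (2 * n + 1)) * (vdm xsq R / H2 (2 * n')))
        * ((\<Prod>s\<in>S. racah_weight a c N s) * (vdm xsq S)\<^sup>2))"
  proof (rule sum.cong[OF refl])
    fix S assume "S \<in> {S. S \<subseteq> {a + 1..a + N} \<and> card S = y}"
    then have S: "S \<subseteq> {a + 1..a + N}" "finite S" by (auto intro: finite_subset)
    have "{a + 1..a + N} \<inter> (P \<union> R) = {}" unfolding PR by auto
    then have dS: "S \<inter> P = {}" "S \<inter> R = {}" using S(1) by blast+
    have one: "S \<union> P \<union> R \<subseteq> {1..}"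
    proof -
      have "P \<union> R \<subseteq> {1..}" unfolding PR by auto
      moreover have "S \<subseteq> {1..}" using S(1) by fastforce
      ultimately show ?thesis by blast
    qed
    have mono: "xsq p \<le> xsq q" if "p \<in> S \<union> P \<union> R" "p < q" for p q
      using one that by (intro xsq_mono) auto
    have vP: "vdm xsq (S \<union> P) = vdm xsq S * vdm xsq P * (\<Prod>s\<in>S. \<Prod>u\<in>P. \<bar>xsq s - xsq u\<bar>)"
      by (rule vdm_Un[OF S(2) fin(1) dS(1)]) (use mono in blast)
    have vR: "vdm xsq (S \<union> R) = vdm xsq S * vdm xsq R * (\<Prod>s\<in>S. \<Prod>u\<in>R. \<bar>xsq s - xsq u\<bar>)"
      by (rule vdm_Un[OF S(2) fin(2) dS(2)]) (use mono in blast)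
    have pP: "(\<Prod>p\<in>S \<union> P. real p - 1 / 2) = (\<Prod>s\<in>S. real s - 1 / 2) * (\<Prod>p\<in>P. real p - 1 / 2)"
      by (rule prod.union_disjoint[OF S(2) fin(1) dS(1)])
    have "(\<Prod>s\<in>S. racah_weight a c N s) = (\<Prod>s\<in>S. (real s - 1 / 2) * ((\<Prod>u\<in>P. \<bar>xsq s - xsq u\<bar>) * (\<Prod>u\<in>R. \<bar>xsq s - xsq u\<bar>)))"
    proof (rule prod.cong[OF refl])
      fix s assume "s \<in> S"
      then have "s \<in> {a + 1..a + N}" using S(1) by blast
      from prod_abs_racah_weight[OF this PR]
      show "racah_weight a c N s = (real s - 1 / 2) * ((\<Prod>u\<in>P. \<bar>xsq s - xsq u\<bar>) * (\<Prod>u\<in>R. \<bar>xsq s - xsq u\<bar>))"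
        by (simp add: prod.union_disjoint[OF fin disj])
    qed
    also have "\<dots> = (\<Prod>s\<in>S. real s - 1 / 2) * ((\<Prod>s\<in>S. \<Prod>u\<in>P. \<bar>xsq s - xsq u\<bar>) * (\<Prod>s\<in>S. \<Prod>u\<in>R. \<bar>xsq s - xsq u\<bar>))"
      by (simp only: prod.distrib)
    finally show "2 ^ entry as 1 * ((\<Prod>p\<in>S \<union> P. real p - 1 / 2) * vdm xsq (S \<union> P) / H2 (2 * n + 1)) * (vdm xsq (S \<union> R) / H2 (2 * n'))
      = (2 ^ entry as 1 * ((\<Prod>p\<in>P. real p - 1 / 2) * vdm xsq P / H2 (2 * n + 1)) * (vdm xsq R / H2 (2 * n')))
        * ((\<Prod>s\<in>S. racah_weight a c N s) * (vdm xsq S)\<^sup>2)"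
      unfolding vP vR pP by (simp add: power2_eq_square mult_ac)
  qed
  also have "\<dots> = (2 ^ entry as 1 * ((\<Prod>p\<in>P. real p - 1 / 2) * vdm xsq P / H2 (2 * n + 1)) * (vdm xsq R / H2 (2 * n')))
      * (\<Sum>S | S \<subseteq> {a + 1..a + N} \<and> card S = y. (\<Prod>s\<in>S. racah_weight a c N s) * (vdm xsq S)\<^sup>2)"
    by (rule sum_distrib_left[symmetric])
  also have "2 ^ entry as 1 * ((\<Prod>p\<in>P. real p - 1 / 2) * vdm xsq P / H2 (2 * n + 1)) * (vdm xsq R / H2 (2 * n'))
    = 2 ^ entry as 1 * Q' (t_plus x y as bs) * K (t_minus x y z as bs)
    * ((H2 (2 * osum as + 2 * osum bs + 1) * H2 (2 * esum as + 2 * esum bs + 2 * z))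
       / (H2 (2 * osum as + 2 * osum bs + 2 * y + 1) * H2 (2 * esum as + 2 * esum bs + 2 * y + 2 * z)))"
  proof -
    have H2pos: "H2 m > 0" for m unfolding H2_def by (intro prod_pos) simp
    have bP: "blocks False (t_plus x y as bs) = P" unfolding P_def L_def by (rule t_plus_blocks)
    have bR: "blocks False (t_minus x y z as bs) = R" unfolding R_def L_def by (rule t_minus_blocks)
    have eP: "esum (t_plus x y as bs) = osum as + osum bs"
      using card_blocks[of False "t_plus x y as bs"] unfolding bP cardP by simp
    have eR: "esum (t_minus x y z as bs) = esum as + esum bs + z"
      using card_blocks[of False "t_minus x y z as bs"] unfolding bR cardR by simp
    have "2 * osum as + 2 * osum bs + 1 = 2 * (osum as + osum bs) + 1"
      "2 * esum as + 2 * esum bs + 2 * z = 2 * (esum as + esum bs + z)"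
      "2 * osum as + 2 * osum bs + 2 * y + 1 = 2 * n + 1"
      "2 * esum as + 2 * esum bs + 2 * y + 2 * z = 2 * n'"
      by (simp_all add: n_def n'_def)
    note e = this
    show ?thesis unfolding Q'_formula K_formula bP bR eP eR e
      using H2pos[of "2 * (osum as + osum bs) + 1"] H2pos[of "2 * (esum as + esum bs + z)"] by simp
  qed
  finally show ?thesis unfolding N_def .
qed

lemma Q'_pos: "Q' t > 0"
proof -
  have "real p - 1 / 2 > 0" if "p \<in> blocks False t" for p
  proof -
    have "1 \<le> p" using blocks_subset_Icc that by fastforce
    then show ?thesis by simp
  qed
  moreover have "vdm xsq (blocks False t) > 0"
    by (rule vdm_xsq_pos) (use blocks_subset[of False t] in auto)
  moreover have "H2 m > 0" for m unfolding H2_def by (intro prod_pos) simp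
  ultimately show ?thesis unfolding Q'_formula by (intro divide_pos_pos mult_pos_pos prod_pos)
qed

lemma K_pos: "K t > 0"
proof -
  have "vdm xsq (blocks False t) > 0"
    by (rule vdm_xsq_pos) (use blocks_subset[of False t] in auto)
  moreover have "H2 m > 0" for m unfolding H2_def by (intro prod_pos) simp
  ultimately show ?thesis unfolding K_formula by (rule divide_pos_pos)
qed

lemma M_N2_product_formula:
  "M_N2 x y z as bs =
        2 powi (int (entry as 1) - int y) * Q' (t_plus x y as bs) * K (t_minus x y z as bs)
        * ((H2 (2 * osum as + 2 * osum bs + 1) * H2 (2 * esum as + 2 * esum bs + 2 * z))
           / (H2 (2 * osum as + 2 * osum bs + 2 * y + 1) * H2 (2 * esum as + 2 * esum bs + 2 * y + 2 * z)))
        * ((H (2 * sum_list as + sum_list bs + 2 * y + z) * H (sum_list bs + y + z))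
           / (H (2 * sum_list as + sum_list bs + y + z) * H (sum_list bs + z)))
        * ((T (x + 1) (2 * sum_list as + sum_list bs + 2 * y + z - 1) y
            * T (x + sum_list as + 1) (sum_list bs + 2 * y + z - 1) y)
           / (T 1 (2 * sum_list as + sum_list bs + 2 * y + z - 1) y
              * T (sum_list as + 1) (sum_list bs + 2 * y + z - 1) y))"
proof -
  define a where "a = sum_list as"
  define c where "c = sum_list bs + z"
  have "(\<Sum>S | S \<subseteq> {a + 1..a + (x + y)} \<and> card S = y. (\<Prod>s\<in>S. racah_weight a c (x + y) s) * (vdm xsq S)\<^sup>2)
    = 1 / 2 ^ y * ((H (2 * a + c + 2 * y) * H (c + y)) / (H (2 * a + c + y) * H c))
      * ((T (x + 1) (2 * a + c + 2 * y - 1) y * T (x + a + 1) (c + 2 * y - 1) y)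
        / (T 1 (2 * a + c + 2 * y - 1) y * T (a + 1) (c + 2 * y - 1) y))"
    unfolding racah_product_eq[symmetric] by (rule racah_selberg) simp
  note s = this
  \<comment> \<open>The \<open>y\<close> factors 1/2 come from the total masses, one for each row of
    the determinant; the exponent may be negative.\<close>
  have pw: "2 powi (int (entry as 1) - int y) = (2 ^ entry as 1 * (1 / 2 ^ y) :: real)"
    by (simp add: power_int_diff)
  have e: "2 * sum_list as + sum_list bs + 2 * y + z = 2 * a + c + 2 * y" "sum_list bs + y + z = c + y"
    "2 * sum_list as + sum_list bs + y + z = 2 * a + c + y" "sum_list bs + z = c"
    "sum_list bs + 2 * y + z = c + 2 * y"
    by (simp_all add: a_def c_def)
  show ?thesis
    unfolding M_N2_formula unfolding e unfolding a_def[symmetric] s pw by (simp add: mult_ac)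
qed

text \<open>The first identity is a regrouping of the second. The factors \<open>Q'\<close> and
  \<open>K\<close> depend on \<open>x\<close> and \<open>y\<close> only through
  \<open>x + y\<close>, so \<open>M_N2 (x + y) 0\<close> and \<open>M_N2 y 0\<close> deliver their
  ratio up to equal powers of 2, while \<open>M_N2 0 y\<close> delivers the part free of
  \<open>x\<close>.\<close>

theorem theorem2p13:
  fixes x y z :: nat and as bs :: "nat list"
  shows "let
      a = sum_list as; b = sum_list bs;
      o\<^sub>a = osum as; e\<^sub>a = esum as; o\<^sub>b = osum bs; e\<^sub>b = esum bs
    in
      M_N2 x y z as bs =
        (M_N2 (x + y) 0 z as bs * M_N2 0 y z as bs) / M_N2 y 0 z as bs
        * ((T (x + 1) (2 * a + b + 2 * y + z - 1) y * T (x + a + 1) (b + 2 * y + z - 1) y)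
           / (T 1 (2 * a + b + 2 * y + z - 1) y * T (a + 1) (b + 2 * y + z - 1) y))
      \<and>
      M_N2 x y z as bs =
        2 powi (int (entry as 1) - int y) * Q' (t_plus x y as bs) * K (t_minus x y z as bs)
        * ((H2 (2 * o\<^sub>a + 2 * o\<^sub>b + 1) * H2 (2 * e\<^sub>a + 2 * e\<^sub>b + 2 * z))
           / (H2 (2 * o\<^sub>a + 2 * o\<^sub>b + 2 * y + 1) * H2 (2 * e\<^sub>a + 2 * e\<^sub>b + 2 * y + 2 * z)))
        * ((H (2 * a + b + 2 * y + z) * H (b + y + z)) / (H (2 * a + b + y + z) * H (b + z)))
        * ((T (x + 1) (2 * a + b + 2 * y + z - 1) y * T (x + a + 1) (b + 2 * y + z - 1) y)
           / (T 1 (2 * a + b + 2 * y + z - 1) y * T (a + 1) (b + 2 * y + z - 1) y))"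
proof -
  have H2pos: "H2 m > 0" for m unfolding H2_def by (intro prod_pos) simp
  have Hpos: "H m > 0" for m unfolding H_def by (intro prod_pos) simp
  have T0: "T u m 0 = 1" for u m by (simp add: T_def)
  let ?G = "2 powi (int (entry as 1) - int y)
        * ((H2 (2 * osum as + 2 * osum bs + 1) * H2 (2 * esum as + 2 * esum bs + 2 * z))
           / (H2 (2 * osum as + 2 * osum bs + 2 * y + 1) * H2 (2 * esum as + 2 * esum bs + 2 * y + 2 * z)))
        * ((H (2 * sum_list as + sum_list bs + 2 * y + z) * H (sum_list bs + y + z))
           / (H (2 * sum_list as + sum_list bs + y + z) * H (sum_list bs + z)))"
  let ?t = "(T (x + 1) (2 * sum_list as + sum_list bs + 2 * y + z - 1) y
            * T (x + sum_list as + 1) (sum_list bs + 2 * y + z - 1) y)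
           / (T 1 (2 * sum_list as + sum_list bs + 2 * y + z - 1) y
              * T (sum_list as + 1) (sum_list bs + 2 * y + z - 1) y)"
  \<comment> \<open>For \<open>y = 0\<close> the products \<open>T\<close> are empty and the
    quotients of \<open>H\<close> and \<open>H2\<close> are 1.\<close>
  have zero: "M_N2 u 0 z as bs = 2 ^ entry as 1 * (Q' (t_plus u 0 as bs) * K (t_minus u 0 z as bs))" for u
    unfolding M_N2_product_formula using H2pos[THEN less_imp_neq] Hpos[THEN less_imp_neq]
    by (simp add: T0)
  have t: "t_plus (x + y) 0 as bs = t_plus x y as bs" "t_minus (x + y) 0 z as bs = t_minus x y z as bs"
    "t_plus 0 y as bs = t_plus y 0 as bs" "t_minus 0 y z as bs = t_minus y 0 z as bs"
    by (simp_all add: t_plus_def t_minus_def Let_def)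
  \<comment> \<open>For \<open>x = 0\<close> the numerator and the denominator of the quotient of
    the \<open>T\<close> coincide.\<close>
  have M0: "M_N2 0 y z as bs = ?G * (Q' (t_plus y 0 as bs) * K (t_minus y 0 z as bs))"
    unfolding M_N2_product_formula t
    using T_pos[of 1 "2 * sum_list as + sum_list bs + 2 * y + z - 1" y]
      T_pos[of "sum_list as + 1" "sum_list bs + 2 * y + z - 1" y] by simp
  have Mx: "M_N2 x y z as bs = ?G * (Q' (t_plus x y as bs) * K (t_minus x y z as bs)) * ?t"
    unfolding M_N2_product_formula by (simp only: mult_ac)
  have "M_N2 x y z as bs = (M_N2 (x + y) 0 z as bs * M_N2 0 y z as bs) / M_N2 y 0 z as bs * ?t"
  proof -
    have "Q' (t_plus y 0 as bs) * K (t_minus y 0 z as bs) \<noteq> 0"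
      using Q'_pos[of "t_plus y 0 as bs"] K_pos[of "t_minus y 0 z as bs"] by simp
    moreover have "(2 ^ k * r * (g * q)) / (2 ^ k * q) = g * r" if "q \<noteq> 0" for k and r g q :: real
      using that by simp
    ultimately show ?thesis unfolding Mx zero M0 t by (simp only: not_False_eq_True)
  qed
  moreover note M_N2_product_formula[of x y z as bs]
  ultimately show ?thesis unfolding Let_def by (rule conjI)
qed

end
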